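(* Let $(\Sigma,\sigma)$ be a topologically mixing countable Markov shift and let $\phi:\Sigma\to\mathbb{R}$ be a function of summable variations and finite pressure $P(\phi)<\infty$. Fix a symbol $a$ of the alphabet of $\Sigma$. Then, for every closed subset $\mathcal{K}\subset\mathcal{M}(\bar\sigma)$, $$\limsup_{n\to\infty}\frac1n\log\left(\frac{\sum_{x\in \mathrm{Per}_a(n),\,\mu_x\in\mathcal{K}}e^{S_n\phi(x)}}{\sum_{x\in \mathrm{Per}_a(n)}e^{S_n\phi(x)}}\right)\le-\inf\{I_\phi(\nu):\nu\in\mathcal{K}\}.$$
   Context: **Countable Markov shift.** Let $M$ be an $\mathbb{N}\times\mathbb{N}$ matrix with entries in $\{0,1\}$, $\Sigma=\{(x_1,x_2,\ldots)\in\mathbb{N}^{\mathbb{N}}: M(x_i,x_{i+1})=1\ \forall i\}$ with the topology induced from the product of discrete topologies, and $\sigma(x_1,x_2,\ldots)=(x_2,x_3,\ldots)$. A word $a_1\ldots a_m$ is admissible if $M(a_i,a_{i+1})=1$ for $1\le i\le m-1$. Cylinders are $[a_1,\ldots,a_m]=\{x\in\Sigma:x_i=a_i,\ 1\le i\le m\}$. $(\Sigma,\sigma)$ is topologically mixing if for all $a,b\in\mathbb{N}$ there is $N(a,b)$ such that for every $n\ge N(a,b)$ there is an admissible word of length $n$ starting with $a$ and ending with $b$. **Variations.** $V_n(\phi)=\sup\{|\phi(x)-\phi(y)|: x_i=y_i,\ 1\le i\le n\}$; $\phi$ has summable variations if $\sum_{n\ge2}V_n(\phi)<\infty$. $S_n\phi=\sum_{k=0}^{n-1}\phi\circ\sigma^k$.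 **Compactification.** $\rho(x,y)=\sum_{n\ge1}2^{-n}\left|\frac1{x_n}-\frac1{y_n}\right|$ on $\Sigma$. The completion $\bar\Sigma$ of $(\Sigma,\rho)$ is a compact metric space (a subset of $(\mathbb{N}\cup\{\infty\})^{\mathbb{N}}$, with $1/\infty=0$), and $\sigma$ extends to a continuous map $\bar\sigma:\bar\Sigma\to\bar\Sigma$. $\mathrm{UC}_{b,\rho}(\Sigma)$ is the space of bounded, uniformly $\rho$-continuous functions $g:\Sigma\to\mathbb{R}$; each has a unique continuous extension $\bar g:\bar\Sigma\to\mathbb{R}$. $\mathcal{M}(\bar\sigma)$ is the space of $\bar\sigma$-invariant Borel probability measures on $\bar\Sigma$ with the weak$^*$ topology; $\mathcal{M}(\sigma)$ is the space of $\sigma$-invariant Borel probability measures on $\Sigma$ (viewed inside $\mathcal{M}(\bar\sigma)$). **Pressure.** For $\psi=\phi+g$ with $\phi$ of summable variations and $g\in\mathrm{UC}_{b,\rho}(\Sigma)$, $P(\psi)=\sup\{h_\mu(\sigma)+\int\psi\,d\mu:\mu\in\mathcal{M}(\sigma),\ -\int\psi\,d\mu<\infty\}$, where $h_\mu(\sigma)$ is the entropy; for topologically mixing shifts this equals the Gurevich pressure $\lim_{n}\frac1n\log\sum_{\sigma^nx=x,\,x_1=a}e^{S_n\psi(x)}$ for any symbol $a$. **Periodic measures.** $\mathrm{Per}_a(n)=\{x\in[a]:\sigma^n(x)=x\}$, and for $x\in\mathrm{Per}_a(n)$, $\mu_x=\frac1n\sum_{k=0}^{n-1}\delta_{\sigma^k(x)}$.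 **Rate function.** For $\mu\in\mathcal{M}(\bar\sigma)$, $I_\phi(\mu)=\sup\{\int\bar g\,d\mu-P(\phi+g)+P(\phi): g\in\mathrm{UC}_{b,\rho}(\Sigma)\}\in[0,+\infty]$. Conventions: $\log 0=-\infty$, $\inf\emptyset=+\infty$. *)

theory Defs
  imports "HOL-Probability.Probability"
begin

text \<open>
  The alphabet \<open>{1, 2, \<dots>}\<close> is modelled by the type \<^typ>\<open>nat\<close>, the value \<open>m\<close> standing for the
  symbol \<open>m + 1\<close>, and sequences are indexed from \<open>0\<close>. A 0-1 transition matrix is a relation
  \<open>M :: nat \<Rightarrow> nat \<Rightarrow> bool\<close>. Functions on the shift space are total functions on
  \<^typ>\<open>nat \<Rightarrow> nat\<close> of which only the values on \<open>Shift M\<close> are used.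
\<close>

section \<open>Countable Markov shifts\<close>

definition Shift :: "(nat \<Rightarrow> nat \<Rightarrow> bool) \<Rightarrow> (nat \<Rightarrow> nat) set" where
  "Shift M = {x. \<forall>i. M (x i) (x (Suc i))}"

definition shift :: "(nat \<Rightarrow> 'a) \<Rightarrow> (nat \<Rightarrow> 'a)" where
  "shift x = (\<lambda>i. x (Suc i))"

definition admissible :: "(nat \<Rightarrow> nat \<Rightarrow> bool) \<Rightarrow> nat list \<Rightarrow> bool" where
  "admissible M w \<longleftrightarrow> (\<forall>i. Suc i < length w \<longrightarrow> M (w ! i) (w ! Suc i))"

definition cylinder :: "(nat \<Rightarrow> nat \<Rightarrow> bool) \<Rightarrow> nat list \<Rightarrow> (nat \<Rightarrow> nat) set" where
  "cylinder M w = {x \<in> Shift M. \<forall>i < length w. x i = w ! i}"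

definition topologically_mixing :: "(nat \<Rightarrow> nat \<Rightarrow> bool) \<Rightarrow> bool" where
  "topologically_mixing M \<longleftrightarrow>
     (\<forall>a b. \<exists>N. \<forall>n\<ge>N. \<exists>w. admissible M w \<and> length w = n \<and> w \<noteq> [] \<and> hd w = a \<and> last w = b)"

definition variation :: "(nat \<Rightarrow> nat \<Rightarrow> bool) \<Rightarrow> ((nat \<Rightarrow> nat) \<Rightarrow> real) \<Rightarrow> nat \<Rightarrow> ennreal" where
  "variation M \<phi> n =
     (SUP (x, y) \<in> {(x, y). x \<in> Shift M \<and> y \<in> Shift M \<and> (\<forall>i<n. x i = y i)}.
        ennreal \<bar>\<phi> x - \<phi> y\<bar>)"

text \<open>The sum starts at \<open>n = 2\<close>; the first variation may be infinite.\<close>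

definition summable_variations :: "(nat \<Rightarrow> nat \<Rightarrow> bool) \<Rightarrow> ((nat \<Rightarrow> nat) \<Rightarrow> real) \<Rightarrow> bool" where
  "summable_variations M \<phi> \<longleftrightarrow> (\<Sum>n. variation M \<phi> (n + 2)) < \<infinity>"

definition birkhoff_sum :: "nat \<Rightarrow> ((nat \<Rightarrow> nat) \<Rightarrow> real) \<Rightarrow> (nat \<Rightarrow> nat) \<Rightarrow> real" where
  "birkhoff_sum n \<phi> x = (\<Sum>k<n. \<phi> ((shift ^^ k) x))"

definition Per :: "(nat \<Rightarrow> nat \<Rightarrow> bool) \<Rightarrow> nat \<Rightarrow> nat \<Rightarrow> (nat \<Rightarrow> nat) set" where
  "Per M a n = {x \<in> cylinder M [a]. (shift ^^ n) x = x}"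

section \<open>The compactification\<close>

text \<open>The reciprocal \<open>1 / (m + 1)\<close> of the symbol coded by \<open>m\<close>, with \<open>1 / \<infinity> = 0\<close>.\<close>

definition recip :: "enat \<Rightarrow> real" where
  "recip m = (case m of enat k \<Rightarrow> 1 / real (Suc k) | \<infinity> \<Rightarrow> 0)"

text \<open>The weight of coordinate \<open>i\<close> is \<open>2^-(i+1)\<close> since coordinates are indexed from \<open>0\<close>.\<close>

definition rho :: "(nat \<Rightarrow> enat) \<Rightarrow> (nat \<Rightarrow> enat) \<Rightarrow> real" where
  "rho x y = (\<Sum>i. (1/2) ^ Suc i * \<bar>recip (x i) - recip (y i)\<bar>)"

definition emb :: "(nat \<Rightarrow> nat) \<Rightarrow> (nat \<Rightarrow> enat)" where
  "emb x = (\<lambda>i. enat (x i))"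

lemma recip_bounds: "0 \<le> recip m" "recip m \<le> 1"
  by (cases m; simp add: recip_def)+

lemma recip_inj: "recip m = recip m' \<Longrightarrow> m = m'"
  by (cases m; cases m') (auto simp: recip_def)

lemma rho_summable: "summable (\<lambda>i. (1/2) ^ Suc i * \<bar>recip (x i) - recip (y i)\<bar>)"
proof (rule summable_comparison_test')
  show "summable (\<lambda>i. (1/2::real) ^ Suc i)"
    by (rule summable_Suc_iff[THEN iffD2]) (simp add: summable_geometric)
  fix i :: nat
  have "\<bar>recip (x i) - recip (y i)\<bar> \<le> 1"
    using recip_bounds[of "x i"] recip_bounds[of "y i"] by linarith
  then show "norm ((1/2) ^ Suc i * \<bar>recip (x i) - recip (y i)\<bar>) \<le> (1/2::real) ^ Suc i"
    by (simp add: abs_mult mult_left_le)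
qed

lemma Metric_space_rho: "Metric_space UNIV rho"
proof
  fix x y z :: "nat \<Rightarrow> enat"
  show "0 \<le> rho x y"
    unfolding rho_def by (rule suminf_nonneg[OF rho_summable]) simp
  show "rho x y = rho y x"
    by (simp add: rho_def abs_minus_commute)
  show "rho x y = 0 \<longleftrightarrow> x = y"
    unfolding rho_def
    by (subst suminf_eq_zero_iff[OF rho_summable]) (auto intro: recip_inj)
  have "rho x z \<le> (\<Sum>i. (1/2) ^ Suc i * \<bar>recip (x i) - recip (y i)\<bar> +
                      (1/2) ^ Suc i * \<bar>recip (y i) - recip (z i)\<bar>)"
    unfolding rho_def
  proof (rule suminf_le[OF _ rho_summable summable_add[OF rho_summable rho_summable]])
    fix i :: nat
    show "(1/2::real) ^ Suc i * \<bar>recip (x i) - recip (z i)\<bar> \<le>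
        (1/2) ^ Suc i * \<bar>recip (x i) - recip (y i)\<bar> + (1/2) ^ Suc i * \<bar>recip (y i) - recip (z i)\<bar>"
      unfolding distrib_left[symmetric] by (rule mult_left_mono) auto
  qed
  then show "rho x z \<le> rho x y + rho y z"
    unfolding rho_def suminf_add[OF rho_summable rho_summable] .
qed

text \<open>
  \<open>(nat \<Rightarrow> enat, rho)\<close> is a compact metric space, so the completion of \<open>(Shift M, rho)\<close> is the
  closure of \<open>Shift M\<close> in it. The continuous extension of the shift to it is again \<open>shift\<close>.
\<close>

definition Shift_bar :: "(nat \<Rightarrow> nat \<Rightarrow> bool) \<Rightarrow> (nat \<Rightarrow> enat) set" where
  "Shift_bar M = Metric_space.mtopology UNIV rho closure_of (emb ` Shift M)"

definition Shift_bar_top :: "(nat \<Rightarrow> nat \<Rightarrow> bool) \<Rightarrow> (nat \<Rightarrow> enat) topology" where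
  "Shift_bar_top M = subtopology (Metric_space.mtopology UNIV rho) (Shift_bar M)"

definition UCb :: "(nat \<Rightarrow> nat \<Rightarrow> bool) \<Rightarrow> ((nat \<Rightarrow> nat) \<Rightarrow> real) set" where
  "UCb M = {g. bounded (g ` Shift M) \<and>
      (\<forall>e>0. \<exists>d>0. \<forall>x\<in>Shift M. \<forall>y\<in>Shift M. rho (emb x) (emb y) < d \<longrightarrow> \<bar>g x - g y\<bar> < e)}"

definition extend :: "(nat \<Rightarrow> nat \<Rightarrow> bool) \<Rightarrow> ((nat \<Rightarrow> nat) \<Rightarrow> real) \<Rightarrow> (nat \<Rightarrow> enat) \<Rightarrow> real" where
  "extend M g = (THE h. h \<in> extensional (Shift_bar M)
      \<and> continuous_map (Shift_bar_top M) euclideanreal h \<and> (\<forall>x\<in>Shift M. h (emb x) = g x))"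

section \<open>Invariant measures\<close>

definition inv_measures :: "(nat \<Rightarrow> nat \<Rightarrow> bool) \<Rightarrow> (nat \<Rightarrow> nat) measure set" where
  "inv_measures M = {\<mu>. sets \<mu> = sets (restrict_space borel (Shift M)) \<and> prob_space \<mu>
      \<and> distr \<mu> \<mu> shift = \<mu>}"

definition borel_bar :: "(nat \<Rightarrow> nat \<Rightarrow> bool) \<Rightarrow> (nat \<Rightarrow> enat) measure" where
  "borel_bar M = sigma (Shift_bar M) {U. openin (Shift_bar_top M) U}"

definition inv_measures_bar :: "(nat \<Rightarrow> nat \<Rightarrow> bool) \<Rightarrow> (nat \<Rightarrow> enat) measure set" where
  "inv_measures_bar M = {\<mu>. sets \<mu> = sets (borel_bar M) \<and> prob_space \<mu> \<and> distr \<mu> \<mu> shift = \<mu>}"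

definition weak_star :: "(nat \<Rightarrow> nat \<Rightarrow> bool) \<Rightarrow> (nat \<Rightarrow> enat) measure topology" where
  "weak_star M = topology_generated_by
     {{\<mu> \<in> inv_measures_bar M. (\<integral>y. f y \<partial>\<mu>) \<in> U} |f U.
        continuous_map (Shift_bar_top M) euclideanreal f \<and> open U}"

text \<open>The measure \<open>1/n (\<delta>_x + \<delta>_{shift x} + \<dots> + \<delta>_{shift^(n-1) x})\<close>, as a measure on \<open>Shift_bar M\<close>.\<close>

definition orbit_measure :: "(nat \<Rightarrow> nat \<Rightarrow> bool) \<Rightarrow> nat \<Rightarrow> (nat \<Rightarrow> nat) \<Rightarrow> (nat \<Rightarrow> enat) measure" where
  "orbit_measure M n x = measure_of (Shift_bar M) (sets (borel_bar M))
     (\<lambda>A. (\<Sum>k<n. emeasure (return (borel_bar M) (emb ((shift ^^ k) x))) A) / of_nat n)"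

section \<open>Entropy, pressure and rate function\<close>

text \<open>
  A finite measurable partition is given by a function \<open>f\<close> with finitely many values and measurable
  level sets. The join of its preimages under the first \<open>n\<close> iterates of the shift is then the
  partition into the level sets of \<open>x \<mapsto> (f x, f (shift x), \<dots>, f (shift^(n-1) x))\<close>, and \<open>entropy\<close>
  with base \<open>e\<close> is the Shannon entropy \<open>- \<Sum> p ln p\<close> of a partition.
\<close>

definition itinerary :: "((nat \<Rightarrow> nat) \<Rightarrow> nat) \<Rightarrow> nat \<Rightarrow> (nat \<Rightarrow> nat) \<Rightarrow> nat list" where
  "itinerary f n x = map (\<lambda>k. f ((shift ^^ k) x)) [0..<n]"

definition partition_entropy :: "(nat \<Rightarrow> nat) measure \<Rightarrow> ((nat \<Rightarrow> nat) \<Rightarrow> nat) \<Rightarrow> real" where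
  "partition_entropy \<mu> f = lim (\<lambda>n. (1 / real n) *
     prob_space.entropy \<mu> (exp 1) (count_space (itinerary f n ` space \<mu>)) (itinerary f n))"

definition ks_entropy :: "(nat \<Rightarrow> nat) measure \<Rightarrow> ereal" where
  "ks_entropy \<mu> = (SUP f \<in> {f. simple_function \<mu> f}. ereal (partition_entropy \<mu> f))"

text \<open>
  The extended integral is meaningful only if the integral of the positive or of the negative part
  is finite. A function has integral \<open>> -\<infinity>\<close> iff its negative part has finite integral; this is
  how the condition \<open>- \<integral>\<psi> d\<mu> < \<infinity>\<close> is expressed in the pressure, where the value \<open>+\<infinity>\<close> of
  the integral is permitted.
\<close>

definition ext_integral :: "'a measure \<Rightarrow> ('a \<Rightarrow> real) \<Rightarrow> ereal" where
  "ext_integral \<mu> \<psi> =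
     enn2ereal (\<integral>\<^sup>+x. ennreal (\<psi> x) \<partial>\<mu>) - enn2ereal (\<integral>\<^sup>+x. ennreal (- \<psi> x) \<partial>\<mu>)"

definition pressure :: "(nat \<Rightarrow> nat \<Rightarrow> bool) \<Rightarrow> ((nat \<Rightarrow> nat) \<Rightarrow> real) \<Rightarrow> ereal" where
  "pressure M \<psi> = (SUP \<mu> \<in> {\<mu> \<in> inv_measures M. (\<integral>\<^sup>+x. ennreal (- \<psi> x) \<partial>\<mu>) < \<infinity>}.
     ks_entropy \<mu> + ext_integral \<mu> \<psi>)"

definition rate ::
  "(nat \<Rightarrow> nat \<Rightarrow> bool) \<Rightarrow> ((nat \<Rightarrow> nat) \<Rightarrow> real) \<Rightarrow> (nat \<Rightarrow> enat) measure \<Rightarrow> ereal" where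
  "rate M \<phi> \<mu> = (SUP g \<in> UCb M.
     ereal (\<integral>y. extend M g y \<partial>\<mu>) - pressure M (\<lambda>x. \<phi> x + g x) + pressure M \<phi>)"

definition elog :: "ennreal \<Rightarrow> ereal" where
  "elog r = (if r = 0 then -\<infinity> else if r = \<infinity> then \<infinity> else ereal (ln (enn2real r)))"

end

theory Submission
  imports Defs
begin

text \<open>
  Write \<open>Z_n(\<psi>)\<close> for the sum of \<open>exp (birkhoff_sum n \<psi> x)\<close> over the points \<open>x\<close> of \<open>Per M a n\<close>, and \<open>P\<close> for
  the pressure. The upper bound is Chebyshev's inequality together with compactness. If the integral of
  the extension of \<open>g\<close> over the orbit measure of \<open>x\<close> exceeds \<open>c\<close>, then \<open>birkhoff_sum n g x > n * c\<close>, so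
  these \<open>x\<close> contribute at most \<open>exp (- n * c) * Z_n(\<phi> + g)\<close> to \<open>Z_n(\<phi>)\<close>. If \<open>\<alpha>\<close> is below the infimum of
  the rate over \<open>K\<close>, each \<open>\<nu>\<close> in \<open>K\<close> has a \<open>g\<close> whose integral exceeds \<open>P(\<phi> + g) - P(\<phi>) + \<alpha>\<close>. By
  compactness finitely many \<open>g\<close> suffice for all of \<open>K\<close> (\<open>finite_subcover\<close>), and the quotient is at most a
  constant times \<open>exp (- n * \<alpha>)\<close>, up to subexponential factors, as soon as
  \<open>limsup (1 / n) log Z_n(\<phi> + g) \<le> P(\<phi> + g)\<close> and \<open>liminf (1 / n) log Z_n(\<phi>) \<ge> P(\<phi>)\<close>.
  The pressure being a supremum over invariant measures, these are the two halves of a variational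
  principle.

  The first half (\<open>eventually_Zper_le\<close>) constructs measures. A finite set of loops at \<open>a\<close> of length \<open>n\<close> may
  be concatenated freely. The Bernoulli measure on concatenations with weights proportional to
  \<open>exp (birkhoff_sum n \<psi> x)\<close>, averaged over the \<open>n\<close> phases, has free energy \<open>(1 / n) log\<close> of the sum of
  the weights, up to the distortion of \<open>birkhoff_sum n \<psi>\<close>, which is \<open>o(n)\<close> for \<open>\<psi> = \<phi> + g\<close>.

  The second half (\<open>eventually_Zper_ge\<close>) bounds \<open>h + \<integral>\<phi> d\<mu>\<close> for every invariant \<open>\<mu>\<close> and every finite
  measurable partition \<open>f\<close>. If \<open>Z_l(\<phi>) \<le> exp (C + l * p)\<close> for all \<open>l\<close>, the loops at \<open>a\<close> with weights
  \<open>exp (birkhoff_sum l \<phi> z)\<close> define a code for itineraries of \<open>f\<close>, and by the Gibbs inequality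
  (\<open>shannon_le_cost\<close>) the mean code length bounds the entropy. The part of an orbit segment between the
  first and the last visit to the symbols \<open>{..m}\<close> is closed up to a loop (\<open>closing_lemma\<close>); the rest is
  coded uniformly. The cost of the rest is charged to the time spent above \<open>m\<close>, which by invariance has
  small mean. That liminf and not only limsup is controlled follows from the approximate
  supermultiplicativity of \<open>Z_n\<close> (\<open>Zper_growth\<close>).

  For compactness, the compactification is embedded into a Cantor set of reals (\<open>encode\<close>). Helly's
  selection theorem for real distributions then gives sequential compactness of the invariant measures
  (\<open>inv_measures_bar_seq_compact\<close>), and a countable dense set of step functions turns this into finite
  covers.
\<close>

section \<open>Shannon entropy and subadditive sequences\<close>

text \<open>
  The Shannon entropy of the partition into the level sets of \<open>X\<close>, written as the integral of the
  information function. This form turns every entropy estimate below into a pointwise estimate.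
\<close>

definition shannon :: "'a measure \<Rightarrow> ('a \<Rightarrow> 'b) \<Rightarrow> real" where
  "shannon \<mu> X = (\<integral>x. - ln (measure \<mu> {y \<in> space \<mu>. X y = X x}) \<partial>\<mu>)"

lemma expectation_simple:
  fixes h :: "'b \<Rightarrow> real"
  assumes "prob_space \<mu>" and X: "simple_function \<mu> X"
  shows "integrable \<mu> (\<lambda>x. h (X x))"
    and "(\<integral>x. h (X x) \<partial>\<mu>) = (\<Sum>u\<in>X ` space \<mu>. measure \<mu> {y \<in> space \<mu>. X y = u} * h u)"
proof -
  interpret prob_space \<mu> by fact
  have fin: "finite (X ` space \<mu>)" using X by (rule simple_functionD)
  have lev: "{y \<in> space \<mu>. X y = u} \<in> sets \<mu>" for u
  proof -
    have "X -` {u} \<inter> space \<mu> \<in> sets \<mu>" using X by (rule simple_functionD)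
    moreover have "X -` {u} \<inter> space \<mu> = {y \<in> space \<mu>. X y = u}" by auto
    ultimately show ?thesis by simp
  qed
  have eq: "h (X x) = (\<Sum>u\<in>X ` space \<mu>. h u * indicator {y \<in> space \<mu>. X y = u} x)" if "x \<in> space \<mu>" for x
  proof -
    have "(\<Sum>u\<in>X ` space \<mu>. h u * indicator {y \<in> space \<mu>. X y = u} x) = (\<Sum>u\<in>X ` space \<mu>. if u = X x then h u else 0)"
      using that by (intro sum.cong) (auto simp: indicator_def)
    also have "\<dots> = h (X x)" using fin that by (simp add: sum.delta)
    finally show ?thesis by simp
  qed
  have int: "integrable \<mu> (\<lambda>x. \<Sum>u\<in>X ` space \<mu>. h u * indicator {y \<in> space \<mu>. X y = u} x)"
    using lev by (intro Bochner_Integration.integrable_sum integrable_mult_right integrable_real_indicator)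
      (auto simp: emeasure_eq_measure)
  then show "integrable \<mu> (\<lambda>x. h (X x))"
    by (subst Bochner_Integration.integrable_cong[OF refl eq])
  have "(\<integral>x. h (X x) \<partial>\<mu>) = (\<integral>x. (\<Sum>u\<in>X ` space \<mu>. h u * indicator {y \<in> space \<mu>. X y = u} x) \<partial>\<mu>)"
    by (intro Bochner_Integration.integral_cong refl eq)
  also have "\<dots> = (\<Sum>u\<in>X ` space \<mu>. measure \<mu> {y \<in> space \<mu>. X y = u} * h u)"
    using lev
    by (subst Bochner_Integration.integral_sum) (auto simp: emeasure_eq_measure mult.commute Int_absorb2 intro!: sum.cong)
  finally show "(\<integral>x. h (X x) \<partial>\<mu>) = (\<Sum>u\<in>X ` space \<mu>. measure \<mu> {y \<in> space \<mu>. X y = u} * h u)" .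
qed

lemma entropy_eq_shannon:
  assumes "prob_space \<mu>" and X: "simple_function \<mu> X"
  shows "prob_space.entropy \<mu> (exp 1) (count_space (X ` space \<mu>)) X = shannon \<mu> X"
proof -
  interpret prob_space \<mu> by fact
  interpret information_space \<mu> "exp 1" by unfold_locales simp
  have "entropy (exp 1) (count_space (X ` space \<mu>)) X =
    - (\<Sum>u\<in>X ` space \<mu>. measure \<mu> (X -` {u} \<inter> space \<mu>) * log (exp 1) (measure \<mu> (X -` {u} \<inter> space \<mu>)))"
    by (rule entropy_simple_distributed[OF simple_distributedI[OF X measure_nonneg refl]])
  also have "\<dots> = (\<Sum>u\<in>X ` space \<mu>. measure \<mu> {y \<in> space \<mu>. X y = u} * - ln (measure \<mu> {y \<in> space \<mu>. X y = u}))"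
    unfolding sum_negf[symmetric]
    proof (intro sum.cong refl)
    fix u
    have "X -` {u} \<inter> space \<mu> = {y \<in> space \<mu>. X y = u}" by auto
    then show "- (measure \<mu> (X -` {u} \<inter> space \<mu>) * log (exp 1) (measure \<mu> (X -` {u} \<inter> space \<mu>))) =
       measure \<mu> {y \<in> space \<mu>. X y = u} * - ln (measure \<mu> {y \<in> space \<mu>. X y = u})"
      by (simp add: log_def)
  qed
  also have "\<dots> = shannon \<mu> X"
    unfolding shannon_def
    by (rule expectation_simple(2)[OF assms, where h="\<lambda>u. - ln (measure \<mu> {y \<in> space \<mu>. X y = u})", symmetric])
  finally show ?thesis .
qed

lemma shannon_integrable:
  assumes "prob_space \<mu>" and X: "simple_function \<mu> X"
  shows "integrable \<mu> (\<lambda>x. - ln (measure \<mu> {y \<in> space \<mu>. X y = X x}))"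
  by (rule expectation_simple(1)[OF assms, where h="\<lambda>u. - ln (measure \<mu> {y \<in> space \<mu>. X y = u})"])

lemma shannon_nonneg:
  assumes "prob_space \<mu>"
  shows "0 \<le> shannon \<mu> X"
proof -
  interpret prob_space \<mu> by fact
  have "0 \<le> - ln (measure \<mu> {y \<in> space \<mu>. X y = X x})" for x
    using prob_le_1[of "{y \<in> space \<mu>. X y = X x}"] measure_nonneg[of \<mu> "{y \<in> space \<mu>. X y = X x}"]
    by (cases "measure \<mu> {y \<in> space \<mu>. X y = X x} = 0") (auto simp: less_le)
  then show ?thesis unfolding shannon_def by (intro integral_nonneg_AE) auto
qed

lemma AE_cell_pos:
  assumes "prob_space \<mu>" and X: "simple_function \<mu> X"
  shows "AE x in \<mu>. 0 < measure \<mu> {y \<in> space \<mu>. X y = X x}"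
proof -
  interpret prob_space \<mu> by fact
  let ?p = "\<lambda>u. measure \<mu> {y \<in> space \<mu>. X y = u}"
  have "AE x in \<mu>. \<forall>u\<in>X ` space \<mu>. X x = u \<longrightarrow> 0 < ?p u"
  proof (subst AE_finite_all)
    show "finite (X ` space \<mu>)" using X by (rule simple_functionD)
    show "\<forall>u\<in>X ` space \<mu>. AE x in \<mu>. X x = u \<longrightarrow> 0 < ?p u"
    proof
      fix u assume "u \<in> X ` space \<mu>"
      have "X -` {u} \<inter> space \<mu> \<in> sets \<mu>" using X by (rule simple_functionD)
      moreover have "X -` {u} \<inter> space \<mu> = {y \<in> space \<mu>. X y = u}" by auto
      ultimately have s: "{y \<in> space \<mu>. X y = u} \<in> sets \<mu>" by simp
      show "AE x in \<mu>. X x = u \<longrightarrow> 0 < ?p u"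
      proof (cases "?p u = 0")
        case True
        then have "AE x in \<mu>. x \<notin> {y \<in> space \<mu>. X y = u}"
          using s by (intro AE_not_in) (auto simp: null_sets_def emeasure_eq_measure)
        moreover have "AE x in \<mu>. x \<in> space \<mu>" by (rule AE_space)
        ultimately show ?thesis by eventually_elim auto
      next
        case False
        then show ?thesis by (simp add: zero_less_measure_iff)
      qed
    qed
  qed
  moreover have "AE x in \<mu>. x \<in> space \<mu>" by (rule AE_space)
  ultimately show ?thesis by eventually_elim auto
qed

text \<open>
  The Gibbs inequality, in the language of codes: if \<open>Q\<close> is a subprobability on the values of \<open>X\<close>
  and \<open>cost x\<close> bounds the code length \<open>- ln (Q (X x))\<close>, then the mean cost is at least the entropy.
  With \<open>p\<close> the law of \<open>X\<close> it follows from \<open>ln t \<le> t - 1\<close> at \<open>t = Q / p\<close>. All upper and all lower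
  bounds for entropies in this development come from this lemma, by a suitable choice of \<open>Q\<close>.
\<close>

lemma shannon_le_cost:
  assumes \<mu>: "prob_space \<mu>" and X: "simple_function \<mu> X"
    and Q0: "\<And>u. u \<in> X ` space \<mu> \<Longrightarrow> 0 \<le> Q u" and Q1: "(\<Sum>u\<in>X ` space \<mu>. Q u) \<le> 1"
    and c: "integrable \<mu> cost" and le: "AE x in \<mu>. exp (- cost x) \<le> Q (X x)"
  shows "shannon \<mu> X \<le> (\<integral>x. cost x \<partial>\<mu>)"
proof -
  interpret prob_space \<mu> by fact
  let ?p = "\<lambda>u. measure \<mu> {y \<in> space \<mu>. X y = u}"
  note i1 = shannon_integrable[OF \<mu> X]
  note i2 = expectation_simple[OF \<mu> X, of "\<lambda>u. Q u / ?p u"]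
  have "(\<integral>x. - ln (?p (X x)) - cost x \<partial>\<mu>) \<le> (\<integral>x. Q (X x) / ?p (X x) - 1 \<partial>\<mu>)"
  proof (rule integral_mono_AE)
    show "integrable \<mu> (\<lambda>x. - ln (?p (X x)) - cost x)" using i1 c by (rule Bochner_Integration.integrable_diff)
    show "integrable \<mu> (\<lambda>x. Q (X x) / ?p (X x) - 1)" using i2(1) by simp
    show "AE x in \<mu>. - ln (?p (X x)) - cost x \<le> Q (X x) / ?p (X x) - 1"
      using le AE_cell_pos[OF \<mu> X]
    proof eventually_elim
      case (elim x)
      have q: "0 < Q (X x)" using elim(1) exp_gt_zero less_le_trans by blast
      have "- cost x \<le> ln (Q (X x))" using elim(1) q by (simp add: ln_ge_iff)
      moreover have "ln (Q (X x) / ?p (X x)) \<le> Q (X x) / ?p (X x) - 1"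
        using q elim(2) by (intro ln_le_minus_one divide_pos_pos)
      moreover have "ln (Q (X x) / ?p (X x)) = ln (Q (X x)) - ln (?p (X x))"
        using q elim(2) by (simp add: ln_div)
      ultimately show ?case by linarith
    qed
  qed
  also have "(\<integral>x. Q (X x) / ?p (X x) - 1 \<partial>\<mu>) = (\<Sum>u\<in>X ` space \<mu>. ?p u * (Q u / ?p u)) - 1"
    using i2 by (simp add: prob_space)
  also have "\<dots> \<le> (\<Sum>u\<in>X ` space \<mu>. Q u) - 1"
    using Q0 by (intro diff_right_mono sum_mono) auto
  also have "\<dots> \<le> 0" using Q1 by simp
  finally show ?thesis using i1 c by (simp add: shannon_def)
qed

lemma simple_function_sum_measure:
  assumes "prob_space \<mu>" and "simple_function \<mu> X"
  shows "(\<Sum>u\<in>X ` space \<mu>. measure \<mu> {y \<in> space \<mu>. X y = u}) = 1"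
  using expectation_simple(2)[OF assms, of "\<lambda>_. 1"] prob_space.prob_space[OF assms(1)] by simp

text \<open>
  The limit in the definition of the entropy of a partition exists by subadditivity, and it is the
  infimum of the sequence.
\<close>

lemma fekete:
  fixes a :: "nat \<Rightarrow> real"
  assumes sub: "\<And>n m. a (n + m) \<le> a n + a m" and nn: "\<And>n. 0 \<le> a n"
  shows "\<exists>L. (\<lambda>n. a n / real n) \<longlonglongrightarrow> L \<and> (\<forall>n>0. L \<le> a n / real n)"
proof -
  define L where "L = (INF n\<in>{0<..}. a n / real n)"
  have bdd: "bdd_below ((\<lambda>n. a n / real n) ` {0<..})" using nn by (intro bdd_belowI[of _ 0]) auto
  have low: "L \<le> a n / real n" if "n > 0" for n
    unfolding L_def using bdd that by (intro cINF_lower) auto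
  have mult: "a (q * m + r) \<le> real q * a m + a r" for q m r
  proof (induction q)
    case (Suc q)
    have "a (Suc q * m + r) = a (m + (q * m + r))" by (simp add: algebra_simps)
    also have "\<dots> \<le> a m + a (q * m + r)" by (rule sub)
    finally show ?case using Suc by (simp add: algebra_simps)
  qed simp
  have "(\<lambda>n. a n / real n) \<longlonglongrightarrow> L"
  proof (rule LIMSEQ_I)
    fix e :: real assume e: "0 < e"
    have "\<exists>n\<in>{0<..}. a n / real n < L + e / 2"
      using cINF_less_iff[of "{0<..}" "\<lambda>n. a n / real n" "L + e / 2"] bdd e unfolding L_def by auto
    then obtain m where m: "m > 0" "a m / real m < L + e / 2" by auto
    define B where "B = (\<Sum>r<m. a r)"
    have B: "a r \<le> B" if "r < m" for r
      unfolding B_def using that nn by (intro member_le_sum) auto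
    have B0: "0 \<le> B" unfolding B_def using nn by (intro sum_nonneg) auto
    obtain N :: nat where N: "B / (e / 2) < real N" using reals_Archimedean2 by blast
    show "\<exists>no. \<forall>n\<ge>no. norm (a n / real n - L) < e"
    proof (intro exI[of _ "Suc N"] allI impI)
      fix n assume n: "Suc N \<le> n"
      have "a n = a (n div m * m + n mod m)" by simp
      also have "\<dots> \<le> real (n div m) * a m + a (n mod m)" by (rule mult)
      also have "\<dots> \<le> real (n div m) * a m + B" using B[of "n mod m"] m by simp
      also have "real (n div m) * a m = real (n div m * m) * (a m / real m)" using m by simp
      also have "\<dots> \<le> real n * (a m / real m)"
        using nn[of m] m by (intro mult_right_mono) (auto simp: divide_nonneg_nonneg simp del: of_nat_mult)
      also have "real n * (a m / real m) \<le> real n * (L + e / 2)"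
        using m by (intro mult_left_mono) auto
      finally have "a n \<le> real n * (L + e / 2) + B" by simp
      moreover have "B < real n * (e / 2)"
      proof -
        have "B < real N * (e / 2)" using N e by (simp add: field_simps)
        also have "\<dots> \<le> real n * (e / 2)" using n e by (intro mult_right_mono) auto
        finally show ?thesis .
      qed
      ultimately have "a n < real n * (L + e)" by (simp add: algebra_simps)
      then have "a n / real n < L + e" using n by (simp add: field_simps)
      moreover have "L \<le> a n / real n" using n by (intro low) auto
      ultimately show "norm (a n / real n - L) < e" by simp
    qed
  qed
  with low show ?thesis by blast
qed

section \<open>Entropy of shift-invariant measures\<close>

lemma shift_in_Shift: "x \<in> Shift M \<Longrightarrow> shift x \<in> Shift M"
  by (simp add: Shift_def shift_def)

lemma shift_pow_apply: "(shift ^^ k) x i = x (i + k)"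
  by (induction k arbitrary: x i) (simp_all add: shift_def)

lemma shift_pow_in_Shift: "x \<in> Shift M \<Longrightarrow> (shift ^^ k) x \<in> Shift M"
  by (simp add: Shift_def shift_pow_apply)

abbreviation borel_Shift :: "(nat \<Rightarrow> nat \<Rightarrow> bool) \<Rightarrow> (nat \<Rightarrow> nat) measure" where
  "borel_Shift M \<equiv> restrict_space borel (Shift M)"

lemma measurable_shift: "shift \<in> borel_Shift M \<rightarrow>\<^sub>M borel_Shift M"
proof (rule measurable_restrict_space3)
  show "(shift :: (nat \<Rightarrow> nat) \<Rightarrow> _) \<in> borel \<rightarrow>\<^sub>M borel"
    unfolding shift_def
    by (rule measurable_coordinatewise_then_product, rule measurable_product_then_coordinatewise) simp
  show "shift \<in> Shift M \<rightarrow> Shift M" by (auto intro: shift_in_Shift)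
qed

lemma inv_measuresD:
  assumes "\<mu> \<in> inv_measures M"
  shows "prob_space \<mu>" "sets \<mu> = sets (borel_Shift M)" "space \<mu> = Shift M" "distr \<mu> \<mu> shift = \<mu>"
  using assms sets_eq_imp_space_eq[of \<mu> "borel_Shift M"] by (auto simp: inv_measures_def space_restrict_space)

lemma inv_measures_shift:
  assumes "\<mu> \<in> inv_measures M"
  shows "shift ^^ k \<in> \<mu> \<rightarrow>\<^sub>M \<mu>" "distr \<mu> \<mu> (shift ^^ k) = \<mu>"
proof -
  have 1: "shift \<in> \<mu> \<rightarrow>\<^sub>M \<mu>"
    using measurable_shift measurable_cong_sets[OF inv_measuresD(2)[OF assms] inv_measuresD(2)[OF assms]] by auto
  show 2: "shift ^^ k \<in> \<mu> \<rightarrow>\<^sub>M \<mu>" for k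
    by (induction k) (use 1 in \<open>auto simp: id_def comp_def\<close>)
  show "distr \<mu> \<mu> (shift ^^ k) = \<mu>"
  proof (induction k)
    case 0 then show ?case by (simp add: id_def distr_id)
  next
    case (Suc k)
    have "distr \<mu> \<mu> (shift ^^ Suc k) = distr (distr \<mu> \<mu> (shift ^^ k)) \<mu> shift"
      using distr_distr[OF 1 2[of k]] by simp
    then show ?case unfolding Suc inv_measuresD(4)[OF assms] .
  qed
qed

lemma itinerary_Suc: "itinerary f (Suc n) x = itinerary f n x @ [f ((shift ^^ n) x)]"
  by (simp add: itinerary_def)

lemma length_itinerary [simp]: "length (itinerary f n x) = n"
  by (simp add: itinerary_def)

lemma itinerary_nth: "i < n \<Longrightarrow> itinerary f n x ! i = f ((shift ^^ i) x)"
  by (simp add: itinerary_def)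

lemma itinerary_add: "itinerary f (n + m) x = itinerary f n x @ itinerary f m ((shift ^^ n) x)"
proof (rule nth_equalityI)
  fix i assume "i < length (itinerary f (n + m) x)"
  then have i: "i < n + m" by simp
  have "(shift ^^ i) x = (shift ^^ (i - n)) ((shift ^^ n) x)" if "n \<le> i"
    using that fun_cong[OF funpow_add[of "i - n" n shift], of x] by simp
  with i show "itinerary f (n + m) x ! i = (itinerary f n x @ itinerary f m ((shift ^^ n) x)) ! i"
    by (cases "i < n") (simp_all add: nth_append itinerary_nth)
qed simp

lemma simple_function_itinerary:
  assumes "\<mu> \<in> inv_measures M" "simple_function \<mu> f"
  shows "simple_function \<mu> (itinerary f n)"
proof (induction n)
  case 0
  then show ?case by (simp add: itinerary_def)
next
  case (Suc n)
  have "simple_function \<mu> (\<lambda>x. f ((shift ^^ n) x))"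
    using simple_function_comp[OF inv_measures_shift(1)[OF assms(1)] assms(2)] by simp
  from simple_function_compose2[OF Suc this, of "\<lambda>a b. a @ [b]"]
  show ?case by (simp add: itinerary_Suc[abs_def])
qed

text \<open>
  An itinerary of length \<open>n + m\<close> is coded by the product of the laws of its first \<open>n\<close> and its last
  \<open>m\<close> symbols; by invariance the second factor has mean cost \<open>shannon \<mu> (itinerary f m)\<close>.
\<close>

lemma shannon_itinerary_subadditive:
  assumes \<mu>: "\<mu> \<in> inv_measures M" and f: "simple_function \<mu> f"
  shows "shannon \<mu> (itinerary f (n + m)) \<le> shannon \<mu> (itinerary f n) + shannon \<mu> (itinerary f m)"
proof -
  interpret prob_space \<mu> using inv_measuresD(1)[OF \<mu>] .
  note P = inv_measuresD(1)[OF \<mu>]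
  note S = simple_function_itinerary[OF \<mu> f]
  define p where "p k u = measure \<mu> {y \<in> space \<mu>. itinerary f k y = u}" for k u
  define Q where "Q u = p n (take n u) * p m (drop n u)" for u
  define c where "c k x = - ln (p k (itinerary f k x))" for k x
  have ci: "integrable \<mu> (c k)" for k
    using shannon_integrable[OF P S, of k] unfolding c_def p_def .
  have cs: "integrable \<mu> (\<lambda>x. c m ((shift ^^ n) x))" "(\<integral>x. c m ((shift ^^ n) x) \<partial>\<mu>) = (\<integral>x. c m x \<partial>\<mu>)"
  proof -
    note meas = inv_measures_shift[OF \<mu>, of n]
    show "integrable \<mu> (\<lambda>x. c m ((shift ^^ n) x))"
      using ci[of m] by (subst integrable_distr_eq[symmetric, OF meas(1)]) (simp_all add: meas(2))
    show "(\<integral>x. c m ((shift ^^ n) x) \<partial>\<mu>) = (\<integral>x. c m x \<partial>\<mu>)"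
      using integral_distr[OF meas(1), of "c m"] ci[of m] by (simp add: meas(2))
  qed
  have st: "(shift ^^ n) x \<in> space \<mu>" if "x \<in> space \<mu>" for x
    using that inv_measuresD(3)[OF \<mu>] by (auto intro: shift_pow_in_Shift)
  have fin: "finite (itinerary f k ` space \<mu>)" for k using S[of k] by (rule simple_functionD)
  have "shannon \<mu> (itinerary f (n + m)) \<le> (\<integral>x. c n x + c m ((shift ^^ n) x) \<partial>\<mu>)"
  proof (rule shannon_le_cost[OF P S, where Q = Q])
    show "0 \<le> Q u" for u unfolding Q_def p_def by simp
    let ?d = "\<lambda>u. (take n u, drop n u)"
    have inj: "inj_on ?d (itinerary f (n + m) ` space \<mu>)"
      by (rule inj_onI) (metis Pair_inject append_take_drop_id)
    have "(\<Sum>u\<in>itinerary f (n + m) ` space \<mu>. Q u) =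
        (\<Sum>(v, w)\<in>?d ` itinerary f (n + m) ` space \<mu>. p n v * p m w)"
      unfolding Q_def
      by (subst sum.reindex[OF inj]) simp
    also have "\<dots> \<le> (\<Sum>(v, w)\<in>itinerary f n ` space \<mu> \<times> itinerary f m ` space \<mu>. p n v * p m w)"
      using fin st by (intro sum_mono2) (auto simp: itinerary_add p_def)
    also have "\<dots> = (\<Sum>v\<in>itinerary f n ` space \<mu>. p n v) * (\<Sum>w\<in>itinerary f m ` space \<mu>. p m w)"
      by (simp add: sum_product sum.cartesian_product)
    also have "\<dots> = 1"
      using simple_function_sum_measure[OF P S] by (simp add: p_def)
    finally show "(\<Sum>u\<in>itinerary f (n + m) ` space \<mu>. Q u) \<le> 1" .
    show "integrable \<mu> (\<lambda>x. c n x + c m ((shift ^^ n) x))" using ci cs by simp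
    have A: "AE x in \<mu>. 0 < p k (itinerary f k x)" for k
      using AE_cell_pos[OF P S] unfolding p_def .
    have "AE x in distr \<mu> \<mu> (shift ^^ n). 0 < p m (itinerary f m x)"
      unfolding inv_measures_shift(2)[OF \<mu>] by (rule A)
    then have "AE x in \<mu>. 0 < p m (itinerary f m ((shift ^^ n) x))"
      by (rule AE_distrD[OF inv_measures_shift(1)[OF \<mu>]])
    then show "AE x in \<mu>. exp (- (c n x + c m ((shift ^^ n) x))) \<le> Q (itinerary f (n + m) x)"
      using A[of n]
      by eventually_elim (simp add: Q_def c_def itinerary_add exp_add)
  qed
  also have "\<dots> = (\<integral>x. c n x \<partial>\<mu>) + (\<integral>x. c m x \<partial>\<mu>)"
    using ci cs by simp
  also have "\<dots> = shannon \<mu> (itinerary f n) + shannon \<mu> (itinerary f m)"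
    by (simp add: shannon_def c_def p_def)
  finally show ?thesis .
qed

lemma partition_entropy_limit:
  assumes \<mu>: "\<mu> \<in> inv_measures M" and f: "simple_function \<mu> f"
  shows "(\<lambda>n. shannon \<mu> (itinerary f n) / real n) \<longlonglongrightarrow> partition_entropy \<mu> f"
    and "0 \<le> partition_entropy \<mu> f"
proof -
  obtain L where L: "(\<lambda>n. shannon \<mu> (itinerary f n) / real n) \<longlonglongrightarrow> L"
    using fekete[of "\<lambda>n. shannon \<mu> (itinerary f n)"]
      shannon_itinerary_subadditive[OF assms] shannon_nonneg[OF inv_measuresD(1)[OF \<mu>]] by blast
  have "partition_entropy \<mu> f = L"
    unfolding partition_entropy_def
    using L by (intro limI) (simp add: entropy_eq_shannon[OF inv_measuresD(1)[OF \<mu>] simple_function_itinerary[OF assms]])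
  with L show 1: "(\<lambda>n. shannon \<mu> (itinerary f n) / real n) \<longlonglongrightarrow> partition_entropy \<mu> f" by simp
  show "0 \<le> partition_entropy \<mu> f"
    by (rule LIMSEQ_le_const[OF 1]) (auto intro!: shannon_nonneg divide_nonneg_nonneg inv_measuresD(1)[OF \<mu>])
qed

lemma ks_entropy_nonneg:
  assumes "\<mu> \<in> inv_measures M"
  shows "0 \<le> ks_entropy \<mu>"
proof -
  have "simple_function \<mu> (\<lambda>_. 0 :: nat)" by simp
  then show ?thesis
    unfolding ks_entropy_def
    using partition_entropy_limit(2)[OF assms, of "\<lambda>_. 0"]
    by (intro SUP_upper2[of "\<lambda>_. 0"]) auto
qed

section \<open>Distortion of Birkhoff sums\<close>

text \<open>
  Agreement is required at the \<open>n + 1\<close> places \<open>0, \<dots>, n\<close>. The last summand of the Birkhoff sum is then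
  compared at two points that share two symbols, so that only variations of order at least \<open>2\<close> enter.
\<close>

definition bounded_distortion :: "(nat \<Rightarrow> nat \<Rightarrow> bool) \<Rightarrow> ((nat \<Rightarrow> nat) \<Rightarrow> real) \<Rightarrow> real \<Rightarrow> bool" where
  "bounded_distortion M \<psi> V \<longleftrightarrow> (\<forall>n. \<forall>x\<in>Shift M. \<forall>y\<in>Shift M. (\<forall>i\<le>n. x i = y i) \<longrightarrow>
     \<bar>birkhoff_sum n \<psi> x - birkhoff_sum n \<psi> y\<bar> \<le> V)"

text \<open>
  A uniformly continuous perturbation of a potential of summable variations has, in general,
  only distortion \<open>o(n)\<close>.
\<close>

definition tempered_distortion :: "(nat \<Rightarrow> nat \<Rightarrow> bool) \<Rightarrow> ((nat \<Rightarrow> nat) \<Rightarrow> real) \<Rightarrow> bool" where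
  "tempered_distortion M \<psi> \<longleftrightarrow> (\<forall>e>0. \<exists>C. \<forall>n. \<forall>x\<in>Shift M. \<forall>y\<in>Shift M. (\<forall>i\<le>n. x i = y i) \<longrightarrow>
     \<bar>birkhoff_sum n \<psi> x - birkhoff_sum n \<psi> y\<bar> \<le> C + e * real n)"

lemma birkhoff_sum_add: "birkhoff_sum n (\<lambda>x. \<phi> x + g x) x = birkhoff_sum n \<phi> x + birkhoff_sum n g x"
  by (simp add: birkhoff_sum_def sum.distrib)

lemma birkhoff_sum_cocycle:
  "birkhoff_sum (n + m) \<phi> x = birkhoff_sum n \<phi> x + birkhoff_sum m \<phi> ((shift ^^ n) x)"
proof (induction m)
  case (Suc m)
  have "(shift ^^ (n + m)) x = (shift ^^ m) ((shift ^^ n) x)"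
    using fun_cong[OF funpow_add[of m n shift], of x] by (simp add: add.commute)
  then show ?case using Suc by (simp add: birkhoff_sum_def)
qed (simp add: birkhoff_sum_def)

lemma tempered_distortion_add:
  assumes "tempered_distortion M \<phi>" "tempered_distortion M g"
  shows "tempered_distortion M (\<lambda>x. \<phi> x + g x)"
  unfolding tempered_distortion_def
proof (intro allI impI)
  fix e :: real assume "0 < e"
  then have e: "0 < e / 2" by simp
  obtain C where C: "\<forall>n. \<forall>x\<in>Shift M. \<forall>y\<in>Shift M. (\<forall>i\<le>n. x i = y i) \<longrightarrow>
     \<bar>birkhoff_sum n \<phi> x - birkhoff_sum n \<phi> y\<bar> \<le> C + e / 2 * real n"
    using assms(1) e unfolding tempered_distortion_def by blast
  obtain D where D: "\<forall>n. \<forall>x\<in>Shift M. \<forall>y\<in>Shift M. (\<forall>i\<le>n. x i = y i) \<longrightarrow>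
     \<bar>birkhoff_sum n g x - birkhoff_sum n g y\<bar> \<le> D + e / 2 * real n"
    using assms(2) e unfolding tempered_distortion_def by blast
  show "\<exists>C. \<forall>n. \<forall>x\<in>Shift M. \<forall>y\<in>Shift M. (\<forall>i\<le>n. x i = y i) \<longrightarrow>
     \<bar>birkhoff_sum n (\<lambda>x. \<phi> x + g x) x - birkhoff_sum n (\<lambda>x. \<phi> x + g x) y\<bar> \<le> C + e * real n"
  proof (intro exI[of _ "C + D"] allI ballI impI)
    fix n x y assume *: "x \<in> Shift M" "y \<in> Shift M" "\<forall>i\<le>n. x i = y i"
    have "\<bar>birkhoff_sum n \<phi> x - birkhoff_sum n \<phi> y\<bar> \<le> C + e / 2 * real n"
      "\<bar>birkhoff_sum n g x - birkhoff_sum n g y\<bar> \<le> D + e / 2 * real n" using C D * by blast+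
    then show "\<bar>birkhoff_sum n (\<lambda>x. \<phi> x + g x) x - birkhoff_sum n (\<lambda>x. \<phi> x + g x) y\<bar> \<le> C + D + e * real n"
      unfolding birkhoff_sum_add by (simp add: abs_if split: if_splits)
  qed
qed

lemma bounded_imp_tempered: "bounded_distortion M \<phi> V \<Longrightarrow> tempered_distortion M \<phi>"
  unfolding bounded_distortion_def tempered_distortion_def
proof (intro allI impI)
  fix e :: real
  assume *: "\<forall>n. \<forall>x\<in>Shift M. \<forall>y\<in>Shift M. (\<forall>i\<le>n. x i = y i) \<longrightarrow>
      \<bar>birkhoff_sum n \<phi> x - birkhoff_sum n \<phi> y\<bar> \<le> V" and "0 < e"
  then have "V \<le> V + e * real n" for n by simp
  with * show "\<exists>C. \<forall>n. \<forall>x\<in>Shift M. \<forall>y\<in>Shift M. (\<forall>i\<le>n. x i = y i) \<longrightarrow>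
      \<bar>birkhoff_sum n \<phi> x - birkhoff_sum n \<phi> y\<bar> \<le> C + e * real n"
    by (meson order_trans)
qed

lemma summable_variations_modulus:
  assumes "summable_variations M \<phi>"
  obtains v where "\<forall>n. 0 \<le> v n" "summable v"
    "\<forall>n. \<forall>x\<in>Shift M. \<forall>y\<in>Shift M. (\<forall>i<n + 2. x i = y i) \<longrightarrow> \<bar>\<phi> x - \<phi> y\<bar> \<le> v n"
proof -
  have fin: "(\<Sum>n. variation M \<phi> (n + 2)) \<noteq> top"
    using assms unfolding summable_variations_def by (simp add: less_top)
  have f: "variation M \<phi> (n + 2) \<noteq> top" for n
  proof -
    have "sum (\<lambda>n. variation M \<phi> (n + 2)) {n} \<le> (\<Sum>n. variation M \<phi> (n + 2))"
      by (rule sum_le_suminf) (auto simp: summableI)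
    then show ?thesis using fin by (auto simp: top_unique)
  qed
  define v where "v n = enn2real (variation M \<phi> (n + 2))" for n
  have ev: "ennreal (v n) = variation M \<phi> (n + 2)" for n
    using f[of n] by (simp add: v_def less_top)
  show ?thesis
  proof (rule that)
    show "\<forall>n. 0 \<le> v n" by (simp add: v_def)
    show "summable v"
      using fin by (intro summable_suminf_not_top) (simp_all add: ev, simp add: v_def)
    show "\<forall>n. \<forall>x\<in>Shift M. \<forall>y\<in>Shift M. (\<forall>i<n + 2. x i = y i) \<longrightarrow> \<bar>\<phi> x - \<phi> y\<bar> \<le> v n"
    proof (intro allI ballI impI)
    fix n x y assume *: "x \<in> Shift M" "y \<in> Shift M" "\<forall>i<n + 2. x i = y i"
    have "ennreal \<bar>\<phi> x - \<phi> y\<bar> \<le> variation M \<phi> (n + 2)"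
      unfolding variation_def using * by (intro SUP_upper2[of "(x, y)"]) auto
    then show "\<bar>\<phi> x - \<phi> y\<bar> \<le> v n" using ennreal_le_iff[of "v n" "\<bar>\<phi> x - \<phi> y\<bar>"]
      unfolding ev[symmetric] by (simp add: v_def)
    qed
  qed
qed

lemma summable_variations_bounded_distortion:
  assumes "summable_variations M \<phi>"
  obtains V where "0 \<le> V" "bounded_distortion M \<phi> V"
proof -
  obtain v where v: "\<forall>n. 0 \<le> v n" "summable v"
    "\<forall>n. \<forall>x\<in>Shift M. \<forall>y\<in>Shift M. (\<forall>i<n + 2. x i = y i) \<longrightarrow> \<bar>\<phi> x - \<phi> y\<bar> \<le> v n"
    using summable_variations_modulus[OF assms] by blast
  have "bounded_distortion M \<phi> (suminf v)"
    unfolding bounded_distortion_def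
  proof (intro allI ballI impI)
    fix n x y assume xy: "x \<in> Shift M" "y \<in> Shift M" and ag: "\<forall>i\<le>n. x i = y i"
    have "\<bar>birkhoff_sum n \<phi> x - birkhoff_sum n \<phi> y\<bar> \<le> (\<Sum>k<n. \<bar>\<phi> ((shift ^^ k) x) - \<phi> ((shift ^^ k) y)\<bar>)"
      unfolding birkhoff_sum_def sum_subtractf[symmetric] by (rule sum_abs)
    also have "\<dots> \<le> (\<Sum>k<n. v (n - Suc k))"
      using ag by (intro sum_mono v(3)[rule_format] shift_pow_in_Shift xy) (auto simp: shift_pow_apply)
    also have "\<dots> = (\<Sum>k<n. v k)" by (rule sum.nat_diff_reindex)
    also have "\<dots> \<le> suminf v" using v by (intro sum_le_suminf) auto
    finally show "\<bar>birkhoff_sum n \<phi> x - birkhoff_sum n \<phi> y\<bar> \<le> suminf v" .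
  qed
  moreover have "0 \<le> suminf v" using v by (intro suminf_nonneg) auto
  ultimately show ?thesis using that by blast
qed

lemma open_cylinder: "open {y :: nat \<Rightarrow> nat. \<forall>i<n. y i = x i}"
proof -
  have "open ((\<lambda>y :: nat \<Rightarrow> nat. y i) -` {x i})" for i
    by (rule open_vimage[OF discrete_topology_class.open_discrete continuous_on_product_coordinates])
  then have "open (\<Inter>i\<in>{..<n}. (\<lambda>y :: nat \<Rightarrow> nat. y i) -` {x i})" by blast
  moreover have "(\<Inter>i\<in>{..<n}. (\<lambda>y :: nat \<Rightarrow> nat. y i) -` {x i}) = {y. \<forall>i<n. y i = x i}" by auto
  ultimately show ?thesis by simp
qed

lemma measurable_Shift_locally_determined:
  fixes \<psi> :: "(nat \<Rightarrow> nat) \<Rightarrow> real"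
  assumes "\<And>e. 0 < e \<Longrightarrow> \<exists>n. \<forall>x\<in>Shift M. \<forall>y\<in>Shift M. (\<forall>i<n. x i = y i) \<longrightarrow> \<bar>\<psi> x - \<psi> y\<bar> < e"
  shows "\<psi> \<in> borel_measurable (borel_Shift M)"
proof (rule borel_measurable_continuous_on_restrict)
  show "continuous_on (Shift M) \<psi>"
    unfolding continuous_on_topological
  proof (intro ballI allI impI)
    fix x B assume x: "x \<in> Shift M" "open B" "\<psi> x \<in> B"
    then obtain e where e: "0 < e" "\<And>r. \<bar>\<psi> x - r\<bar> < e \<Longrightarrow> r \<in> B"
      using open_dist[of B] by (auto simp: dist_real_def abs_minus_commute)
    obtain n where "\<forall>x\<in>Shift M. \<forall>y\<in>Shift M. (\<forall>i<n. x i = y i) \<longrightarrow> \<bar>\<psi> x - \<psi> y\<bar> < e"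
      using assms[OF e(1)] by blast
    with e x show "\<exists>A. open A \<and> x \<in> A \<and> (\<forall>y\<in>Shift M. y \<in> A \<longrightarrow> \<psi> y \<in> B)"
      by (intro exI[of _ "{y. \<forall>i<n. y i = x i}"]) (auto simp: open_cylinder)
  qed
qed

lemma summable_variations_measurable:
  assumes "summable_variations M \<phi>"
  shows "\<phi> \<in> borel_measurable (borel_Shift M)"
proof (rule measurable_Shift_locally_determined)
  fix e :: real assume e: "0 < e"
  obtain v where v: "\<forall>n. 0 \<le> v n" "summable v"
    "\<forall>n. \<forall>x\<in>Shift M. \<forall>y\<in>Shift M. (\<forall>i<n + 2. x i = y i) \<longrightarrow> \<bar>\<phi> x - \<phi> y\<bar> \<le> v n"
    using summable_variations_modulus[OF assms] by blast
  have "eventually (\<lambda>n. v n < e) sequentially"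
    using summable_LIMSEQ_zero[OF v(2)] e by (auto dest: order_tendstoD)
  then obtain n where "v n < e" by (auto simp: eventually_sequentially)
  with v(3) show "\<exists>n. \<forall>x\<in>Shift M. \<forall>y\<in>Shift M. (\<forall>i<n. x i = y i) \<longrightarrow> \<bar>\<phi> x - \<phi> y\<bar> < e"
    by (intro exI[of _ "n + 2"]) (blast intro: le_less_trans)
qed

lemma rho_le_agree:
  assumes "\<And>i. i < n \<Longrightarrow> x i = y i"
  shows "rho x y \<le> (1/2) ^ n"
proof -
  let ?t = "\<lambda>i. (1/2) ^ Suc i * \<bar>recip (x i) - recip (y i)\<bar>"
  have half: "(\<lambda>i. (1/2 :: real) ^ n * (1/2) ^ Suc i) sums ((1/2) ^ n * 1)"
    by (intro sums_mult power_half_series)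
  have "rho x y = (\<Sum>i. ?t (i + n)) + (\<Sum>i<n. ?t i)"
    unfolding rho_def by (rule suminf_split_initial_segment[OF rho_summable])
  also have "(\<Sum>i<n. ?t i) = 0" using assms by simp
  also have "(\<Sum>i. ?t (i + n)) \<le> (\<Sum>i. (1/2 :: real) ^ n * (1/2) ^ Suc i)"
  proof (rule suminf_le)
    show "?t (i + n) \<le> (1/2) ^ n * (1/2) ^ Suc i" for i
    proof -
      have "\<bar>recip (x (i + n)) - recip (y (i + n))\<bar> \<le> 1"
        using recip_bounds[of "x (i + n)"] recip_bounds[of "y (i + n)"] by linarith
      then have "?t (i + n) \<le> (1/2) ^ Suc (i + n) * 1" by (intro mult_left_mono) auto
      also have "\<dots> = (1/2) ^ n * (1/2) ^ Suc i" by (simp add: power_add)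
      finally show ?thesis .
    qed
    show "summable (\<lambda>i. ?t (i + n))" using rho_summable by (rule summable_ignore_initial_segment)
  qed (use half in \<open>rule sums_summable\<close>)
  also have "\<dots> = (1/2) ^ n" using half by (simp add: sums_iff)
  finally show ?thesis by simp
qed

lemma UCb_locally_determined:
  assumes "g \<in> UCb M" "0 < e"
  shows "\<exists>n. \<forall>x\<in>Shift M. \<forall>y\<in>Shift M. (\<forall>i<n. x i = y i) \<longrightarrow> \<bar>g x - g y\<bar> < e"
proof -
  obtain d where d: "d > 0" "\<forall>x\<in>Shift M. \<forall>y\<in>Shift M. rho (emb x) (emb y) < d \<longrightarrow> \<bar>g x - g y\<bar> < e"
    using assms unfolding UCb_def by blast
  obtain n where n: "(1/2) ^ n < d" using real_arch_pow_inv[OF d(1), of "1/2"] by auto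
  show ?thesis
  proof (intro exI[of _ n] ballI impI)
    fix x y assume xy: "x \<in> Shift M" "y \<in> Shift M" "\<forall>i<n. x i = y i"
    then have "rho (emb x) (emb y) \<le> (1/2) ^ n" by (intro rho_le_agree) (simp add: emb_def)
    with d n xy show "\<bar>g x - g y\<bar> < e" by auto
  qed
qed

text \<open>
  Two orbits that share the symbols \<open>0, \<dots>, n\<close> stay close to each other, except during a final stretch
  of fixed length, where boundedness of \<open>g\<close> is used.
\<close>

lemma UCb_tempered_distortion:
  assumes "g \<in> UCb M"
  shows "tempered_distortion M g"
  unfolding tempered_distortion_def
proof (intro allI impI)
  fix e :: real assume e: "0 < e"
  obtain N where N: "\<forall>x\<in>Shift M. \<forall>y\<in>Shift M. (\<forall>i<N. x i = y i) \<longrightarrow> \<bar>g x - g y\<bar> < e"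
    using UCb_locally_determined[OF assms e] by blast
  obtain B where B': "\<forall>x\<in>Shift M. \<bar>g x\<bar> \<le> B"
    using assms unfolding UCb_def bounded_iff by auto
  then have B: "\<bar>g x\<bar> \<le> B" if "x \<in> Shift M" for x using that by blast
  show "\<exists>C. \<forall>n. \<forall>x\<in>Shift M. \<forall>y\<in>Shift M. (\<forall>i\<le>n. x i = y i) \<longrightarrow>
     \<bar>birkhoff_sum n g x - birkhoff_sum n g y\<bar> \<le> C + e * real n"
  proof (intro exI[of _ "2 * B * N"] allI ballI impI)
    fix n x y assume xy: "x \<in> Shift M" "y \<in> Shift M" and ag: "\<forall>i\<le>n. x i = y i"
    have B0: "0 \<le> B" using B[OF xy(1)] by linarith
    let ?d = "\<lambda>k. \<bar>g ((shift ^^ k) x) - g ((shift ^^ k) y)\<bar>"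
    have "\<bar>birkhoff_sum n g x - birkhoff_sum n g y\<bar> \<le> (\<Sum>k<n. ?d k)"
      unfolding birkhoff_sum_def sum_subtractf[symmetric] by (rule sum_abs)
    also have "\<dots> \<le> (\<Sum>k<n. e + (if n - Suc k < N then 2 * B else 0))"
    proof (rule sum_mono)
      fix k assume k: "k \<in> {..<n}"
      have in': "(shift ^^ k) x \<in> Shift M" "(shift ^^ k) y \<in> Shift M" using xy by (auto intro: shift_pow_in_Shift)
      show "?d k \<le> e + (if n - Suc k < N then 2 * B else 0)"
      proof (cases "n - Suc k < N")
        case True
        then show ?thesis using B[OF in'(1)] B[OF in'(2)] e by simp
      next
        case False
        then have "\<forall>i<N. (shift ^^ k) x i = (shift ^^ k) y i" using ag k by (auto simp: shift_pow_apply)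
        then show ?thesis using N in' False by fastforce
      qed
    qed
    also have "\<dots> = real n * e + (\<Sum>k<n. if k < N then 2 * B else 0)"
      using sum.nat_diff_reindex[of "\<lambda>k. if k < N then 2 * B else 0" n] by (simp add: sum.distrib)
    also have "(\<Sum>k<n. if k < N then 2 * B else 0) = real (card ({..<n} \<inter> {k. k < N})) * (2 * B)"
      by (simp add: sum.If_cases)
    also have "\<dots> \<le> real N * (2 * B)"
    proof (intro mult_right_mono)
      have "card ({..<n} \<inter> {k. k < N}) \<le> card {..<N}" by (intro card_mono) auto
      then show "real (card ({..<n} \<inter> {k. k < N})) \<le> real N" by simp
    qed (use B0 in simp)
    finally show "\<bar>birkhoff_sum n g x - birkhoff_sum n g y\<bar> \<le> 2 * B * N + e * real n" by (simp add: mult.commute)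
  qed
qed

text \<open>
  The partition function \<open>Z_n(\<psi>)\<close> of the loops of length \<open>n\<close> at \<open>a\<close>; its value is \<open>\<infinity>\<close> if the sum
  diverges.
\<close>

definition Zper :: "(nat \<Rightarrow> nat \<Rightarrow> bool) \<Rightarrow> ((nat \<Rightarrow> nat) \<Rightarrow> real) \<Rightarrow> nat \<Rightarrow> nat \<Rightarrow> ennreal" where
  "Zper M \<psi> a n = (\<Sum>\<^sub>\<infinity>x\<in>Per M a n. ennreal (exp (birkhoff_sum n \<psi> x)))"

lemma infsum_ennreal_le:
  fixes f :: "'a \<Rightarrow> ennreal"
  assumes "\<And>F. finite F \<Longrightarrow> F \<subseteq> A \<Longrightarrow> sum f F \<le> c"
  shows "infsum f A \<le> c"
  by (subst nonneg_infsum_complete) (auto intro!: SUP_least assms)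

lemma sum_le_infsum_ennreal:
  fixes f :: "'a \<Rightarrow> ennreal"
  assumes "finite F" "F \<subseteq> A"
  shows "sum f F \<le> infsum f A"
  by (subst nonneg_infsum_complete) (use assms in \<open>auto intro!: SUP_upper\<close>)

lemma less_infsum_ennreal:
  fixes f :: "'a \<Rightarrow> ennreal"
  assumes "c < infsum f A"
  obtains F where "finite F" "F \<subseteq> A" "c < sum f F"
  using assms by (subst (asm) nonneg_infsum_complete) (auto simp: less_SUP_iff)

lemma Per_D:
  assumes "x \<in> Per M a n"
  shows "x \<in> Shift M" "x 0 = a" "x (i + n) = x i" "(shift ^^ n) x = x"
proof -
  show 1: "(shift ^^ n) x = x" "x \<in> Shift M" "x 0 = a" using assms by (auto simp: Per_def cylinder_def)
  show "x (i + n) = x i" using fun_cong[OF 1(1), of i] by (simp add: shift_pow_apply)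
qed

lemma Per_I:
  assumes "x \<in> Shift M" "x 0 = a" "\<And>i. x (i + n) = x i"
  shows "x \<in> Per M a n"
  using assms by (auto simp: Per_def cylinder_def shift_pow_apply fun_eq_iff)

section \<open>Averages of probability measures\<close>

definition avg_measure :: "'a measure \<Rightarrow> nat \<Rightarrow> (nat \<Rightarrow> 'a measure) \<Rightarrow> 'a measure" where
  "avg_measure S n m = measure_of (space S) (sets S) (\<lambda>A. (\<Sum>k<n. emeasure (m k) A) / of_nat n)"

text \<open>
  The average equals the Giry bind of the uniform distribution on \<open>{..<n}\<close>, from which countable
  additivity and the integration formulas are inherited.
\<close>

locale measure_average =
  fixes S :: "'a measure" and n :: nat and m :: "nat \<Rightarrow> 'a measure"
  assumes n: "0 < n" and sets_m: "k < n \<Longrightarrow> sets (m k) = sets S" and prob_m: "k < n \<Longrightarrow> prob_space (m k)"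
begin

text \<open>
  The kernel has to be defined for every natural number; the values at \<open>k \<ge> n\<close> carry no mass.
\<close>

definition total :: "nat \<Rightarrow> 'a measure" where
  "total k = (if k < n then m k else m 0)"

lemma total_measurable: "total \<in> measure_pmf (pmf_of_set {..<n}) \<rightarrow>\<^sub>M subprob_algebra S"
proof -
  have "total k \<in> space (subprob_algebra S)" for k
    using n sets_m prob_m
    by (auto simp: total_def space_subprob_algebra intro: prob_space_imp_subprob_space)
  then show ?thesis by auto
qed

lemma avg_eq_bind: "avg_measure S n m = measure_pmf (pmf_of_set {..<n}) \<bind> total"
proof -
  let ?N = "measure_pmf (pmf_of_set {..<n}) \<bind> total"
  have sN: "sets ?N = sets S"
    by (rule sets_bind[OF sets_kernel[OF total_measurable]]) simp_all
  then have spN: "space ?N = space S" by (rule sets_eq_imp_space_eq)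
  have e: "emeasure ?N A = (\<Sum>k<n. emeasure (m k) A) / of_nat n" if "A \<in> sets S" for A
  proof -
    have "emeasure ?N A = (\<integral>\<^sup>+k. emeasure (total k) A \<partial>measure_pmf (pmf_of_set {..<n}))"
      using total_measurable that by (intro emeasure_bind) simp_all
    also have "\<dots> = (\<Sum>k<n. emeasure (total k) A) / of_nat n"
      using n by (subst nn_integral_pmf_of_set) auto
    finally show ?thesis by (simp add: total_def)
  qed
  have "avg_measure S n m = measure_of (space ?N) (sets ?N) (emeasure ?N)"
    unfolding avg_measure_def spN sN
  proof (rule measure_of_eq)
    show "sets S \<subseteq> Pow (space S)" by (rule sets.space_closed)
    fix A assume "A \<in> sigma_sets (space S) (sets S)"
    then show "(\<Sum>k<n. emeasure (m k) A) / of_nat n = emeasure ?N A"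
      by (simp add: e sets.sigma_sets_eq)
  qed
  then show ?thesis by (simp add: measure_of_of_measure)
qed

lemma sets_avg [simp]: "sets (avg_measure S n m) = sets S"
  and space_avg [simp]: "space (avg_measure S n m) = space S"
  unfolding avg_measure_def by simp_all

lemma nn_integral_avg:
  assumes "f \<in> borel_measurable S"
  shows "(\<integral>\<^sup>+x. f x \<partial>avg_measure S n m) = (\<Sum>k<n. \<integral>\<^sup>+x. f x \<partial>m k) / of_nat n"
proof -
  have "(\<integral>\<^sup>+x. f x \<partial>avg_measure S n m) = (\<Sum>k<n. \<integral>\<^sup>+x. f x \<partial>total k) / of_nat n"
    unfolding avg_eq_bind nn_integral_bind[OF assms total_measurable]
    using n by (subst nn_integral_pmf_of_set) auto
  then show ?thesis by (simp add: total_def)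
qed

lemma emeasure_avg:
  assumes "A \<in> sets S"
  shows "emeasure (avg_measure S n m) A = (\<Sum>k<n. emeasure (m k) A) / of_nat n"
  using nn_integral_avg[of "indicator A"] assms sets_m by simp

lemma prob_space_avg: "prob_space (avg_measure S n m)"
proof (rule prob_spaceI)
  have "emeasure (m k) (space S) = 1" if "k < n" for k
    using prob_space.emeasure_space_1[OF prob_m[OF that]] sets_eq_imp_space_eq[OF sets_m[OF that]] by simp
  then have "emeasure (avg_measure S n m) (space S) = of_nat n / of_nat n"
    by (subst emeasure_avg) simp_all
  also have "\<dots> = 1" using n by (simp add: ennreal_of_nat_eq_real_of_nat divide_ennreal)
  finally show "emeasure (avg_measure S n m) (space (avg_measure S n m)) = 1" by simp
qed

lemma integrable_avg:
  fixes f :: "'a \<Rightarrow> real"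
  assumes int: "\<And>k. k < n \<Longrightarrow> integrable (m k) f" and f: "f \<in> borel_measurable S"
  shows "integrable (avg_measure S n m) f"
    and "(\<integral>x. f x \<partial>avg_measure S n m) = (\<Sum>k<n. \<integral>x. f x \<partial>m k) / real n"
proof -
  have fin: "(\<integral>\<^sup>+x. ennreal (f x) \<partial>m k) \<noteq> \<infinity>" "(\<integral>\<^sup>+x. ennreal (- f x) \<partial>m k) \<noteq> \<infinity>" if "k < n" for k
    using int[OF that] unfolding real_integrable_def by auto
  have E: "(\<integral>\<^sup>+x. ennreal (g x) \<partial>avg_measure S n m) = ennreal ((\<Sum>k<n. enn2real (\<integral>\<^sup>+x. ennreal (g x) \<partial>m k)) / real n)"
    if "g \<in> borel_measurable S" "\<And>k. k < n \<Longrightarrow> (\<integral>\<^sup>+x. ennreal (g x) \<partial>m k) \<noteq> \<infinity>" for g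
  proof -
    have "(\<Sum>k<n. \<integral>\<^sup>+x. ennreal (g x) \<partial>m k) = ennreal (\<Sum>k<n. enn2real (\<integral>\<^sup>+x. ennreal (g x) \<partial>m k))"
      using that(2) by (subst sum_ennreal[symmetric]) (auto intro!: sum.cong simp: less_top)
    then show ?thesis
      using n that(1) by (subst nn_integral_avg) (auto simp: divide_ennreal sum_nonneg ennreal_of_nat_eq_real_of_nat)
  qed
  show i: "integrable (avg_measure S n m) f"
    unfolding real_integrable_def using f fin by (auto simp: E measurable_cong_sets[OF sets_avg refl])
  have "(\<integral>x. f x \<partial>avg_measure S n m) = (\<Sum>k<n. enn2real (\<integral>\<^sup>+x. ennreal (f x) \<partial>m k)) / real n
      - (\<Sum>k<n. enn2real (\<integral>\<^sup>+x. ennreal (- f x) \<partial>m k)) / real n"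
    unfolding real_lebesgue_integral_def[OF i] using f fin
    by (subst (1 2) E) (auto simp: sum_nonneg divide_nonneg_nonneg)
  also have "\<dots> = (\<Sum>k<n. \<integral>x. f x \<partial>m k) / real n"
    using int by (simp add: real_lebesgue_integral_def sum_subtractf diff_divide_distrib)
  finally show "(\<integral>x. f x \<partial>avg_measure S n m) = (\<Sum>k<n. \<integral>x. f x \<partial>m k) / real n" .
qed

end

section \<open>Bernoulli measures on concatenated loops\<close>

text \<open>
  A finite set \<open>F\<close> of loops of length \<open>n\<close> at \<open>a\<close> may be concatenated in any order, so it spans a copy
  of a full shift in \<open>Shift M\<close>. The independent concatenation with weights \<open>p\<close> is invariant under the
  \<open>n\<close>-th power of the shift; averaging it over the \<open>n\<close> starting phases gives an invariant measure.
  Loops serve as letters in the form of the periodic points that they generate.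
\<close>

locale bernoulli_loops =
  fixes M :: "nat \<Rightarrow> nat \<Rightarrow> bool" and a n :: nat and F :: "(nat \<Rightarrow> nat) set" and p :: "(nat \<Rightarrow> nat) \<Rightarrow> real"
  assumes n: "0 < n" and finite_F: "finite F" and F_Per: "F \<subseteq> Per M a n"
    and p_pos: "\<And>x. x \<in> F \<Longrightarrow> 0 < p x" and p_sum: "(\<Sum>x\<in>F. p x) = 1"
begin

definition B :: "(nat \<Rightarrow> nat \<Rightarrow> nat) measure" where
  "B = PiM UNIV (\<lambda>_. point_measure F p)"

definition concat_loops :: "(nat \<Rightarrow> nat \<Rightarrow> nat) \<Rightarrow> nat \<Rightarrow> nat" where
  "concat_loops \<omega> i = \<omega> (i div n) (i mod n)"

definition phase :: "nat \<Rightarrow> (nat \<Rightarrow> nat \<Rightarrow> nat) \<Rightarrow> nat \<Rightarrow> nat" where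
  "phase k \<omega> = (shift ^^ k) (concat_loops \<omega>)"

definition phase_measure :: "nat \<Rightarrow> (nat \<Rightarrow> nat) measure" where
  "phase_measure k = distr B (borel_Shift M) (phase k)"

definition loop_measure :: "(nat \<Rightarrow> nat) measure" where
  "loop_measure = avg_measure (borel_Shift M) n phase_measure"

lemma prob_point: "prob_space (point_measure F (\<lambda>x. ennreal (p x)))"
proof (rule prob_space_point_measure[OF finite_F])
  have "(\<Sum>x\<in>F. ennreal (p x)) = ennreal (\<Sum>x\<in>F. p x)"
    using p_pos by (intro sum_ennreal) (simp add: less_imp_le)
  then show "(\<Sum>x\<in>F. ennreal (p x)) = 1" by (simp only: p_sum ennreal_1)
qed simp

lemma product_point: "product_prob_space (\<lambda>_ :: nat. point_measure F p)"
  by (intro product_prob_spaceI prob_point)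

sublocale P: product_prob_space "\<lambda>_ :: nat. point_measure F p" UNIV
  by (rule product_point)

lemma prob_B: "prob_space B"
  unfolding B_def by (rule P.P.prob_space_axioms)

lemma space_B: "space B = {\<omega>. \<forall>j. \<omega> j \<in> F}"
  unfolding B_def space_PiM space_point_measure PiE_UNIV_domain by auto

lemma concat_in_Shift:
  assumes "\<omega> \<in> space B"
  shows "concat_loops \<omega> \<in> Shift M"
  unfolding Shift_def
proof safe
  fix i
  have P: "\<omega> j \<in> Per M a n" for j using assms F_Per by (auto simp: space_B)
  have S: "M (\<omega> (i div n) (i mod n)) (\<omega> (i div n) (Suc (i mod n)))"
    using Per_D(1)[OF P[of "i div n"]] by (simp add: Shift_def)
  show "M (concat_loops \<omega> i) (concat_loops \<omega> (Suc i))"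
  proof (cases "Suc (i mod n) = n")
    case True
    then have "Suc i mod n = 0" "Suc i div n = Suc (i div n)" by (simp_all add: mod_Suc div_Suc)
    moreover have "\<omega> (i div n) n = \<omega> (Suc (i div n)) 0"
      using Per_D(2)[OF P[of "i div n"]] Per_D(2)[OF P[of "Suc (i div n)"]] Per_D(3)[OF P[of "i div n"], of 0] by simp
    ultimately show ?thesis using S True by (simp add: concat_loops_def)
  next
    case False
    then have "Suc i mod n = Suc (i mod n)" "Suc i div n = i div n" by (simp_all add: mod_Suc div_Suc)
    then show ?thesis using S by (simp add: concat_loops_def)
  qed
qed

lemma phase_in_Shift: "\<omega> \<in> space B \<Longrightarrow> phase k \<omega> \<in> Shift M"
  unfolding phase_def by (intro shift_pow_in_Shift concat_in_Shift)

lemma phase_measurable: "phase k \<in> B \<rightarrow>\<^sub>M borel_Shift M"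
proof (rule measurable_restrict_space2)
  show "phase k \<in> space B \<rightarrow> Shift M" by (auto intro: phase_in_Shift)
  show "phase k \<in> borel_measurable B"
  proof (rule measurable_coordinatewise_then_product)
    fix i
    have "(\<lambda>\<omega>. \<omega> ((i + k) div n)) \<in> B \<rightarrow>\<^sub>M point_measure F p"
      unfolding B_def by (rule measurable_component_singleton) simp
    moreover have "(\<lambda>x. x ((i + k) mod n)) \<in> borel_measurable (point_measure F p)"
      by (simp add: measurable_point_measure_eq1)
    ultimately show "(\<lambda>\<omega>. phase k \<omega> i) \<in> borel_measurable B"
      unfolding phase_def shift_pow_apply concat_loops_def by (rule measurable_compose)
  qed
qed

lemma B_shift: "distr B B (\<lambda>\<omega> j. \<omega> (Suc j)) = B"
proof -
  have "distr (Pi\<^sub>M UNIV (\<lambda>_. point_measure F p)) (\<Pi>\<^sub>M i\<in>UNIV. point_measure F p) (\<lambda>\<omega>. \<lambda>j\<in>UNIV. \<omega> (Suc j))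
      = (\<Pi>\<^sub>M i\<in>UNIV. point_measure F p)"
    by (rule distr_PiM_reindex[where f = Suc]) (auto intro: prob_point)
  then show ?thesis by (simp add: B_def restrict_def)
qed

lemma B_shift_measurable: "(\<lambda>\<omega> j. \<omega> (Suc j)) \<in> B \<rightarrow>\<^sub>M B"
  unfolding B_def by (rule measurable_PiM_single') (auto simp: space_PiM space_point_measure PiE_def extensional_def)

lemma phase_add_n: "phase (k + n) \<omega> = phase k (\<lambda>j. \<omega> (Suc j))"
proof
  fix i
  have e: "i + (k + n) = (i + k) + n" by simp
  show "phase (k + n) \<omega> i = phase k (\<lambda>j. \<omega> (Suc j)) i"
    unfolding phase_def shift_pow_apply concat_loops_def e using n by (simp del: add.assoc)
qed

lemma phase_measure_n: "phase_measure n = phase_measure 0"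
proof -
  have "phase_measure 0 = distr (distr B B (\<lambda>\<omega> j. \<omega> (Suc j))) (borel_Shift M) (phase 0)"
    by (simp add: phase_measure_def B_shift)
  also have "\<dots> = distr B (borel_Shift M) (phase 0 \<circ> (\<lambda>\<omega> j. \<omega> (Suc j)))"
    by (rule distr_distr[OF phase_measurable B_shift_measurable])
  also have "phase 0 \<circ> (\<lambda>\<omega> j. \<omega> (Suc j)) = phase n"
    using phase_add_n[of 0] by auto
  finally show ?thesis by (simp add: phase_measure_def)
qed

lemma phase_measure_Suc: "distr (phase_measure k) (borel_Shift M) shift = phase_measure (Suc k)"
proof -
  have "distr (phase_measure k) (borel_Shift M) shift = distr B (borel_Shift M) (shift \<circ> phase k)"
    unfolding phase_measure_def by (rule distr_distr[OF measurable_shift phase_measurable])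
  also have "shift \<circ> phase k = phase (Suc k)" by (rule ext) (simp add: phase_def)
  finally show ?thesis by (simp add: phase_measure_def)
qed

lemma phase_average: "measure_average (borel_Shift M) n phase_measure"
  unfolding measure_average_def using n
  by (simp add: phase_measure_def prob_space.prob_space_distr[OF prob_B phase_measurable])

interpretation avg: measure_average "borel_Shift M" n phase_measure
  by (rule phase_average)

lemma loop_measure_inv: "loop_measure \<in> inv_measures M"
proof -
  have "distr loop_measure loop_measure shift = loop_measure"
  proof (rule measure_eqI)
    fix A assume "A \<in> sets (distr loop_measure loop_measure shift)"
    then have A: "A \<in> sets (borel_Shift M)" by (simp add: loop_measure_def)
    have mS: "shift \<in> loop_measure \<rightarrow>\<^sub>M loop_measure"
      using measurable_shift by (subst measurable_cong_sets[of _ "borel_Shift M" _ "borel_Shift M"]) (simp_all add: loop_measure_def)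
    have A': "shift -` A \<inter> Shift M \<in> sets (borel_Shift M)"
      using measurable_sets[OF measurable_shift A] by (simp add: space_restrict_space)
    have step: "emeasure (phase_measure k) (shift -` A \<inter> Shift M) = emeasure (phase_measure (Suc k)) A" for k
    proof -
      have "shift \<in> phase_measure k \<rightarrow>\<^sub>M borel_Shift M"
        using measurable_shift by (simp add: phase_measure_def)
      then show ?thesis
        unfolding phase_measure_Suc[symmetric]
        by (subst emeasure_distr[OF _ A]) (simp_all add: phase_measure_def space_restrict_space)
    qed
    have "emeasure (distr loop_measure loop_measure shift) A = emeasure loop_measure (shift -` A \<inter> Shift M)"
      using mS A by (subst emeasure_distr) (simp_all add: loop_measure_def space_restrict_space)
    also have "\<dots> = (\<Sum>k<n. emeasure (phase_measure (Suc k)) A) / of_nat n"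
      unfolding loop_measure_def using A' by (simp add: avg.emeasure_avg step)
    also have "(\<Sum>k<n. emeasure (phase_measure (Suc k)) A) = (\<Sum>k<n. emeasure (phase_measure k) A)"
    proof -
      obtain n' where n': "n = Suc n'" using n by (cases n) auto
      have "(\<Sum>k<n. emeasure (phase_measure (Suc k)) A) = (\<Sum>k<n'. emeasure (phase_measure (Suc k)) A) + emeasure (phase_measure n) A"
        by (simp add: n')
      also have "\<dots> = emeasure (phase_measure 0) A + (\<Sum>k<n'. emeasure (phase_measure (Suc k)) A)"
        by (simp add: phase_measure_n add.commute)
      also have "\<dots> = (\<Sum>k<n. emeasure (phase_measure k) A)"
        unfolding n' by (rule sum.lessThan_Suc_shift[symmetric])
      finally show ?thesis .
    qed
    also have "\<dots> / of_nat n = emeasure loop_measure A"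
      unfolding loop_measure_def using A by (simp add: avg.emeasure_avg)
    finally show "emeasure (distr loop_measure loop_measure shift) A = emeasure loop_measure A" .
  qed simp
  then show ?thesis
    unfolding inv_measures_def using avg.prob_space_avg by (simp add: loop_measure_def)
qed

end

lemma ext_integral_integrable:
  assumes "integrable \<mu> \<psi>"
  shows "ext_integral \<mu> \<psi> = ereal (\<integral>x. \<psi> x \<partial>\<mu>)" "(\<integral>\<^sup>+x. ennreal (- \<psi> x) \<partial>\<mu>) < \<infinity>"
proof -
  have fin: "(\<integral>\<^sup>+x. ennreal (\<psi> x) \<partial>\<mu>) \<noteq> top" "(\<integral>\<^sup>+x. ennreal (- \<psi> x) \<partial>\<mu>) \<noteq> top"
    using assms unfolding real_integrable_def by auto
  then show "(\<integral>\<^sup>+x. ennreal (- \<psi> x) \<partial>\<mu>) < \<infinity>" by (simp add: less_top)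
  have "ext_integral \<mu> \<psi> = ereal (enn2real (\<integral>\<^sup>+x. ennreal (\<psi> x) \<partial>\<mu>)) - ereal (enn2real (\<integral>\<^sup>+x. ennreal (- \<psi> x) \<partial>\<mu>))"
    unfolding ext_integral_def using fin
    by (metis enn2ereal_ennreal enn2real_nonneg ennreal_enn2real less_top)
  then show "ext_integral \<mu> \<psi> = ereal (\<integral>x. \<psi> x \<partial>\<mu>)"
    by (simp add: real_lebesgue_integral_def[OF assms])
qed

lemma tempered_locally_bounded:
  assumes "tempered_distortion M \<psi>" "finite T"
  shows "\<exists>D. \<forall>x\<in>Shift M. (x 0, x 1) \<in> T \<longrightarrow> \<bar>\<psi> x\<bar> \<le> D"
proof -
  obtain C where C: "\<forall>n. \<forall>x\<in>Shift M. \<forall>y\<in>Shift M. (\<forall>i\<le>n. x i = y i) \<longrightarrow>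
     \<bar>birkhoff_sum n \<psi> x - birkhoff_sum n \<psi> y\<bar> \<le> C + 1 * real n"
    using assms(1) zero_less_one unfolding tempered_distortion_def by blast
  have C1: "\<bar>\<psi> x - \<psi> y\<bar> \<le> C + 1" if "x \<in> Shift M" "y \<in> Shift M" "x 0 = y 0" "x 1 = y 1" for x y
  proof -
    have "\<forall>i\<le>1. x i = y i" using that by (auto simp: le_Suc_eq)
    then have "\<bar>birkhoff_sum 1 \<psi> x - birkhoff_sum 1 \<psi> y\<bar> \<le> C + 1 * real 1"
      using C that by blast
    then show ?thesis by (simp add: birkhoff_sum_def)
  qed
  define y where "y t = (SOME x. x \<in> Shift M \<and> (x 0, x 1) = t)" for t
  define D where "D = C + 1 + (\<Sum>t\<in>T. \<bar>\<psi> (y t)\<bar>)"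
  show ?thesis
  proof (intro exI[of _ D] ballI impI)
    fix x assume x: "x \<in> Shift M" "(x 0, x 1) \<in> T"
    define z where "z = y (x 0, x 1)"
    have "\<exists>w. w \<in> Shift M \<and> (w 0, w 1) = (x 0, x 1)" using x by blast
    from someI_ex[OF this] have z: "z \<in> Shift M" "z 0 = x 0" "z 1 = x 1"
      by (auto simp: z_def y_def)
    have "\<bar>\<psi> z\<bar> \<le> (\<Sum>t\<in>T. \<bar>\<psi> (y t)\<bar>)"
      unfolding z_def using x assms(2) by (intro member_le_sum) auto
    with C1[OF x(1) z(1)] z show "\<bar>\<psi> x\<bar> \<le> D" by (simp add: D_def)
  qed
qed

lemma measurable_symbol: "(\<lambda>x :: nat \<Rightarrow> nat. h (x i)) \<in> borel_Shift M \<rightarrow>\<^sub>M count_space UNIV"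
proof -
  have "(\<lambda>x :: nat \<Rightarrow> nat. x i) \<in> borel \<rightarrow>\<^sub>M borel"
    by (rule measurable_product_then_coordinatewise) simp
  then have "(\<lambda>x :: nat \<Rightarrow> nat. x i) \<in> borel_Shift M \<rightarrow>\<^sub>M count_space UNIV"
    by (intro measurable_restrict_space1) (simp add: measurable_cong_sets[OF refl sets_borel_eq_count_space])
  then show ?thesis by (rule measurable_compose) simp
qed

lemma large_symbol_sets: "{x \<in> Shift M. m < x 0} \<in> sets (borel_Shift M)"
proof -
  have "(\<lambda>x. m < x 0) \<in> borel_Shift M \<rightarrow>\<^sub>M count_space UNIV" by (rule measurable_symbol)
  then have "(\<lambda>x. m < x 0) -` {True} \<inter> space (borel_Shift M) \<in> sets (borel_Shift M)" by (rule measurable_sets) simp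
  moreover have "(\<lambda>x. m < x 0) -` {True} \<inter> space (borel_Shift M) = {x \<in> Shift M. m < x 0}" by (auto simp: space_restrict_space)
  ultimately show ?thesis by simp
qed

context bernoulli_loops
begin

interpretation B: prob_space B by (rule prob_B)
interpretation avg: measure_average "borel_Shift M" n phase_measure by (rule phase_average)

lemma phase_le:
  assumes "\<omega> \<in> space B" "\<forall>x\<in>F. \<forall>i<n. x i \<le> L"
  shows "phase k \<omega> i \<le> L"
  using assms n by (simp add: phase_def shift_pow_apply concat_loops_def space_B)

lemma symbols_bounded:
  obtains L where "\<forall>x\<in>F. \<forall>i<n. x i \<le> L"
proof -
  have fin: "finite ((\<lambda>(x, i). x i) ` (F \<times> {..<n}))" using finite_F by simp
  show ?thesis
  proof (rule that[of "Max ((\<lambda>(x, i). x i) ` (F \<times> {..<n}))"])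
    show "\<forall>x\<in>F. \<forall>i<n. x i \<le> Max ((\<lambda>(x, i). x i) ` (F \<times> {..<n}))"
    proof (intro ballI allI impI)
    fix x i assume "x \<in> F" "i < n"
    then have "x i \<in> (\<lambda>(x, i). x i) ` (F \<times> {..<n})" by force
    then show "x i \<le> Max ((\<lambda>(x, i). x i) ` (F \<times> {..<n}))" using fin by (rule Max_ge[rotated])
    qed
  qed
qed

lemma loop_integral:
  fixes h :: "(nat \<Rightarrow> nat) \<Rightarrow> real"
  assumes h: "h \<in> borel_measurable (borel_Shift M)" and bd: "\<And>k \<omega>. \<omega> \<in> space B \<Longrightarrow> \<bar>h (phase k \<omega>)\<bar> \<le> D"
  shows "integrable loop_measure h" "integrable B (\<lambda>\<omega>. h (phase k \<omega>))"
    "(\<integral>x. h x \<partial>loop_measure) = (\<Sum>k<n. \<integral>\<omega>. h (phase k \<omega>) \<partial>B) / real n"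
proof -
  have i: "integrable B (\<lambda>\<omega>. h (phase k \<omega>))" for k
    using bd by (intro B.integrable_const_bound[of _ D] AE_I2) (auto intro: measurable_compose[OF phase_measurable h])
  then show "integrable B (\<lambda>\<omega>. h (phase k \<omega>))" .
  have j: "integrable (phase_measure k) h" for k
    unfolding phase_measure_def using i by (simp add: integrable_distr_eq[OF phase_measurable h])
  show "integrable loop_measure h" unfolding loop_measure_def by (rule avg.integrable_avg[OF j h])
  show "(\<integral>x. h x \<partial>loop_measure) = (\<Sum>k<n. \<integral>\<omega>. h (phase k \<omega>) \<partial>B) / real n"
    unfolding loop_measure_def
    by (subst avg.integrable_avg(2)[OF j h]) (simp_all add: phase_measure_def integral_distr[OF phase_measurable h])
qed

lemma B_component:
  fixes h :: "(nat \<Rightarrow> nat) \<Rightarrow> real"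
  shows "integrable B (\<lambda>\<omega>. h (\<omega> j))" "(\<integral>\<omega>. h (\<omega> j) \<partial>B) = (\<Sum>x\<in>F. p x * h x)"
proof -
  have m: "(\<lambda>\<omega>. \<omega> j) \<in> B \<rightarrow>\<^sub>M point_measure F p"
    unfolding B_def by (rule measurable_component_singleton) simp
  have hm: "h \<in> borel_measurable (point_measure F p)" by (simp add: measurable_point_measure_eq1)
  have d: "distr B (point_measure F p) (\<lambda>\<omega>. \<omega> j) = point_measure F p"
    unfolding B_def by (rule distr_PiM_component) (auto intro: prob_point)
  have "integrable (point_measure F p) h"
    using finite_F p_pos by (intro integrable_point_measure_finite)
  then show "integrable B (\<lambda>\<omega>. h (\<omega> j))"
    using integrable_distr_eq[OF m hm] d by simp
  show "(\<integral>\<omega>. h (\<omega> j) \<partial>B) = (\<Sum>x\<in>F. p x * h x)"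
    using integral_distr[OF m hm] d finite_F p_pos
    by (simp add: lebesgue_integral_point_measure_finite less_imp_le)
qed

lemma B_block_emb:
  "{\<omega>' \<in> space B. \<forall>j\<in>J. \<omega>' j = \<omega> j} = prod_emb UNIV (\<lambda>_. point_measure F p) J (\<Pi>\<^sub>E j\<in>J. {\<omega> j})"
  by (auto simp: prod_emb_def space_B space_point_measure PiE_iff restrict_def fun_eq_iff)

lemma B_block:
  assumes "\<omega> \<in> space B" "finite J"
  shows "measure B {\<omega>' \<in> space B. \<forall>j\<in>J. \<omega>' j = \<omega> j} = (\<Prod>j\<in>J. p (\<omega> j))"
proof -
  have F: "\<omega> j \<in> F" for j using assms by (simp add: space_B)
  have "{\<omega>' \<in> space B. \<forall>j\<in>J. \<omega>' j = \<omega> j} = prod_emb UNIV (\<lambda>_. point_measure F p) J (\<Pi>\<^sub>E j\<in>J. {\<omega> j})"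
    by (rule B_block_emb)
  then have "measure B {\<omega>' \<in> space B. \<forall>j\<in>J. \<omega>' j = \<omega> j} = (\<Prod>j\<in>J. measure (point_measure F p) {\<omega> j})"
    unfolding B_def using assms F by (simp add: P.measure_PiM_emb sets_point_measure)
  also have "\<dots> = (\<Prod>j\<in>J. p (\<omega> j))"
    using F p_pos finite_F by (intro prod.cong refl) (simp add: measure_point_measure_finite_if less_imp_le)
  finally show ?thesis .
qed

definition base_entropy :: real where
  "base_entropy = (\<Sum>x\<in>F. p x * - ln (p x))"

text \<open>
  A window of length \<open>N\<close> that starts in the first loop contains the loops number \<open>1, \<dots>, N div n - 1\<close>
  completely. Replacing symbols by \<open>min (x 0) L\<close> loses nothing, since all symbols of \<open>F\<close> are at most
  \<open>L\<close>.
\<close>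

lemma loops_determined:
  assumes L: "\<forall>x\<in>F. \<forall>i<n. x i \<le> L"
    and w: "\<omega> \<in> space B" "\<omega>' \<in> space B" and k: "k < n"
    and eq: "itinerary (\<lambda>x. min (x 0) L) N (phase k \<omega>') = itinerary (\<lambda>x. min (x 0) L) N (phase k \<omega>)"
    and j: "1 \<le> j" "j \<le> N div n - 1"
  shows "\<omega>' j = \<omega> j"
proof -
  have sym: "phase k \<omega>' i = phase k \<omega> i" if "i < N" for i
  proof -
    have "min ((shift ^^ i) (phase k \<omega>') 0) L = min ((shift ^^ i) (phase k \<omega>) 0) L"
      using arg_cong[OF eq, of "\<lambda>u. u ! i"] that by (simp add: itinerary_nth)
    then show ?thesis using phase_le[OF w(1) L] phase_le[OF w(2) L] by (simp add: shift_pow_apply)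
  qed
  have first: "\<omega>' j i = \<omega> j i" if i: "i < n" for i
  proof -
    have le: "k \<le> j * n + i" using k j(1) by (metis le_add1 less_imp_le le_trans mult_le_mono1 mult_1)
    have "Suc j * n \<le> N div n * n" using j n by (intro mult_le_mono1) linarith
    then have "Suc j * n \<le> N" using div_times_less_eq_dividend[of N n] by linarith
    then have "j * n + i - k < N" using i by simp
    from sym[OF this] show ?thesis
      using le i by (simp add: phase_def shift_pow_apply concat_loops_def)
  qed
  have P: "\<omega> j \<in> Per M a n" "\<omega>' j \<in> Per M a n" using w F_Per by (auto simp: space_B)
  have per: "x i = x (i mod n)" if "x \<in> Per M a n" for x i
  proof (induction i rule: less_induct)
    case (less i)
    show ?case
    proof (cases "i < n")
      case False
      then have "x i = x (i - n)" using Per_D(3)[OF that, of "i - n"] by simp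
      also have "\<dots> = x ((i - n) mod n)" using False n by (intro less) simp
      finally show ?thesis using False by (simp add: le_mod_geq)
    qed simp
  qed
  show ?thesis
  proof
    fix i
    have "i mod n < n" using n by simp
    then show "\<omega>' j i = \<omega> j i" using per[OF P(1), of i] per[OF P(2), of i] first by simp
  qed
qed

text \<open>
  The itinerary determines \<open>N div n - 1\<close> independent loops, so a cell has at most the probability of
  these loops, and the information of the cell is at least their total information.
\<close>

lemma phase_shannon:
  assumes L: "\<forall>x\<in>F. \<forall>i<n. x i \<le> L" and k: "k < n"
    and X: "X = itinerary (\<lambda>x. min (x 0) L) N" and sX: "simple_function (phase_measure k) X"
  shows "real (N div n - 1) * base_entropy \<le> shannon (phase_measure k) X"
proof -
  note P = avg.prob_m[OF k]
  let ?P = "\<lambda>u. measure (phase_measure k) {x \<in> space (phase_measure k). X x = u}"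
  let ?J = "{1..N div n - 1}"
  have cell: "?P (X (phase k \<omega>)) \<le> (\<Prod>j\<in>?J. p (\<omega> j))" if w: "\<omega> \<in> space B" for \<omega>
  proof -
    have lev: "{x \<in> Shift M. X x = u} \<in> sets (borel_Shift M)" for u
      using simple_functionD(2)[OF sX, of "{u}"]
      by (simp add: phase_measure_def space_restrict_space vimage_def Int_def conj_commute)
    have "?P (X (phase k \<omega>)) = measure B {\<omega>' \<in> space B. X (phase k \<omega>') = X (phase k \<omega>)}"
      using lev by (simp add: phase_measure_def measure_distr[OF phase_measurable] space_restrict_space)
        (intro arg_cong[of _ _ "measure B"], auto intro: phase_in_Shift)
    also have "\<dots> \<le> measure B {\<omega>' \<in> space B. \<forall>j\<in>?J. \<omega>' j = \<omega> j}"
    proof (rule B.finite_measure_mono)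
      show "{\<omega>' \<in> space B. X (phase k \<omega>') = X (phase k \<omega>)} \<subseteq> {\<omega>' \<in> space B. \<forall>j\<in>?J. \<omega>' j = \<omega> j}"
        using loops_determined[OF L w _ k] unfolding X by auto
      have "{\<omega>' \<in> space B. \<forall>j\<in>?J. \<omega>' j = \<omega> j} = prod_emb UNIV (\<lambda>_. point_measure F p) ?J (\<Pi>\<^sub>E j\<in>?J. {\<omega> j})"
        by (rule B_block_emb)
      also have "\<dots> \<in> sets B"
        unfolding B_def using w by (intro sets_PiM_I) (auto simp: sets_point_measure space_B)
      finally show "{\<omega>' \<in> space B. \<forall>j\<in>?J. \<omega>' j = \<omega> j} \<in> sets B" .
    qed
    also have "\<dots> = (\<Prod>j\<in>?J. p (\<omega> j))" using w by (rule B_block) simp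
    finally show ?thesis .
  qed
  have im: "integrable (phase_measure k) (\<lambda>x. - ln (?P (X x)))"
    using shannon_integrable[OF P sX] .
  have im': "(\<lambda>x. - ln (?P (X x))) \<in> borel_measurable (borel_Shift M)"
    using borel_measurable_integrable[OF im] by (simp add: phase_measure_def)
  have "real (N div n - 1) * base_entropy = (\<integral>\<omega>. (\<Sum>j\<in>?J. - ln (p (\<omega> j))) \<partial>B)"
    by (simp add: B_component[of "\<lambda>x. - ln (p x)"] base_entropy_def
        Bochner_Integration.integral_sum[OF B_component(1)[of "\<lambda>x. - ln (p x)"]] del: Bochner_Integration.integral_minus sum_negf)
  also have "\<dots> \<le> (\<integral>\<omega>. - ln (?P (X (phase k \<omega>))) \<partial>B)"
  proof (rule integral_mono_AE)
    show "integrable B (\<lambda>\<omega>. \<Sum>j\<in>?J. - ln (p (\<omega> j)))"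
      by (intro Bochner_Integration.integrable_sum B_component(1))
    show "integrable B (\<lambda>\<omega>. - ln (?P (X (phase k \<omega>))))"
      using im unfolding phase_measure_def[of k]
      by (subst (asm) integrable_distr_eq[OF phase_measurable]) (use im' in \<open>simp_all add: phase_measure_def\<close>)
    have "AE x in phase_measure k. 0 < ?P (X x)" using AE_cell_pos[OF P sX] .
    then have "AE \<omega> in B. 0 < ?P (X (phase k \<omega>))"
      unfolding phase_measure_def[of k] by (rule AE_distrD[OF phase_measurable])
    moreover have "AE \<omega> in B. \<omega> \<in> space B" by (rule AE_space)
    ultimately show "AE \<omega> in B. (\<Sum>j\<in>?J. - ln (p (\<omega> j))) \<le> - ln (?P (X (phase k \<omega>)))"
    proof eventually_elim
      case (elim \<omega>)
      have pos: "0 < p (\<omega> j)" for j using elim by (intro p_pos) (simp add: space_B)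
      have "ln (?P (X (phase k \<omega>))) \<le> ln (\<Prod>j\<in>?J. p (\<omega> j))"
        using cell[OF elim(2)] elim(1) by (simp add: prod_pos pos)
      also have "\<dots> = (\<Sum>j\<in>?J. ln (p (\<omega> j)))" by (rule ln_prod) (simp, metis pos less_irrefl)
      finally show ?case by (simp add: sum_negf)
    qed
  qed
  also have "\<dots> = shannon (phase_measure k) X"
    unfolding shannon_def
    using integral_distr[OF phase_measurable im', of k] by (simp add: phase_measure_def)
  finally show ?thesis .
qed

end

context bernoulli_loops
begin

interpretation B: prob_space B by (rule prob_B)
interpretation avg: measure_average "borel_Shift M" n phase_measure by (rule phase_average)

text \<open>
  The entropy of the average is at least the average of the entropies of the phases: the law under the
  average is used as a code for each phase. This is concavity of the entropy in coding form.
\<close>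

lemma loop_shannon:
  assumes L: "\<forall>x\<in>F. \<forall>i<n. x i \<le> L" and sf: "simple_function loop_measure (\<lambda>x. min (x 0) L)"
  shows "real (N div n - 1) * base_entropy \<le> shannon loop_measure (itinerary (\<lambda>x. min (x 0) L) N)"
proof -
  let ?X = "itinerary (\<lambda>x. min (x 0) L) N"
  have P: "prob_space loop_measure" unfolding loop_measure_def by (rule avg.prob_space_avg)
  have sX: "simple_function loop_measure ?X" by (rule simple_function_itinerary[OF loop_measure_inv sf])
  have sk: "simple_function (phase_measure k) ?X" for k
    using sX by (simp add: simple_function_def phase_measure_def loop_measure_def)
  have sp: "space (phase_measure k) = Shift M" "space loop_measure = Shift M" for k
    by (simp_all add: phase_measure_def loop_measure_def space_restrict_space)
  let ?Q = "\<lambda>u. measure loop_measure {x \<in> space loop_measure. ?X x = u}"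
  have each: "real (N div n - 1) * base_entropy \<le> (\<integral>x. - ln (?Q (?X x)) \<partial>phase_measure k)" if k: "k < n" for k
  proof -
    have "real (N div n - 1) * base_entropy \<le> shannon (phase_measure k) ?X"
      by (rule phase_shannon[OF L k refl sk])
    also have "\<dots> \<le> (\<integral>x. - ln (?Q (?X x)) \<partial>phase_measure k)"
    proof (rule shannon_le_cost[OF avg.prob_m[OF k] sk, where Q = ?Q])
      show "(\<Sum>u\<in>?X ` space (phase_measure k). ?Q u) \<le> 1"
        using simple_function_sum_measure[OF P sX] by (simp add: sp)
      show "integrable (phase_measure k) (\<lambda>x. - ln (?Q (?X x)))"
        by (rule expectation_simple(1)[OF avg.prob_m[OF k] sk])
      show "AE x in phase_measure k. exp (- (- ln (?Q (?X x)))) \<le> ?Q (?X x)"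
        using AE_cell_pos[OF avg.prob_m[OF k] sk]
      proof eventually_elim
        case (elim x)
        let ?A = "{y \<in> Shift M. ?X y = ?X x}"
        have A: "?A \<in> sets (borel_Shift M)"
          using simple_functionD(2)[OF sX, of "{?X x}"]
          by (simp add: loop_measure_def space_restrict_space vimage_def Int_def conj_commute)
        have "emeasure (phase_measure k) ?A \<noteq> 0" using elim by (auto simp: sp measure_def)
        then have "(\<Sum>k<n. emeasure (phase_measure k) ?A) \<noteq> 0" using k by auto
        then have "emeasure loop_measure ?A \<noteq> 0"
          unfolding loop_measure_def using A
          by (simp add: avg.emeasure_avg ennreal_divide_eq_0_iff ennreal_of_nat_eq_real_of_nat)
        then have "0 < ?Q (?X x)"
          using finite_measure.emeasure_eq_measure[OF prob_space.finite_measure[OF P]] by (simp add: sp zero_less_measure_iff)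
        then show ?case by simp
      qed
    qed simp
    finally show ?thesis .
  qed
  have int: "integrable (phase_measure k) (\<lambda>x. - ln (?Q (?X x)))" if k: "k < n" for k
    by (rule expectation_simple(1)[OF avg.prob_m[OF k] sk])
  have "(\<lambda>x. - ln (?Q (?X x))) \<in> borel_measurable (phase_measure 0)"
    using int[OF n] by (rule borel_measurable_integrable)
  then have m: "(\<lambda>x. - ln (?Q (?X x))) \<in> borel_measurable (borel_Shift M)"
    by (simp add: phase_measure_def)
  have "shannon loop_measure ?X = (\<Sum>k<n. \<integral>x. - ln (?Q (?X x)) \<partial>phase_measure k) / real n"
    using avg.integrable_avg(2)[OF int m] unfolding shannon_def loop_measure_def by simp
  moreover have "real n * (real (N div n - 1) * base_entropy) \<le> (\<Sum>k<n. \<integral>x. - ln (?Q (?X x)) \<partial>phase_measure k)"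
    using sum_mono[of "{..<n}" "\<lambda>_. real (N div n - 1) * base_entropy", OF each] by simp
  ultimately have "real n * (real (N div n - 1) * base_entropy) \<le> real n * shannon loop_measure ?X"
    using n by simp
  then show ?thesis using n by (simp only: mult_le_cancel_left_pos of_nat_0_less_iff)
qed

lemma loop_entropy: "ereal (base_entropy / real n) \<le> ks_entropy loop_measure"
proof -
  obtain L where L: "\<forall>x\<in>F. \<forall>i<n. x i \<le> L" by (rule symbols_bounded)
  let ?f = "\<lambda>x :: nat \<Rightarrow> nat. min (x 0) L"
  have sf: "simple_function loop_measure ?f"
    unfolding simple_function_eq_measurable
  proof
    show "finite (?f ` space loop_measure)" by (rule finite_subset[of _ "{..L}"]) auto
    show "?f \<in> loop_measure \<rightarrow>\<^sub>M count_space UNIV"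
    proof -
      have "loop_measure \<rightarrow>\<^sub>M count_space UNIV = (borel_Shift M \<rightarrow>\<^sub>M (count_space UNIV :: nat measure))"
        by (rule measurable_cong_sets) (simp_all add: loop_measure_def)
      then show ?thesis using measurable_symbol[of "\<lambda>c. min c L" 0 M] by blast
    qed
  qed
  have lim: "(\<lambda>q. shannon loop_measure (itinerary ?f (n * Suc q)) / real (n * Suc q)) \<longlonglongrightarrow> partition_entropy loop_measure ?f"
  proof -
    have "strict_mono (\<lambda>q. n * Suc q)" using n by (intro strict_monoI) simp
    from LIMSEQ_subseq_LIMSEQ[OF partition_entropy_limit(1)[OF loop_measure_inv sf] this]
    show ?thesis by (simp add: comp_def)
  qed
  have "(\<lambda>q. real q / real (Suc q) * (base_entropy / real n)) \<longlonglongrightarrow> 1 * (base_entropy / real n)"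
    by (intro tendsto_mult tendsto_const LIMSEQ_n_over_Suc_n)
  then have "1 * (base_entropy / real n) \<le> partition_entropy loop_measure ?f"
  proof (rule LIMSEQ_le[OF _ lim], intro exI allI impI)
    fix q :: nat
    have "(n * Suc q) div n - 1 = q" using n by simp
    with loop_shannon[OF L sf, of "n * Suc q"]
    have "real q * base_entropy / real (n * Suc q) \<le> shannon loop_measure (itinerary ?f (n * Suc q)) / real (n * Suc q)"
      by (intro divide_right_mono) simp_all
    moreover have "real q / real (Suc q) * (base_entropy / real n) = real q * base_entropy / real (n * Suc q)"
      by (simp only: of_nat_mult times_divide_times_eq mult.commute)
    ultimately show "real q / real (Suc q) * (base_entropy / real n) \<le> shannon loop_measure (itinerary ?f (n * Suc q)) / real (n * Suc q)"
      by (simp only:)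
  qed
  then show ?thesis
    unfolding ks_entropy_def using sf by (intro SUP_upper2[of ?f]) auto
qed

lemma concat_agrees:
  assumes "\<omega> \<in> space B" "i \<le> n"
  shows "concat_loops \<omega> i = \<omega> 0 i"
proof (cases "i = n")
  case True
  have P: "\<omega> j \<in> Per M a n" for j using assms F_Per by (auto simp: space_B)
  show ?thesis using True n Per_D(2)[OF P[of 1]] Per_D(2)[OF P[of 0]] Per_D(3)[OF P[of 0], of 0]
    by (simp add: concat_loops_def)
qed (use assms n in \<open>simp add: concat_loops_def\<close>)

text \<open>
  A concatenation agrees with its first loop at the places \<open>0, \<dots>, n\<close>, since the next loop starts with
  \<open>a\<close> as well. Hence the integral of \<open>\<psi>\<close> over the \<open>n\<close> phases is the mean of \<open>birkhoff_sum n \<psi>\<close> over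
  \<open>F\<close> up to the distortion \<open>D\<close>.
\<close>

lemma pressure_ge_loop_measure:
  assumes m: "\<psi> \<in> borel_measurable (borel_Shift M)" and temp: "tempered_distortion M \<psi>"
    and D: "\<And>x y. x \<in> Shift M \<Longrightarrow> y \<in> Shift M \<Longrightarrow> \<forall>i\<le>n. x i = y i \<Longrightarrow>
      \<bar>birkhoff_sum n \<psi> x - birkhoff_sum n \<psi> y\<bar> \<le> D"
  shows "ereal ((base_entropy + (\<Sum>x\<in>F. p x * birkhoff_sum n \<psi> x) - D) / real n) \<le> pressure M \<psi>"
proof -
  obtain L where L: "\<forall>x\<in>F. \<forall>i<n. x i \<le> L" by (rule symbols_bounded)
  obtain C where C: "\<forall>x\<in>Shift M. (x 0, x 1) \<in> {..L} \<times> {..L} \<longrightarrow> \<bar>\<psi> x\<bar> \<le> C"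
    using tempered_locally_bounded[OF temp, of "{..L} \<times> {..L}"] by auto
  have bd: "\<bar>\<psi> (phase k \<omega>)\<bar> \<le> C" if "\<omega> \<in> space B" for k \<omega>
    using C phase_in_Shift[OF that] phase_le[OF that L] by simp
  note I = loop_integral[OF m bd]
  have e: "(\<Sum>k<n. \<psi> (phase k \<omega>)) = birkhoff_sum n \<psi> (concat_loops \<omega>)" for \<omega>
    by (simp add: birkhoff_sum_def phase_def)
  have i: "integrable B (\<lambda>\<omega>. birkhoff_sum n \<psi> (concat_loops \<omega>))"
    unfolding e[symmetric] by (intro Bochner_Integration.integrable_sum I(2))
  have "(\<Sum>x\<in>F. p x * birkhoff_sum n \<psi> x) - D = (\<integral>\<omega>. birkhoff_sum n \<psi> (\<omega> 0) - D \<partial>B)"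
    using B_component[of "birkhoff_sum n \<psi>" 0] by (simp add: B.prob_space)
  also have "\<dots> \<le> (\<integral>\<omega>. birkhoff_sum n \<psi> (concat_loops \<omega>) \<partial>B)"
  proof (rule integral_mono)
    fix \<omega> assume w: "\<omega> \<in> space B"
    then have "\<omega> 0 \<in> Shift M" using F_Per by (auto simp: space_B intro: Per_D)
    then show "birkhoff_sum n \<psi> (\<omega> 0) - D \<le> birkhoff_sum n \<psi> (concat_loops \<omega>)"
      using D[OF concat_in_Shift[OF w], of "\<omega> 0"] concat_agrees[OF w] by (simp add: abs_le_iff)
  qed (use B_component[of "birkhoff_sum n \<psi>" 0] i in simp_all)
  also have "\<dots> = (\<Sum>k<n. \<integral>\<omega>. \<psi> (phase k \<omega>) \<partial>B)"
    unfolding e[symmetric] by (rule Bochner_Integration.integral_sum) (rule I(2))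
  also have "\<dots> = real n * (\<integral>x. \<psi> x \<partial>loop_measure)" using n I(3) by simp
  finally have int: "((\<Sum>x\<in>F. p x * birkhoff_sum n \<psi> x) - D) / real n \<le> (\<integral>x. \<psi> x \<partial>loop_measure)"
    using n by (simp add: field_simps)
  have "ereal ((base_entropy + (\<Sum>x\<in>F. p x * birkhoff_sum n \<psi> x) - D) / real n)
      = ereal (base_entropy / real n) + ereal (((\<Sum>x\<in>F. p x * birkhoff_sum n \<psi> x) - D) / real n)"
    by (simp add: add_divide_distrib diff_divide_distrib)
  also have "\<dots> \<le> ks_entropy loop_measure + ext_integral loop_measure \<psi>"
    using int by (intro add_mono loop_entropy) (simp add: ext_integral_integrable[OF I(1)])
  also have "\<dots> \<le> pressure M \<psi>"
    unfolding pressure_def using loop_measure_inv ext_integral_integrable(2)[OF I(1)]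
    by (intro SUP_upper) auto
  finally show ?thesis .
qed

end

text \<open>
  For weights proportional to \<open>exp (birkhoff_sum n \<psi> x)\<close> the entropy and the mean of the Birkhoff sum
  add up to exactly the logarithm of the partition function of \<open>F\<close>.
\<close>

lemma pressure_ge_periodic_sum:
  assumes n: "0 < n" and F: "finite F" "F \<subseteq> Per M a n" "F \<noteq> {}"
    and m: "\<psi> \<in> borel_measurable (borel_Shift M)" and temp: "tempered_distortion M \<psi>"
    and D: "\<And>x y. x \<in> Shift M \<Longrightarrow> y \<in> Shift M \<Longrightarrow> \<forall>i\<le>n. x i = y i \<Longrightarrow>
      \<bar>birkhoff_sum n \<psi> x - birkhoff_sum n \<psi> y\<bar> \<le> D"
  shows "ereal ((ln (\<Sum>x\<in>F. exp (birkhoff_sum n \<psi> x)) - D) / real n) \<le> pressure M \<psi>"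
proof -
  define Z where "Z = (\<Sum>x\<in>F. exp (birkhoff_sum n \<psi> x))"
  have Z: "0 < Z" unfolding Z_def using F by (intro sum_pos) auto
  define p where "p x = exp (birkhoff_sum n \<psi> x) / Z" for x
  have p1: "(\<Sum>x\<in>F. p x) = 1"
    using Z unfolding p_def sum_divide_distrib[symmetric] by (simp add: Z_def)
  interpret bernoulli_loops M a n F p
  proof
    show "0 < p x" for x using Z by (simp add: p_def)
  qed (use n F p1 in simp_all)
  have "base_entropy + (\<Sum>x\<in>F. p x * birkhoff_sum n \<psi> x) = (\<Sum>x\<in>F. p x * ln Z)"
    unfolding base_entropy_def sum.distrib[symmetric]
  proof (intro sum.cong refl)
    fix x
    have "ln (p x) = birkhoff_sum n \<psi> x - ln Z" using Z by (simp add: p_def ln_div)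
    then have "- ln (p x) + birkhoff_sum n \<psi> x = ln Z" by linarith
    then show "p x * - ln (p x) + p x * birkhoff_sum n \<psi> x = p x * ln Z"
      by (metis distrib_left)
  qed
  also have "\<dots> = ln Z" unfolding sum_distrib_right[symmetric] p1 by simp
  finally have "base_entropy + (\<Sum>x\<in>F. p x * birkhoff_sum n \<psi> x) = ln Z" .
  with pressure_ge_loop_measure[OF m temp D] show ?thesis unfolding Z_def[symmetric] by (simp only:)
qed

text \<open>
  Upper bound for the growth of periodic sums. If \<open>Z_n\<close> exceeded \<open>exp (n q)\<close> for a large \<open>n\<close>, so would
  a finite partial sum, and its loop measure would have free energy larger than the pressure.
\<close>

lemma eventually_Zper_le:
  assumes m: "\<psi> \<in> borel_measurable (borel_Shift M)" and temp: "tempered_distortion M \<psi>"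
    and P: "pressure M \<psi> < ereal q"
  shows "eventually (\<lambda>n. Zper M \<psi> a n \<le> ennreal (exp (real n * q))) sequentially"
proof -
  obtain c where c: "pressure M \<psi> < ereal c" "c < q"
    using ereal_dense2[OF P] by auto
  define e where "e = (q - c) / 2"
  have e: "0 < e" using c by (simp add: e_def)
  obtain C where C: "\<forall>n. \<forall>x\<in>Shift M. \<forall>y\<in>Shift M. (\<forall>i\<le>n. x i = y i) \<longrightarrow>
     \<bar>birkhoff_sum n \<psi> x - birkhoff_sum n \<psi> y\<bar> \<le> C + e * real n"
    using temp e unfolding tempered_distortion_def by blast
  have Cn: "\<bar>birkhoff_sum n \<psi> x - birkhoff_sum n \<psi> y\<bar> \<le> C + e * real n"
    if "x \<in> Shift M" "y \<in> Shift M" "\<forall>i\<le>n. x i = y i" for n x y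
    by (rule C[rule_format, OF that(1,2)]) (use that(3) in simp)
  have "Zper M \<psi> a n \<le> ennreal (exp (real n * q))" if n: "n > nat \<lceil>C / e\<rceil>" "0 < n" for n
    unfolding Zper_def
  proof (rule infsum_ennreal_le)
    fix F assume F: "finite F" "F \<subseteq> Per M a n"
    show "(\<Sum>x\<in>F. ennreal (exp (birkhoff_sum n \<psi> x))) \<le> ennreal (exp (real n * q))"
    proof (cases "F = {}")
      case False
      let ?Z = "\<Sum>x\<in>F. exp (birkhoff_sum n \<psi> x)"
      have Z: "0 < ?Z" using F False by (intro sum_pos) auto
      have "ereal ((ln ?Z - (C + e * real n)) / real n) \<le> pressure M \<psi>"
        by (rule pressure_ge_periodic_sum[OF n(2) F False m temp Cn])
      also have "\<dots> < ereal c" by (rule c)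
      finally have "ln ?Z < c * real n + C + e * real n" using n(2) by (simp add: field_simps)
      also have "\<dots> \<le> c * real n + e * real n + e * real n"
      proof -
        have "C / e \<le> real n" using n(1) by linarith
        then show ?thesis using e by (simp add: field_simps)
      qed
      also have "\<dots> = real n * q" by (simp add: e_def field_simps)
      finally have "ln ?Z < real n * q" .
      from less_imp_le[OF this] have "exp (ln ?Z) \<le> exp (real n * q)" by (simp only: exp_le_cancel_iff)
      then have "?Z \<le> exp (real n * q)" by (simp only: exp_ln[OF Z])
      moreover have "(\<Sum>x\<in>F. ennreal (exp (birkhoff_sum n \<psi> x))) = ennreal ?Z"
        by (rule sum_ennreal) simp
      ultimately show ?thesis by (simp only: ennreal_leI)
    qed simp
  qed
  then show ?thesis
    by (rule eventually_mono[OF eventually_gt_at_top[of "nat \<lceil>C / e\<rceil>"]]) linarith+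
qed

section \<open>Supermultiplicativity of periodic sums\<close>

text \<open>
  Loops are given by a function \<open>v\<close> that matters on \<open>{0..n}\<close> only; it is repeated with period \<open>n\<close>.
\<close>

lemma closed_path_Per:
  assumes n: "0 < n" and step: "\<And>i. i < n \<Longrightarrow> M (v i) (v (Suc i))" and v: "v 0 = a" "v n = a"
  shows "\<exists>z\<in>Per M a n. \<forall>i\<le>n. z i = v i"
proof (intro bexI allI impI)
  let ?z = "\<lambda>i. v (i mod n)"
  show "?z \<in> Per M a n"
  proof (rule Per_I)
    show "?z \<in> Shift M"
      unfolding Shift_def
    proof safe
      fix i
      have lt: "i mod n < n" using n by simp
      have "v (Suc i mod n) = v (Suc (i mod n))"
        using v by (auto simp: mod_Suc)
      then show "M (v (i mod n)) (v (Suc i mod n))" using step[OF lt] by simp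
    qed
  qed (use v in auto)
  fix i assume "i \<le> n"
  then show "?z i = v i" using v by (cases "i = n") auto
qed

lemma mixing_path:
  assumes "admissible M w" "length w = Suc n" "i < n"
  shows "M (w ! i) (w ! Suc i)"
  using assms by (auto simp: admissible_def)

lemma mixing_Per_nonempty:
  assumes "topologically_mixing M"
  shows "\<exists>N>0. \<forall>n\<ge>N. Per M a n \<noteq> {}"
proof -
  obtain N where N: "\<forall>n\<ge>N. \<exists>w. admissible M w \<and> length w = n \<and> w \<noteq> [] \<and> hd w = a \<and> last w = a"
    using assms unfolding topologically_mixing_def by blast
  show ?thesis
  proof (intro exI[of _ "Suc N"] conjI allI impI)
    fix n assume n: "Suc N \<le> n"
    then obtain w where w: "admissible M w" "length w = Suc n" "w \<noteq> []" "hd w = a" "last w = a"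
      using N[rule_format, of "Suc n"] by auto
    have "\<exists>z\<in>Per M a n. \<forall>i\<le>n. z i = w ! i"
      by (rule closed_path_Per)
        (use n w in \<open>auto simp: hd_conv_nth last_conv_nth intro: mixing_path\<close>)
    then show "Per M a n \<noteq> {}" by blast
  qed simp
qed

lemma Per_concat:
  assumes k: "0 < k" and x: "x \<in> Per M a k" and y: "y \<in> Per M a m"
  obtains z where "z \<in> Per M a (k + m)" "\<And>i. i \<le> k \<Longrightarrow> z i = x i" "\<And>i. i \<le> m \<Longrightarrow> z (k + i) = y i"
proof -
  let ?v = "\<lambda>i. if i < k then x i else y (i - k)"
  have xk: "x k = a" using Per_D(2)[OF x] Per_D(3)[OF x, of 0] by simp
  have ym: "y m = a" using Per_D(2)[OF y] Per_D(3)[OF y, of 0] by simp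
  have "\<exists>z\<in>Per M a (k + m). \<forall>i\<le>k + m. z i = ?v i"
  proof (rule closed_path_Per)
    fix i assume "i < k + m"
    have X: "M (x i) (x (Suc i))" for i using Per_D(1)[OF x] by (simp add: Shift_def)
    have Y: "M (y i) (y (Suc i))" for i using Per_D(1)[OF y] by (simp add: Shift_def)
    consider "Suc i < k" | "Suc i = k" | "k \<le> i" by linarith
    then show "M (?v i) (?v (Suc i))"
    proof cases
      case 1 then show ?thesis using X by simp
    next
      case 2 then show ?thesis using X[of i] xk Per_D(2)[OF y] by auto
    next
      case 3 then show ?thesis using Y[of "i - k"] by (simp add: Suc_diff_le)
    qed
  qed (use k Per_D(2)[OF x] ym in auto)
  then obtain z where z: "z \<in> Per M a (k + m)" "\<forall>i\<le>k + m. z i = ?v i" by blast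
  show ?thesis
  proof (rule that[OF z(1)])
    show "z i = x i" if "i \<le> k" for i
      using z(2)[rule_format, of i] that xk Per_D(2)[OF y] by (cases "i = k") auto
    show "z (k + i) = y i" if "i \<le> m" for i
      using z(2)[rule_format, of "k + i"] that by simp
  qed
qed

lemma Per_eqI:
  assumes "x \<in> Per M a n" "y \<in> Per M a n" "0 < n" "\<And>i. i < n \<Longrightarrow> x i = y i"
  shows "x = y"
proof
  fix i show "x i = y i"
  proof (induction i rule: less_induct)
    case (less i)
    show ?case
    proof (cases "i < n")
      case False
      then have "x i = x (i - n)" "y i = y (i - n)"
        using Per_D(3)[OF assms(1), of "i - n"] Per_D(3)[OF assms(2), of "i - n"] by simp_all
      then show ?thesis using less[of "i - n"] False assms(3) by simp
    qed (use assms(4) in simp)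
  qed
qed

lemma periodic_sums_supermultiplicative:
  assumes V: "bounded_distortion M \<phi> V" and k: "0 < k" and m: "0 < m"
    and F: "finite F" "F \<subseteq> Per M a k" and G: "finite G" "G \<subseteq> Per M a m"
  obtains H where "finite H" "H \<subseteq> Per M a (k + m)"
    "exp (- (2 * V)) * (\<Sum>x\<in>F. exp (birkhoff_sum k \<phi> x)) * (\<Sum>y\<in>G. exp (birkhoff_sum m \<phi> y))
      \<le> (\<Sum>z\<in>H. exp (birkhoff_sum (k + m) \<phi> z))"
proof -
  have "\<exists>z. z \<in> Per M a (k + m) \<and> (\<forall>i\<le>k. z i = x i) \<and> (\<forall>i\<le>m. z (k + i) = y i)"
    if "x \<in> Per M a k" "y \<in> Per M a m" for x y
    by (rule Per_concat[OF k that]) blast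
  then obtain j where j: "\<And>x y. x \<in> Per M a k \<Longrightarrow> y \<in> Per M a m \<Longrightarrow> j x y \<in> Per M a (k + m) \<and>
      (\<forall>i\<le>k. j x y i = x i) \<and> (\<forall>i\<le>m. j x y (k + i) = y i)"
    by metis
  let ?H = "(\<lambda>(x, y). j x y) ` (F \<times> G)"
  have inj: "inj_on (\<lambda>(x, y). j x y) (F \<times> G)"
  proof (rule inj_onI, clarify)
    fix x y x' y' assume *: "x \<in> F" "y \<in> G" "x' \<in> F" "y' \<in> G" "j x y = j x' y'"
    then have P: "x \<in> Per M a k" "y \<in> Per M a m" "x' \<in> Per M a k" "y' \<in> Per M a m" using F G by auto
    have "x i = x' i" if "i < k" for i
      using j[OF P(1,2)] j[OF P(3,4)] *(5) that by (metis less_imp_le)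
    moreover have "y i = y' i" if "i < m" for i
      using j[OF P(1,2)] j[OF P(3,4)] *(5) that by (metis less_imp_le)
    ultimately show "x = x' \<and> y = y'"
      using Per_eqI[OF P(1,3) k] Per_eqI[OF P(2,4) m] by blast
  qed
  have term_ge: "exp (- (2 * V)) * (exp (birkhoff_sum k \<phi> x) * exp (birkhoff_sum m \<phi> y))
      \<le> exp (birkhoff_sum (k + m) \<phi> (j x y))" if "x \<in> F" "y \<in> G" for x y
  proof -
    have P: "x \<in> Per M a k" "y \<in> Per M a m" using that F G by auto
    note z = j[OF P]
    have S: "x \<in> Shift M" "y \<in> Shift M" "j x y \<in> Shift M" using P z by (auto dest: Per_D)
    have "\<bar>birkhoff_sum k \<phi> (j x y) - birkhoff_sum k \<phi> x\<bar> \<le> V"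
      using V S z unfolding bounded_distortion_def by blast
    moreover have "\<bar>birkhoff_sum m \<phi> ((shift ^^ k) (j x y)) - birkhoff_sum m \<phi> y\<bar> \<le> V"
    proof -
      have "\<forall>i\<le>m. (shift ^^ k) (j x y) i = y i" using z by (simp add: shift_pow_apply add.commute)
      then show ?thesis using V S(2) shift_pow_in_Shift[OF S(3)] unfolding bounded_distortion_def by blast
    qed
    ultimately show ?thesis
      unfolding exp_add[symmetric] birkhoff_sum_cocycle by simp
  qed
  show ?thesis
  proof (rule that)
    show "finite ?H" using F G by simp
    show "?H \<subseteq> Per M a (k + m)" using j F G by auto
    have "exp (- (2 * V)) * (\<Sum>x\<in>F. exp (birkhoff_sum k \<phi> x)) * (\<Sum>y\<in>G. exp (birkhoff_sum m \<phi> y))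
        = (\<Sum>(x, y)\<in>F \<times> G. exp (- (2 * V)) * (exp (birkhoff_sum k \<phi> x) * exp (birkhoff_sum m \<phi> y)))"
    proof -
      have "exp (- (2 * V)) * (\<Sum>x\<in>F. exp (birkhoff_sum k \<phi> x)) * (\<Sum>y\<in>G. exp (birkhoff_sum m \<phi> y))
          = exp (- (2 * V)) * (\<Sum>x\<in>F. \<Sum>y\<in>G. exp (birkhoff_sum k \<phi> x) * exp (birkhoff_sum m \<phi> y))"
        by (simp only: mult.assoc sum_product)
      also have "\<dots> = (\<Sum>x\<in>F. \<Sum>y\<in>G. exp (- (2 * V)) * (exp (birkhoff_sum k \<phi> x) * exp (birkhoff_sum m \<phi> y)))"
        by (simp only: sum_distrib_left)
      finally show ?thesis by (simp only: sum.cartesian_product)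
    qed
    also have "\<dots> \<le> (\<Sum>(x, y)\<in>F \<times> G. exp (birkhoff_sum (k + m) \<phi> (j x y)))"
      using term_ge by (intro sum_mono) auto
    also have "\<dots> = (\<Sum>z\<in>?H. exp (birkhoff_sum (k + m) \<phi> z))"
      unfolding sum.reindex[OF inj] by (simp add: case_prod_unfold)
    finally show "exp (- (2 * V)) * (\<Sum>x\<in>F. exp (birkhoff_sum k \<phi> x)) * (\<Sum>y\<in>G. exp (birkhoff_sum m \<phi> y))
      \<le> (\<Sum>z\<in>?H. exp (birkhoff_sum (k + m) \<phi> z))" .
  qed
qed

text \<open>
  By supermultiplicativity one large partition function forces exponential growth at that rate along
  all lengths \<open>q * l + r\<close>. The remainder \<open>r\<close> is taken from \<open>{N..<N + l}\<close>, where loops exist by mixing.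
\<close>

lemma Zper_growth:
  assumes V: "bounded_distortion M \<phi> V" and mix: "topologically_mixing M" and l: "0 < l"
    and big: "ennreal (exp (2 * V + real l * p)) < Zper M \<phi> a l"
  obtains c where "0 < c" "eventually (\<lambda>n. ennreal (c * exp (real n * p)) \<le> Zper M \<phi> a n) sequentially"
proof -
  obtain F where F: "finite F" "F \<subseteq> Per M a l" and Fb: "exp (2 * V + real l * p) < (\<Sum>x\<in>F. exp (birkhoff_sum l \<phi> x))"
  proof -
    obtain F where F: "finite F" "F \<subseteq> Per M a l" "ennreal (exp (2 * V + real l * p)) < (\<Sum>x\<in>F. ennreal (exp (birkhoff_sum l \<phi> x)))"
      using big unfolding Zper_def by (rule less_infsum_ennreal)
    have "(\<Sum>x\<in>F. ennreal (exp (birkhoff_sum l \<phi> x))) = ennreal (\<Sum>x\<in>F. exp (birkhoff_sum l \<phi> x))"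
      by (rule sum_ennreal) simp
    with F show ?thesis using that by (simp add: ennreal_less_iff)
  qed
  obtain N where N: "0 < N" "\<And>n. n \<ge> N \<Longrightarrow> Per M a n \<noteq> {}" using mixing_Per_nonempty[OF mix] by blast
  have "\<forall>n. \<exists>y. n \<ge> N \<longrightarrow> y \<in> Per M a n" using N(2) by blast
  then obtain y where y: "\<And>n. n \<ge> N \<Longrightarrow> y n \<in> Per M a n" by metis
  have ind: "\<exists>H. finite H \<and> H \<subseteq> Per M a (q * l + r) \<and>
      exp (real q * (real l * p)) * exp (birkhoff_sum r \<phi> (y r)) \<le> (\<Sum>z\<in>H. exp (birkhoff_sum (q * l + r) \<phi> z))" if r: "r \<ge> N" for q r
  proof (induction q)
    case 0
    show ?case using y[OF r] by (intro exI[of _ "{y r}"]) simp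
  next
    case (Suc q)
    then obtain H where H: "finite H" "H \<subseteq> Per M a (q * l + r)"
      "exp (real q * (real l * p)) * exp (birkhoff_sum r \<phi> (y r)) \<le> (\<Sum>z\<in>H. exp (birkhoff_sum (q * l + r) \<phi> z))" by blast
    have pos: "0 < q * l + r" using r N by simp
    obtain H' where H': "finite H'" "H' \<subseteq> Per M a (l + (q * l + r))"
      "exp (- (2 * V)) * (\<Sum>x\<in>F. exp (birkhoff_sum l \<phi> x)) * (\<Sum>z\<in>H. exp (birkhoff_sum (q * l + r) \<phi> z))
        \<le> (\<Sum>z\<in>H'. exp (birkhoff_sum (l + (q * l + r)) \<phi> z))"
      by (rule periodic_sums_supermultiplicative[OF V l pos F H(1,2)])
    have "exp (real (Suc q) * (real l * p)) * exp (birkhoff_sum r \<phi> (y r))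
        = exp (- (2 * V)) * exp (2 * V + real l * p) * (exp (real q * (real l * p)) * exp (birkhoff_sum r \<phi> (y r)))"
      by (simp flip: exp_add add: algebra_simps)
    also have "\<dots> \<le> exp (- (2 * V)) * (\<Sum>x\<in>F. exp (birkhoff_sum l \<phi> x)) * (\<Sum>z\<in>H. exp (birkhoff_sum (q * l + r) \<phi> z))"
      using Fb H(3) by (intro mult_mono mult_left_mono) (auto intro!: mult_nonneg_nonneg sum_nonneg)
    finally show ?case using H' by (intro exI[of _ H']) (simp add: algebra_simps)
  qed
  define c where "c = Min ((\<lambda>r. exp (birkhoff_sum r \<phi> (y r) - real r * p)) ` {N..<N + l})"
  have ne: "(\<lambda>r. exp (birkhoff_sum r \<phi> (y r) - real r * p)) ` {N..<N + l} \<noteq> {}" using l by simp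
  have c0: "0 < c" unfolding c_def using ne by (subst Min_gr_iff) auto
  have cle: "c \<le> exp (birkhoff_sum r \<phi> (y r) - real r * p)" if "N \<le> r" "r < N + l" for r
    unfolding c_def using that by (intro Min_le) auto
  show ?thesis
  proof (rule that[OF c0])
    show "eventually (\<lambda>n. ennreal (c * exp (real n * p)) \<le> Zper M \<phi> a n) sequentially"
      unfolding eventually_sequentially
    proof (intro exI[of _ N] allI impI)
      fix n assume n: "N \<le> n"
      define q where "q = (n - N) div l"
      define r where "r = N + (n - N) mod l"
      have r: "N \<le> r" "r < N + l" using l by (auto simp: r_def)
      have nqr: "n = q * l + r" using n by (simp add: q_def r_def)
      obtain H where H: "finite H" "H \<subseteq> Per M a n"
        "exp (real q * (real l * p)) * exp (birkhoff_sum r \<phi> (y r)) \<le> (\<Sum>z\<in>H. exp (birkhoff_sum n \<phi> z))"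
        using ind[OF r(1), of q] nqr by auto
      have "c * exp (real n * p) \<le> exp (birkhoff_sum r \<phi> (y r) - real r * p) * exp (real n * p)"
        using cle[OF r] by (intro mult_right_mono) auto
      also have "\<dots> = exp (real q * (real l * p)) * exp (birkhoff_sum r \<phi> (y r))"
        unfolding exp_add[symmetric] by (simp add: nqr algebra_simps)
      also have "\<dots> \<le> (\<Sum>z\<in>H. exp (birkhoff_sum n \<phi> z))" by (rule H(3))
      finally have "ennreal (c * exp (real n * p)) \<le> ennreal (\<Sum>z\<in>H. exp (birkhoff_sum n \<phi> z))"
        by (rule ennreal_leI)
      also have "\<dots> = (\<Sum>z\<in>H. ennreal (exp (birkhoff_sum n \<phi> z)))" by (rule sum_ennreal[symmetric]) simp
      also have "\<dots> \<le> Zper M \<phi> a n" unfolding Zper_def by (rule sum_le_infsum_ennreal[OF H(1,2)])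
      finally show "ennreal (c * exp (real n * p)) \<le> Zper M \<phi> a n" .
    qed
  qed
qed

section \<open>Closing orbit segments\<close>

lemma word_letters_bounded: "\<exists>L. \<forall>b\<le>m. \<forall>i\<le>J. (v :: nat \<Rightarrow> nat \<Rightarrow> nat) b i \<le> L"
proof -
  have fin: "finite ((\<lambda>(b, i). v b i) ` ({..m} \<times> {..J}))" by simp
  show ?thesis
  proof (intro exI allI impI)
    fix b i assume "b \<le> m" "i \<le> J"
    then have "v b i \<in> (\<lambda>(b, i). v b i) ` ({..m} \<times> {..J})" by force
    then show "v b i \<le> Max ((\<lambda>(b, i). v b i) ` ({..m} \<times> {..J}))" using fin by (rule Max_ge[rotated])
  qed
qed

text \<open>
  Mixing provides connections of one common length \<open>J\<close> for all of the finitely many symbols up to \<open>m\<close>,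
  in both directions. A common length keeps the period of the closed-up orbits below independent of
  their end symbols.
\<close>

lemma connecting_words:
  assumes "topologically_mixing M"
  obtains J u w where "0 < J"
    "\<forall>b\<le>m. u b 0 = a \<and> u b J = b \<and> (\<forall>i<J. M (u b i) (u b (Suc i)))"
    "\<forall>b\<le>m. w b 0 = b \<and> w b J = a \<and> (\<forall>i<J. M (w b i) (w b (Suc i)))"
proof -
  have "\<forall>b c. \<exists>N. \<forall>n\<ge>N. \<exists>w. admissible M w \<and> length w = n \<and> w \<noteq> [] \<and> hd w = b \<and> last w = c"
    using assms unfolding topologically_mixing_def .
  then obtain N where N: "\<And>b c n. n \<ge> N b c \<Longrightarrow> \<exists>w. admissible M w \<and> length w = n \<and> w \<noteq> [] \<and> hd w = b \<and> last w = c"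
    by metis
  define J where "J = Suc (\<Sum>b\<le>m. N a b + N b a)"
  have le: "N a b + N b a \<le> Suc J" if "b \<le> m" for b
  proof -
    have "N a b + N b a \<le> (\<Sum>b\<le>m. N a b + N b a)" using that by (intro member_le_sum) auto
    then show ?thesis by (simp add: J_def)
  qed
  have path: "\<exists>v. v 0 = b \<and> v J = c \<and> (\<forall>i<J. M (v i) (v (Suc i)))" if bc: "N b c \<le> Suc J" for b c
  proof -
    obtain w where "admissible M w" "length w = Suc J" "w \<noteq> []" "hd w = b" "last w = c" using N[OF bc] by blast
    then show ?thesis
      by (intro exI[of _ "(!) w"]) (auto simp: hd_conv_nth last_conv_nth intro: mixing_path)
  qed
  have "\<forall>b. \<exists>v. b \<le> m \<longrightarrow> v 0 = a \<and> v J = b \<and> (\<forall>i<J. M (v i) (v (Suc i)))"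
    using path[of a] le by (metis add_leD1)
  then obtain u where u: "\<And>b. b \<le> m \<Longrightarrow> u b 0 = a \<and> u b J = b \<and> (\<forall>i<J. M (u b i) (u b (Suc i)))"
    by metis
  have "\<forall>b. \<exists>v. b \<le> m \<longrightarrow> v 0 = b \<and> v J = a \<and> (\<forall>i<J. M (v i) (v (Suc i)))"
    using path[of _ a] le by (metis add_leD2)
  then obtain w where w: "\<And>b. b \<le> m \<Longrightarrow> w b 0 = b \<and> w b J = a \<and> (\<forall>i<J. M (w b i) (w b (Suc i)))"
    by metis
  show ?thesis using u w by (intro that[of J u w]) (simp_all add: J_def)
qed

text \<open>
  An orbit segment that starts and ends in \<open>{..m}\<close> is turned into a loop at \<open>a\<close> by inserting connecting
  words of length \<open>J\<close>. The Birkhoff sum changes by a bounded amount: on the connecting words only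
  finitely many pairs of symbols occur, and the segment itself is compared with bounded distortion.
\<close>

lemma closing_lemma:
  assumes mix: "topologically_mixing M" and V: "bounded_distortion M \<phi> V"
  obtains J D where "0 < J" "0 \<le> D"
    "\<forall>x\<in>Shift M. \<forall>s t. s \<le> t \<longrightarrow> x s \<le> m \<longrightarrow> x t \<le> m \<longrightarrow>
      (\<exists>z\<in>Per M a (t - s + 2 * J). (\<forall>i\<le>t - s. z (J + i) = x (s + i)) \<and>
        birkhoff_sum (t - s) \<phi> ((shift ^^ s) x) - D \<le> birkhoff_sum (t - s + 2 * J) \<phi> z)"
proof -
  obtain J u w where J: "0 < J"
    and u': "\<forall>b\<le>m. u b 0 = a \<and> u b J = b \<and> (\<forall>i<J. M (u b i) (u b (Suc i)))"
    and w': "\<forall>b\<le>m. w b 0 = b \<and> w b J = a \<and> (\<forall>i<J. M (w b i) (w b (Suc i)))"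
    using connecting_words[OF mix, of m a] by blast
  have u: "u b 0 = a \<and> u b J = b \<and> (\<forall>i<J. M (u b i) (u b (Suc i)))" if "b \<le> m" for b
    using u' that by blast
  have w: "w b 0 = b \<and> w b J = a \<and> (\<forall>i<J. M (w b i) (w b (Suc i)))" if "b \<le> m" for b
    using w' that by blast
  obtain L1 where L1: "\<forall>b\<le>m. \<forall>i\<le>J. u b i \<le> L1" using word_letters_bounded by blast
  obtain L2 where L2: "\<forall>b\<le>m. \<forall>i\<le>J. w b i \<le> L2" using word_letters_bounded by blast
  define L where "L = max L1 L2"
  have L: "u b i \<le> L" "w b i \<le> L" if "b \<le> m" "i \<le> J" for b i
    using L1 L2 that by (auto simp: L_def max.coboundedI1 max.coboundedI2)
  obtain D0 where "\<forall>x\<in>Shift M. (x 0, x 1) \<in> {..L} \<times> {..L} \<longrightarrow> \<bar>\<phi> x\<bar> \<le> D0"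
    using tempered_locally_bounded[OF bounded_imp_tempered[OF V], of "{..L} \<times> {..L}"] by auto
  then have D0: "\<bar>\<phi> x\<bar> \<le> D0" if "x \<in> Shift M" "x 0 \<le> L" "x 1 \<le> L" for x using that by auto
  have edge: "- (real J * \<bar>D0\<bar>) \<le> birkhoff_sum J \<phi> y" if "y \<in> Shift M" "\<And>i. i \<le> J \<Longrightarrow> y i \<le> L" for y
  proof -
    have "real J * - \<bar>D0\<bar> = (\<Sum>i<J. - \<bar>D0\<bar>)" by simp
    also have "\<dots> \<le> birkhoff_sum J \<phi> y"
      unfolding birkhoff_sum_def
    proof (rule sum_mono)
      fix i assume "i \<in> {..<J}"
      then have "\<bar>\<phi> ((shift ^^ i) y)\<bar> \<le> D0"
        by (intro D0 shift_pow_in_Shift) (use that in \<open>auto simp: shift_pow_apply\<close>)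
      then show "- \<bar>D0\<bar> \<le> \<phi> ((shift ^^ i) y)" by linarith
    qed
    finally show ?thesis by simp
  qed
  show ?thesis
  proof (rule that[OF J, of "2 * (real J * \<bar>D0\<bar>) + \<bar>V\<bar>"], simp, intro ballI allI impI)
    fix x s t assume x: "x \<in> Shift M" and st: "s \<le> t" and m: "x s \<le> m" "x t \<le> m"
    define l where "l = t - s"
    \<comment> \<open>The loop: a word from \<open>a\<close> to \<open>x s\<close>, the segment, and a word from \<open>x t\<close> back to \<open>a\<close>.\<close>
    define v where "v i = (if i < J then u (x s) i else if i \<le> J + l then x (s + (i - J)) else w (x t) (i - (J + l)))" for i
    have "\<exists>z\<in>Per M a (l + 2 * J). \<forall>i\<le>l + 2 * J. z i = v i"
    proof (rule closed_path_Per)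
      fix i assume i: "i < l + 2 * J"
      have X: "M (x i) (x (Suc i))" for i using x by (simp add: Shift_def)
      consider "Suc i < J" | "Suc i = J" | "J \<le> i" "i < J + l" | "i = J + l" | "J + l < i" by linarith
      then show "M (v i) (v (Suc i))"
      proof cases
        case 1 then show ?thesis using u[OF m(1)] by (simp add: v_def)
      next
        case 2
        then have "M (u (x s) i) (x s)" using u[OF m(1)] by (metis lessI)
        then show ?thesis using 2 by (auto simp: v_def)
      next
        case 3 then show ?thesis using X[of "s + (i - J)"] by (simp add: v_def Suc_diff_le)
      next
        case 4
        then have "M (w (x t) 0) (w (x t) (Suc 0))" using w[OF m(2)] J by blast
        moreover have "s + l = t" using st by (simp add: l_def)
        ultimately show ?thesis using 4 w[OF m(2)] by (simp add: v_def)
      next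
        case 5
        have lt: "i - (J + l) < J" using i 5 by simp
        have "M (w (x t) (i - (J + l))) (w (x t) (Suc (i - (J + l))))" using w[OF m(2)] lt by blast
        then show ?thesis using 5 by (simp add: v_def Suc_diff_le)
      qed
    next
      show "0 < l + 2 * J" using J by simp
      show "v 0 = a" using J u[OF m(1)] by (simp add: v_def)
      show "v (l + 2 * J) = a" using J w[OF m(2)] by (simp add: v_def mult_2)
    qed
    then obtain z where z': "z \<in> Per M a (l + 2 * J)" "\<forall>i\<le>l + 2 * J. z i = v i" by blast
    have z: "z \<in> Per M a (l + 2 * J)" "i \<le> l + 2 * J \<Longrightarrow> z i = v i" for i using z' by auto
    have zS: "z \<in> Shift M" using z by (auto dest: Per_D)
    have mid: "z (J + i) = x (s + i)" if "i \<le> l" for i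
      using z(2)[of "J + i"] that by (simp add: v_def)
    have first: "z i \<le> L" if "i \<le> J" for i
    proof (cases "i = J")
      case True
      then show ?thesis using mid[of 0] L(1)[OF m(1), of J] u[OF m(1)] by simp
    next
      case False
      then show ?thesis using z(2)[of i] that L(1)[OF m(1), of i] by (simp add: v_def)
    qed
    have last: "z (i + (J + l)) \<le> L" if "i \<le> J" for i
    proof (cases "i = 0")
      case True
      then show ?thesis using mid[of l] L(2)[OF m(2), of 0] w[OF m(2)] st by (simp add: l_def)
    next
      case False
      then show ?thesis using z(2)[of "i + (J + l)"] that L(2)[OF m(2), of i] by (simp add: v_def)
    qed
    have A: "- (real J * \<bar>D0\<bar>) \<le> birkhoff_sum J \<phi> z" using zS first by (rule edge)
    have B: "- (real J * \<bar>D0\<bar>) \<le> birkhoff_sum J \<phi> ((shift ^^ (J + l)) z)"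
      using last by (intro edge shift_pow_in_Shift zS) (simp add: shift_pow_apply)
    have "\<forall>i\<le>l. (shift ^^ J) z i = (shift ^^ s) x i"
      using mid by (simp add: shift_pow_apply add.commute)
    then have C: "\<bar>birkhoff_sum l \<phi> ((shift ^^ J) z) - birkhoff_sum l \<phi> ((shift ^^ s) x)\<bar> \<le> V"
      using V shift_pow_in_Shift[OF zS] shift_pow_in_Shift[OF x] unfolding bounded_distortion_def by blast
    have "birkhoff_sum (l + 2 * J) \<phi> z = birkhoff_sum ((J + l) + J) \<phi> z" by (simp add: mult_2 add_ac)
    also have "\<dots> = birkhoff_sum J \<phi> z + birkhoff_sum l \<phi> ((shift ^^ J) z) + birkhoff_sum J \<phi> ((shift ^^ (J + l)) z)"
      unfolding birkhoff_sum_cocycle ..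
    finally have "birkhoff_sum l \<phi> ((shift ^^ s) x) - (2 * (real J * \<bar>D0\<bar>) + \<bar>V\<bar>) \<le> birkhoff_sum (l + 2 * J) \<phi> z"
      using A B C by linarith
    with z(1) mid show "\<exists>z\<in>Per M a (t - s + 2 * J). (\<forall>i\<le>t - s. z (J + i) = x (s + i)) \<and>
        birkhoff_sum (t - s) \<phi> ((shift ^^ s) x) - (2 * (real J * \<bar>D0\<bar>) + \<bar>V\<bar>) \<le> birkhoff_sum (t - s + 2 * J) \<phi> z"
      unfolding l_def by blast
  qed
qed

section \<open>Codes generated by loops\<close>

lemma infsum_sum_ennreal:
  fixes f :: "'c \<Rightarrow> 'a \<Rightarrow> ennreal"
  assumes "finite L"
  shows "(\<Sum>c\<in>L. infsum (f c) A) = infsum (\<lambda>z. \<Sum>c\<in>L. f c z) A"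
  using assms
proof (induction L rule: finite_induct)
  case (insert c L)
  then show ?case by (simp add: infsum_add nonneg_summable_on_complete)
qed simp

text \<open>
  Product weights on words, whose factor may depend on the position, have the product of the sums as
  total mass.
\<close>

lemma sum_lists_prod:
  fixes g :: "nat \<Rightarrow> 'b \<Rightarrow> real"
  assumes R: "finite R"
  shows "(\<Sum>c | length c = n \<and> set c \<subseteq> R. \<Prod>i<n. g i (c ! i)) = (\<Prod>i<n. \<Sum>d\<in>R. g i d)"
proof (induction n)
  case (Suc n)
  let ?L = "\<lambda>n. {c. length c = n \<and> set c \<subseteq> R}"
  have im: "?L (Suc n) = (\<lambda>(c, d). c @ [d]) ` (?L n \<times> R)"
  proof safe
    fix c assume c: "length c = Suc n" "set c \<subseteq> R"
    then have "c = butlast c @ [last c]" by (metis append_butlast_last_id length_0_conv nat.distinct(1))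
    moreover from this have "last c \<in> R" "set (butlast c) \<subseteq> R"
      using c by (metis in_set_conv_decomp subsetD, metis in_set_butlastD subset_iff)
    ultimately show "c \<in> (\<lambda>(c, d). c @ [d]) ` (?L n \<times> R)" using c
      by (intro image_eqI[of _ _ "(butlast c, last c)"]) auto
  qed auto
  have inj: "inj_on (\<lambda>(c, d). c @ [d]) (?L n \<times> R)" by (auto simp: inj_on_def)
  have "(\<Sum>c\<in>?L (Suc n). \<Prod>i<Suc n. g i (c ! i)) = (\<Sum>(c, d)\<in>?L n \<times> R. (\<Prod>i<n. g i (c ! i)) * g n d)"
    unfolding im sum.reindex[OF inj]
    by (intro sum.cong) (auto simp: nth_append intro!: prod.cong)
  also have "\<dots> = (\<Sum>c\<in>?L n. \<Prod>i<n. g i (c ! i)) * (\<Sum>d\<in>R. g n d)"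
    by (simp add: sum_product sum.cartesian_product)
  also have "\<dots> = (\<Prod>i<Suc n. \<Sum>d\<in>R. g i d)" using Suc by simp
  finally show ?case .
next
  case 0
  have "{c. length c = 0 \<and> set c \<subseteq> R} = {[]}" by auto
  then show ?case by simp
qed

definition determined :: "nat \<Rightarrow> ((nat \<Rightarrow> nat) \<Rightarrow> 'b) \<Rightarrow> bool" where
  "determined k h \<longleftrightarrow> (\<forall>x y. (\<forall>i<k. x i = y i) \<longrightarrow> h x = h y)"

text \<open>
  A stochastic kernel: it keeps the symbol \<open>c'\<close> with probability \<open>1 - e\<close> and otherwise chooses one of
  \<open>r\<close> symbols uniformly. It lets a cylinder function \<open>f'\<close> predict a measurable function \<open>f\<close> that
  differs from it on a set of small measure.
\<close>

definition noisy :: "real \<Rightarrow> nat \<Rightarrow> nat \<Rightarrow> nat \<Rightarrow> real" where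
  "noisy e r c c' = (1 - e) * of_bool (c = c') + e / real r"

lemma noisy_nonneg: "0 < e \<Longrightarrow> e < 1 \<Longrightarrow> 0 \<le> noisy e r c c'"
  by (simp add: noisy_def)

lemma noisy_sum:
  assumes "finite R" "R \<noteq> {}" "0 < e" "e < 1"
  shows "(\<Sum>c\<in>R. noisy e (card R) c c') \<le> 1"
proof -
  have "(\<Sum>c\<in>R. noisy e (card R) c c') = (1 - e) * (\<Sum>c\<in>R. of_bool (c = c')) + e"
    using assms by (simp add: noisy_def sum.distrib sum_distrib_left card_gt_0_iff)
  also have "(\<Sum>c\<in>R. of_bool (c = c')) = (of_bool (c' \<in> R) :: real)"
    using assms by (simp add: of_bool_def sum.delta)
  also have "(1 - e) * of_bool (c' \<in> R) + e \<le> 1" using assms by (simp add: of_bool_def)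
  finally show ?thesis .
qed

text \<open>
  A code for the words of length \<open>n\<close> over the finite alphabet \<open>R\<close> of values of a partition \<open>f\<close>. A word
  is generated by choosing a window \<open>{s..t}\<close> and a loop \<open>z\<close> of length \<open>t - s + 2 * J\<close> with probability
  proportional to \<open>exp (birkhoff_sum _ \<phi> z)\<close>. Inside the window the symbols are predicted by \<open>f'\<close> along
  the orbit of \<open>z\<close>, up to noise, and outside they are uniform. Since the alphabet is infinite, the
  symbols of the orbit outside the window cannot be coded at finite cost; only the finitely many values
  of \<open>f\<close> are coded there.
\<close>

locale loop_coding =
  fixes M :: "nat \<Rightarrow> nat \<Rightarrow> bool" and a :: nat and \<phi> :: "(nat \<Rightarrow> nat) \<Rightarrow> real" and C p :: real
    and R :: "nat set" and f' :: "(nat \<Rightarrow> nat) \<Rightarrow> nat" and k J :: nat and e :: real and n :: nat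
  assumes Z: "0 < l \<Longrightarrow> Zper M \<phi> a l \<le> ennreal (exp (C + real l * p))"
    and J: "0 < J" and R: "finite R" "R \<noteq> {}" and e: "0 < e" "e < 1"
begin

text \<open>
  The prediction \<open>f'\<close> at place \<open>i\<close> reads the \<open>k\<close> places from \<open>i\<close> on, and these have to lie in the window.
\<close>

definition symbol_weight :: "nat \<Rightarrow> nat \<Rightarrow> (nat \<Rightarrow> nat) \<Rightarrow> nat \<Rightarrow> nat \<Rightarrow> real" where
  "symbol_weight s t z i c =
     (if s \<le> i \<and> i + k \<le> t + 1 then noisy e (card R) c (f' ((shift ^^ (J + (i - s))) z)) else 1 / real (card R))"

text \<open>
  The assumption on the growth of \<open>Zper\<close> makes this a subprobability on the loops of length \<open>l\<close>.
\<close>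

definition loop_weight :: "nat \<Rightarrow> (nat \<Rightarrow> nat) \<Rightarrow> real" where
  "loop_weight l z = exp (birkhoff_sum l \<phi> z - C - real l * p)"

definition window_code :: "nat \<Rightarrow> nat \<Rightarrow> nat list \<Rightarrow> ennreal" where
  "window_code s t c = (\<Sum>\<^sub>\<infinity>z\<in>Per M a (t - s + 2 * J).
     ennreal (loop_weight (t - s + 2 * J) z * (\<Prod>i<n. symbol_weight s t z i (c ! i))))"

text \<open>
  A mixture with equal weights of the uniform code and of the codes of the \<open>n\<^sup>2\<close> windows. The mixture
  costs only \<open>ln (1 + n\<^sup>2)\<close>.
\<close>

definition code :: "nat list \<Rightarrow> real" where
  "code c = ((1 / real (card R)) ^ n + (\<Sum>s<n. \<Sum>t<n. enn2real (window_code s t c))) / (1 + (real n)\<^sup>2)"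

abbreviation words :: "nat list set" where
  "words \<equiv> {c. length c = n \<and> set c \<subseteq> R}"

lemma finite_words: "finite words"
  using finite_lists_length_eq[OF R(1), of n] by (simp add: conj_commute)

lemma symbol_weight_nonneg: "0 \<le> symbol_weight s t z i c"
  using noisy_nonneg[OF e] by (simp add: symbol_weight_def)

lemma symbol_weight_sum: "(\<Sum>c\<in>R. symbol_weight s t z i c) \<le> 1"
proof (cases "s \<le> i \<and> i + k \<le> t + 1")
  case True
  then show ?thesis using noisy_sum[OF R e] by (simp add: symbol_weight_def)
next
  case False
  then have "symbol_weight s t z i c = 1 / real (card R)" for c by (simp only: symbol_weight_def if_False)
  then show ?thesis using R by simp
qed

lemma window_code_sum: "(\<Sum>c\<in>words. window_code s t c) \<le> 1"
proof -
  let ?l = "t - s + 2 * J"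
  have "(\<Sum>c\<in>words. window_code s t c) = (\<Sum>\<^sub>\<infinity>z\<in>Per M a ?l.
     \<Sum>c\<in>words. ennreal (loop_weight ?l z * (\<Prod>i<n. symbol_weight s t z i (c ! i))))"
    unfolding window_code_def by (rule infsum_sum_ennreal[OF finite_words])
  also have "\<dots> \<le> (\<Sum>\<^sub>\<infinity>z\<in>Per M a ?l. ennreal (exp (- C - real ?l * p)) * ennreal (exp (birkhoff_sum ?l \<phi> z)))"
  proof (rule infsum_mono)
    fix z
    have "(\<Sum>c\<in>words. loop_weight ?l z * (\<Prod>i<n. symbol_weight s t z i (c ! i)))
        = loop_weight ?l z * (\<Prod>i<n. \<Sum>d\<in>R. symbol_weight s t z i d)"
      by (simp only: sum_distrib_left[symmetric] sum_lists_prod[OF R(1)])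
    also have "\<dots> \<le> loop_weight ?l z * 1"
      using symbol_weight_sum symbol_weight_nonneg
      by (intro mult_left_mono prod_le_1) (auto simp: loop_weight_def intro!: sum_nonneg)
    also have "\<dots> = exp (- C - real ?l * p) * exp (birkhoff_sum ?l \<phi> z)"
      unfolding loop_weight_def exp_add[symmetric] by (simp add: algebra_simps)
    finally have "ennreal (\<Sum>c\<in>words. loop_weight ?l z * (\<Prod>i<n. symbol_weight s t z i (c ! i)))
        \<le> ennreal (exp (- C - real ?l * p)) * ennreal (exp (birkhoff_sum ?l \<phi> z))"
      by (subst ennreal_mult[symmetric]) (auto intro: ennreal_leI)
    moreover have "(\<Sum>c\<in>words. ennreal (loop_weight ?l z * (\<Prod>i<n. symbol_weight s t z i (c ! i))))
        = ennreal (\<Sum>c\<in>words. loop_weight ?l z * (\<Prod>i<n. symbol_weight s t z i (c ! i)))"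
      by (rule sum_ennreal) (simp add: loop_weight_def prod_nonneg symbol_weight_nonneg)
    ultimately show "(\<Sum>c\<in>words. ennreal (loop_weight ?l z * (\<Prod>i<n. symbol_weight s t z i (c ! i))))
        \<le> ennreal (exp (- C - real ?l * p)) * ennreal (exp (birkhoff_sum ?l \<phi> z))" by simp
  qed (simp_all add: nonneg_summable_on_complete)
  also have "\<dots> \<le> ennreal (exp (- C - real ?l * p)) * Zper M \<phi> a ?l"
    by (rule infsum_ennreal_le)
      (simp only: sum_distrib_left[symmetric] Zper_def, intro mult_left_mono sum_le_infsum_ennreal, auto)
  also have "\<dots> \<le> ennreal (exp (- C - real ?l * p)) * ennreal (exp (C + real ?l * p))"
    using J by (intro mult_left_mono Z) auto
  also have "\<dots> = 1" by (simp only: ennreal_mult[symmetric] exp_ge_zero exp_add[symmetric]) simp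
  finally show ?thesis .
qed

lemma window_code_le_1: "c \<in> words \<Longrightarrow> window_code s t c \<le> 1"
  using window_code_sum[of s t] member_le_sum[of c words "window_code s t"] finite_words
  by (meson order_trans zero_le)

lemma code_nonneg: "0 \<le> code c"
  unfolding code_def by (intro divide_nonneg_nonneg add_nonneg_nonneg sum_nonneg) auto

lemma code_sum: "(\<Sum>c\<in>words. code c) \<le> 1"
proof -
  have u: "(\<Sum>c\<in>words. (1 / real (card R)) ^ n) = 1"
    using sum_lists_prod[OF R(1), where n = n and g = "\<lambda>_ _. 1 / real (card R)"] R by simp
  have w: "(\<Sum>c\<in>words. enn2real (window_code s t c)) \<le> 1" for s t
  proof -
    have "ennreal (\<Sum>c\<in>words. enn2real (window_code s t c)) = (\<Sum>c\<in>words. ennreal (enn2real (window_code s t c)))"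
      by (rule sum_ennreal[symmetric]) simp
    also have "\<dots> = (\<Sum>c\<in>words. window_code s t c)"
    proof (rule sum.cong[OF refl])
      fix c assume "c \<in> words"
      then have "window_code s t c < top"
        using window_code_le_1[of c s t] ennreal_one_less_top le_less_trans by blast
      then show "ennreal (enn2real (window_code s t c)) = window_code s t c" by simp
    qed
    also have "\<dots> \<le> 1" by (rule window_code_sum)
    finally show ?thesis by simp
  qed
  have "(\<Sum>c\<in>words. code c) = ((\<Sum>c\<in>words. (1 / real (card R)) ^ n)
      + (\<Sum>c\<in>words. \<Sum>s<n. \<Sum>t<n. enn2real (window_code s t c))) / (1 + (real n)\<^sup>2)"
    unfolding code_def sum_divide_distrib[symmetric] sum.distrib ..
  also have "(\<Sum>c\<in>words. \<Sum>s<n. \<Sum>t<n. enn2real (window_code s t c))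
      = (\<Sum>s<n. \<Sum>t<n. \<Sum>c\<in>words. enn2real (window_code s t c))"
    by (subst sum.swap, rule sum.cong[OF refl], rule sum.swap)
  also have "((\<Sum>c\<in>words. (1 / real (card R)) ^ n) + (\<Sum>s<n. \<Sum>t<n. \<Sum>c\<in>words. enn2real (window_code s t c))) / (1 + (real n)\<^sup>2)
      \<le> (1 + (\<Sum>s<n. \<Sum>t<n. 1)) / (1 + (real n)\<^sup>2)"
    unfolding u by (intro divide_right_mono add_left_mono sum_mono w) simp
  also have "\<dots> = 1"
    by (simp add: power2_eq_square add_nonneg_eq_0_iff)
  finally show ?thesis .
qed

lemma code_ge_uniform: "(1 / real (card R)) ^ n / (1 + (real n)\<^sup>2) \<le> code c"
  unfolding code_def by (intro divide_right_mono) (auto intro!: sum_nonneg)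

lemma code_ge_window:
  assumes "c \<in> words" "s < n" "t < n" "z \<in> Per M a (t - s + 2 * J)"
  shows "loop_weight (t - s + 2 * J) z * (\<Prod>i<n. symbol_weight s t z i (c ! i)) / (1 + (real n)\<^sup>2) \<le> code c"
proof -
  let ?x = "loop_weight (t - s + 2 * J) z * (\<Prod>i<n. symbol_weight s t z i (c ! i))"
  have x0: "0 \<le> ?x" by (simp add: loop_weight_def prod_nonneg symbol_weight_nonneg)
  have "ennreal ?x \<le> window_code s t c"
    unfolding window_code_def
    using sum_le_infsum_ennreal[of "{z}" "Per M a (t - s + 2 * J)"
        "\<lambda>z. ennreal (loop_weight (t - s + 2 * J) z * (\<Prod>i<n. symbol_weight s t z i (c ! i)))"] assms(4)
    by simp
  moreover have "window_code s t c < top"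
    using window_code_le_1[OF assms(1), of s t] ennreal_one_less_top le_less_trans by blast
  ultimately have "?x \<le> enn2real (window_code s t c)"
    using enn2real_mono[of "ennreal ?x" "window_code s t c"] enn2real_ennreal[OF x0] by simp
  also have "\<dots> \<le> (\<Sum>t<n. enn2real (window_code s t c))"
    using assms by (intro member_le_sum) auto
  also have "\<dots> \<le> (\<Sum>s<n. \<Sum>t<n. enn2real (window_code s t c))"
    using assms member_le_sum[of s "{..<n}" "\<lambda>s. \<Sum>t<n. enn2real (window_code s t c)"] by (simp add: sum_nonneg)
  finally have "?x \<le> (1 / real (card R)) ^ n + (\<Sum>s<n. \<Sum>t<n. enn2real (window_code s t c))"
    by (simp add: add_increasing)
  then show ?thesis unfolding code_def by (intro divide_right_mono) auto
qed

end

section \<open>Approximation of finite partitions by cylinders\<close>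

lemma determined_mono: "determined k h \<Longrightarrow> k \<le> k' \<Longrightarrow> determined k' h"
  unfolding determined_def by (meson less_le_trans)

lemma determined_sets:
  assumes "determined k (\<lambda>x. x \<in> D)"
  shows "D \<in> sets (borel :: (nat \<Rightarrow> nat) measure)"
proof -
  have "open (\<Union>x\<in>D. {y. \<forall>i<k. y i = x i})" using open_cylinder by blast
  moreover have "(\<Union>x\<in>D. {y. \<forall>i<k. y i = x i}) = D" using assms unfolding determined_def by blast
  ultimately show ?thesis by simp
qed

text \<open>
  The sets with this property form a sigma algebra that contains the sets given by one coordinate.
\<close>

lemma approx_by_determined_set:
  fixes \<nu> :: "(nat \<Rightarrow> nat) measure"
  assumes fin: "finite_measure \<nu>" and S: "sets \<nu> = sets borel" and A: "A \<in> sets borel"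
  shows "\<forall>\<delta>>0. \<exists>k D. determined k (\<lambda>x. x \<in> D) \<and> measure \<nu> ((A - D) \<union> (D - A)) < \<delta>"
proof -
  interpret finite_measure \<nu> by (rule fin)
  have det: "D \<in> sets \<nu>" if "determined k (\<lambda>x. x \<in> D)" for k D using determined_sets[OF that] S by simp
  let ?G = "{{f \<in> \<Pi>\<^sub>E i\<in>UNIV. space borel. f i \<in> B} | (i :: nat) (B :: nat set). i \<in> UNIV \<and> B \<in> sets borel}"
  have gen: "sets (borel :: (nat \<Rightarrow> nat) measure) = sigma_sets (\<Pi>\<^sub>E i\<in>UNIV. space borel) ?G"
    unfolding sets_PiM_equal_borel[symmetric] by (rule sets_PiM_single)
  have "A \<in> sigma_sets (\<Pi>\<^sub>E i\<in>UNIV. space borel) ?G" using A gen by simp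
  then show ?thesis
  proof (induction A rule: sigma_sets.induct)
    case (Basic A)
    then obtain i B where "A = {f. f i \<in> B}" by auto
    then have "determined (Suc i) (\<lambda>x. x \<in> A)" by (auto simp: determined_def)
    then show ?case by (intro allI impI exI[of _ "Suc i"] exI[of _ A]) simp
  next
    case Empty
    have "determined 0 (\<lambda>x. x \<in> ({} :: (nat \<Rightarrow> nat) set))" by (simp add: determined_def)
    then show ?case by (intro allI impI exI[of _ 0] exI[of _ "{}"]) simp
  next
    case (Compl A)
    show ?case
    proof (intro allI impI)
      fix \<delta> :: real assume "0 < \<delta>"
      then obtain k D where D: "determined k (\<lambda>x. x \<in> D)" "measure \<nu> ((A - D) \<union> (D - A)) < \<delta>" using Compl by blast
      have "((\<Pi>\<^sub>E i\<in>UNIV. space borel) - A - (- D)) \<union> (- D - ((\<Pi>\<^sub>E i\<in>UNIV. space borel) - A)) = (A - D) \<union> (D - A)"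
        by auto
      moreover have "determined k (\<lambda>x. x \<in> - D)" using D(1) by (auto simp: determined_def)
      ultimately show "\<exists>k D. determined k (\<lambda>x. x \<in> D) \<and> measure \<nu> (((\<Pi>\<^sub>E i\<in>UNIV. space borel) - A - D) \<union> (D - ((\<Pi>\<^sub>E i\<in>UNIV. space borel) - A))) < \<delta>"
        using D(2) by metis
    qed
  next
    case (Union A)
    have As: "A i \<in> sets \<nu>" for i using Union(1)[of i] gen S by simp
    show ?case
    proof (intro allI impI)
      fix \<delta> :: real assume d: "0 < \<delta>"
      have "(\<lambda>n. measure \<nu> (\<Union>i<n. A i)) \<longlonglongrightarrow> measure \<nu> (\<Union>n. \<Union>i<n. A i)"
        using As by (intro finite_Lim_measure_incseq) (auto simp: incseq_def, fastforce)
      moreover have "(\<Union>n. \<Union>i<n. A i) = (\<Union>i. A i)" by auto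
      ultimately have "eventually (\<lambda>n. measure \<nu> (\<Union>i. A i) - \<delta> / 2 < measure \<nu> (\<Union>i<n. A i)) sequentially"
        using d by (intro order_tendstoD(1)) auto
      then obtain n where n: "measure \<nu> (\<Union>i. A i) - \<delta> / 2 < measure \<nu> (\<Union>i<n. A i)"
        by (auto simp: eventually_sequentially)
      have "\<forall>i. \<exists>k D. determined k (\<lambda>x. x \<in> D) \<and> measure \<nu> ((A i - D) \<union> (D - A i)) < \<delta> / (2 * real (Suc n))"
        using Union(2) d by simp
      then obtain k D where D: "\<And>i. determined (k i) (\<lambda>x. x \<in> D i)"
        "\<And>i. measure \<nu> ((A i - D i) \<union> (D i - A i)) < \<delta> / (2 * real (Suc n))" by metis
      let ?D = "\<Union>i<n. D i"
      have Ds: "D i \<in> sets \<nu>" for i using D(1) by (rule det)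
      have det': "determined (\<Sum>i<n. k i) (\<lambda>x. x \<in> ?D)"
      proof -
        have le: "k i \<le> (\<Sum>i<n. k i)" if "i < n" for i
          using that by (intro member_le_sum) auto
        have "determined (\<Sum>i<n. k i) (\<lambda>x. x \<in> D i)" if "i < n" for i
          using determined_mono[OF D(1) le[OF that]] .
        then have "x \<in> D i \<longleftrightarrow> y \<in> D i" if "i < n" "\<forall>j<(\<Sum>i<n. k i). x j = y j" for i x y
          using that unfolding determined_def by blast
        then show ?thesis unfolding determined_def by auto
      qed
      have "measure \<nu> (((\<Union>i. A i) - ?D) \<union> (?D - (\<Union>i. A i)))
          \<le> measure \<nu> (((\<Union>i. A i) - (\<Union>i<n. A i)) \<union> (\<Union>i<n. (A i - D i) \<union> (D i - A i)))"
        using As Ds by (intro finite_measure_mono) auto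
      also have "\<dots> \<le> measure \<nu> ((\<Union>i. A i) - (\<Union>i<n. A i)) + measure \<nu> (\<Union>i<n. (A i - D i) \<union> (D i - A i))"
        using As Ds by (intro measure_Un_le) auto
      also have "measure \<nu> ((\<Union>i. A i) - (\<Union>i<n. A i)) = measure \<nu> (\<Union>i. A i) - measure \<nu> (\<Union>i<n. A i)"
        using As by (intro finite_measure_Diff) auto
      also have "measure \<nu> (\<Union>i<n. (A i - D i) \<union> (D i - A i)) \<le> (\<Sum>i<n. measure \<nu> ((A i - D i) \<union> (D i - A i)))"
        using As Ds by (intro finite_measure_subadditive_finite) auto
      also have "\<dots> \<le> (\<Sum>i<n. \<delta> / (2 * real (Suc n)))"
        using D(2) by (intro sum_mono less_imp_le)
      also have "\<dots> \<le> \<delta> / 2" using d by (simp add: field_simps)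
      finally have "measure \<nu> (((\<Union>i. A i) - ?D) \<union> (?D - (\<Union>i. A i))) < \<delta>" using n by linarith
      with det' show "\<exists>k D. determined k (\<lambda>x. x \<in> D) \<and> measure \<nu> (((\<Union>i. A i) - D) \<union> (D - (\<Union>i. A i))) < \<delta>" by blast
    qed
  qed
qed

text \<open>
  Each level set is approximated; outside the union of the errors the approximating sets single out the
  value of \<open>f\<close>.
\<close>

lemma approx_by_determined_function:
  fixes f :: "(nat \<Rightarrow> nat) \<Rightarrow> nat"
  assumes \<mu>: "\<mu> \<in> inv_measures M" and f: "simple_function \<mu> f" and d: "0 < \<delta>"
  obtains k and f' :: "(nat \<Rightarrow> nat) \<Rightarrow> nat" where "determined k f'" "measure \<mu> {x \<in> Shift M. f x \<noteq> f' x} < \<delta>"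
    "{x \<in> Shift M. f x \<noteq> f' x} \<in> sets \<mu>"
proof -
  note I = inv_measuresD[OF \<mu>]
  interpret prob_space \<mu> by (rule I(1))
  define \<nu> where "\<nu> = distr \<mu> borel (\<lambda>x. x)"
  have idm: "(\<lambda>x. x) \<in> \<mu> \<rightarrow>\<^sub>M borel"
    unfolding measurable_cong_sets[OF I(2) refl] by (rule measurable_restrict_space1) simp
  have \<nu>: "finite_measure \<nu>" "sets \<nu> = sets borel"
    unfolding \<nu>_def using prob_space.finite_measure[OF prob_space_distr[OF idm]] by simp_all
  have m\<nu>: "measure \<nu> A = measure \<mu> (A \<inter> Shift M)" if "A \<in> sets borel" for A
    unfolding \<nu>_def using measure_distr[OF idm that] by (simp add: I(3))
  define R where "R = f ` Shift M"
  have R: "finite R" unfolding R_def using simple_functionD(1)[OF f] I(3) by simp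
  define r where "r = Suc (card R)"
  have "\<forall>c. \<exists>A. A \<in> sets borel \<and> f -` {c} \<inter> Shift M = A \<inter> Shift M"
  proof
    fix c
    have "f -` {c} \<inter> Shift M \<in> sets (borel_Shift M)"
      using simple_functionD(2)[OF f, of "{c}"] I by simp
    then show "\<exists>A. A \<in> sets borel \<and> f -` {c} \<inter> Shift M = A \<inter> Shift M"
      by (auto simp: sets_restrict_space)
  qed
  then obtain A where A: "\<And>c. A c \<in> sets borel" "\<And>c. f -` {c} \<inter> Shift M = A c \<inter> Shift M" by metis
  have "\<forall>c. \<exists>k D. determined k (\<lambda>x. x \<in> D) \<and> measure \<nu> ((A c - D) \<union> (D - A c)) < \<delta> / real r"
    using approx_by_determined_set[OF \<nu> A(1)] d by (simp add: r_def)
  then obtain k D where D: "\<And>c. determined (k c) (\<lambda>x. x \<in> D c)"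
    "\<And>c. measure \<nu> ((A c - D c) \<union> (D c - A c)) < \<delta> / real r" by metis
  define K where "K = (\<Sum>c\<in>R. k c)"
  define f' where "f' x = (LEAST c. c \<in> R \<and> x \<in> D c)" for x
  have DK: "determined K (\<lambda>x. x \<in> D c)" if "c \<in> R" for c
    using D(1) by (rule determined_mono) (use that R in \<open>auto simp: K_def intro!: member_le_sum\<close>)
  have det: "determined K f'"
    unfolding determined_def
  proof (intro allI impI)
    fix x y :: "nat \<Rightarrow> nat" assume xy: "\<forall>i<K. x i = y i"
    have "c \<in> R \<and> x \<in> D c \<longleftrightarrow> c \<in> R \<and> y \<in> D c" for c
      using DK[of c] xy unfolding determined_def by blast
    then show "f' x = f' y" by (simp add: f'_def)
  qed
  let ?E = "\<Union>c\<in>R. ((A c - D c) \<union> (D c - A c)) \<inter> Shift M"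
  have Db: "D c \<in> sets borel" for c using D(1) by (rule determined_sets)
  have Es: "((A c - D c) \<union> (D c - A c)) \<inter> Shift M \<in> sets \<mu>" for c
    using A(1)[of c] Db[of c] I(2) by (simp add: sets_restrict_space) blast
  have sub: "{x \<in> Shift M. f x \<noteq> f' x} \<subseteq> ?E"
  proof
    fix x assume x: "x \<in> {x \<in> Shift M. f x \<noteq> f' x}"
    show "x \<in> ?E"
    proof (rule ccontr)
      assume nE: "x \<notin> ?E"
      have "x \<in> D c \<longleftrightarrow> f x = c" if "c \<in> R" for c
      proof -
        have "x \<in> A c \<longleftrightarrow> f x = c" using A(2)[of c] x by blast
        then show ?thesis using nE that x by blast
      qed
      moreover have "f x \<in> R" using x by (simp add: R_def)
      ultimately have "f' x = f x"
        unfolding f'_def by (intro Least_equality) auto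
      then show False using x by simp
    qed
  qed
  have "{x \<in> Shift M. f x \<noteq> f' x} = (\<Union>c\<in>R. (f -` {c} \<inter> Shift M) \<inter> (f' -` (- {c}) \<inter> Shift M))"
    by (auto simp: R_def)
  moreover have "f' -` (- {c}) \<inter> Shift M \<in> sets \<mu>" for c
  proof -
    have "determined K (\<lambda>x. x \<in> f' -` (- {c}))" using det by (auto simp: determined_def)
    from determined_sets[OF this] show ?thesis using I(2) by (auto simp: sets_restrict_space)
  qed
  moreover have "f -` {c} \<inter> Shift M \<in> sets \<mu>" for c
    using simple_functionD(2)[OF f, of "{c}"] I by simp
  ultimately have meas: "{x \<in> Shift M. f x \<noteq> f' x} \<in> sets \<mu>"
    using R by (auto intro!: sets.finite_UN)
  have "measure \<mu> {x \<in> Shift M. f x \<noteq> f' x} \<le> measure \<mu> ?E"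
    by (rule finite_measure_mono[OF sub]) (intro sets.finite_UN R Es)
  also have "\<dots> \<le> (\<Sum>c\<in>R. measure \<mu> (((A c - D c) \<union> (D c - A c)) \<inter> Shift M))"
    using R Es by (intro finite_measure_subadditive_finite) auto
  also have "\<dots> = (\<Sum>c\<in>R. measure \<nu> ((A c - D c) \<union> (D c - A c)))"
    using A(1) Db by (intro sum.cong refl m\<nu>[symmetric]) auto
  also have "\<dots> \<le> (\<Sum>c\<in>R. \<delta> / real r)" using D(2) by (intro sum_mono less_imp_le)
  also have "\<dots> < \<delta>" using d by (simp add: r_def field_simps)
  finally show ?thesis using that det meas by blast
qed

section \<open>The length of the loop code\<close>

lemma integral_shift:
  fixes h :: "(nat \<Rightarrow> nat) \<Rightarrow> real"
  assumes \<mu>: "\<mu> \<in> inv_measures M" and h: "integrable \<mu> h"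
  shows "integrable \<mu> (birkhoff_sum n h)" "(\<integral>x. birkhoff_sum n h x \<partial>\<mu>) = real n * (\<integral>x. h x \<partial>\<mu>)"
proof -
  have 1: "integrable \<mu> (\<lambda>x. h ((shift ^^ i) x))" for i
    using h by (subst integrable_distr_eq[symmetric, OF inv_measures_shift(1)[OF \<mu>]])
      (simp_all add: inv_measures_shift(2)[OF \<mu>])
  have 2: "(\<integral>x. h ((shift ^^ i) x) \<partial>\<mu>) = (\<integral>x. h x \<partial>\<mu>)" for i
    using integral_distr[OF inv_measures_shift(1)[OF \<mu>, of i], of h] h
    by (simp add: inv_measures_shift(2)[OF \<mu>])
  show "integrable \<mu> (birkhoff_sum n h)"
    unfolding birkhoff_sum_def[abs_def] by (intro Bochner_Integration.integrable_sum 1)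
  show "(\<integral>x. birkhoff_sum n h x \<partial>\<mu>) = real n * (\<integral>x. h x \<partial>\<mu>)"
    unfolding birkhoff_sum_def using 1 2 by (simp add: Bochner_Integration.integral_sum)
qed

context loop_coding
begin

text \<open>
  The part of \<open>\<bar>\<phi>\<bar>\<close> above the level \<open>L\<close>; its integral is small for large \<open>L\<close> if \<open>\<phi>\<close> is integrable.
\<close>

definition excess :: "real \<Rightarrow> (nat \<Rightarrow> nat) \<Rightarrow> real" where
  "excess L y = max 0 (\<bar>\<phi> y\<bar> - L)"

definition noise_cost :: "((nat \<Rightarrow> nat) \<Rightarrow> nat) \<Rightarrow> (nat \<Rightarrow> nat) \<Rightarrow> real" where
  "noise_cost f y = (if f y = f' y then - ln (1 - e) else - ln (e / real (card R)))"

text \<open>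
  The cost per time step on top of \<open>p - \<phi>\<close>. It consists of the unbounded part of \<open>\<phi>\<close>, of a charge for
  each time spent above the symbol \<open>m\<close>, and of the cost of the prediction. Each of the three has a small
  integral if \<open>L\<close>, \<open>m\<close>, the noise \<open>e\<close> and \<open>f'\<close> are chosen well.
\<close>

definition letter_cost :: "((nat \<Rightarrow> nat) \<Rightarrow> nat) \<Rightarrow> real \<Rightarrow> nat \<Rightarrow> (nat \<Rightarrow> nat) \<Rightarrow> real" where
  "letter_cost f L m y = excess L y + (\<bar>p\<bar> + L + ln (real (card R))) * of_bool (m < y 0) + noise_cost f y"

lemma card_R: "1 \<le> real (card R)"
  using R by (simp add: Suc_le_eq card_gt_0_iff)

lemma noise_cost_nonneg: "0 \<le> noise_cost f y"
proof -
  have "e / real (card R) \<le> 1" using e card_R by (simp add: field_simps)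
  moreover have "0 < e / real (card R)" using e card_R by simp
  ultimately show ?thesis using e by (auto simp: noise_cost_def)
qed

lemma noisy_ge: "exp (- noise_cost f y) \<le> noisy e (card R) (f y) (f' y)"
proof -
  have "0 < e / real (card R)" using e card_R by simp
  then show ?thesis using e by (auto simp: noise_cost_def noisy_def)
qed

text \<open>
  An orbit segment that stays above \<open>m\<close> uses the uniform code; its length is charged to the time spent
  above \<open>m\<close>.
\<close>

lemma code_ge_never:
  assumes x: "x \<in> Shift M" and never: "\<And>i. i < n \<Longrightarrow> m < x i" and L: "0 \<le> L" and D: "0 \<le> D"
  shows "exp (- (ln (1 + (real n)\<^sup>2) + D - birkhoff_sum n \<phi> x + real n * p + birkhoff_sum n (letter_cost f L m) x))
    \<le> code (itinerary f n x)"
proof -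
  have "birkhoff_sum n \<phi> x - real n * p - birkhoff_sum n (letter_cost f L m) x
      = (\<Sum>i<n. \<phi> ((shift ^^ i) x) - p - letter_cost f L m ((shift ^^ i) x))"
    by (simp add: birkhoff_sum_def sum_subtractf)
  also have "\<dots> \<le> (\<Sum>i<n. - ln (real (card R)))"
  proof (rule sum_mono)
    fix i assume "i \<in> {..<n}"
    then have "m < (shift ^^ i) x 0" using never by (simp add: shift_pow_apply)
    then show "\<phi> ((shift ^^ i) x) - p - letter_cost f L m ((shift ^^ i) x) \<le> - ln (real (card R))"
      using noise_cost_nonneg[of f "(shift ^^ i) x"]
      by (simp add: letter_cost_def excess_def)
  qed
  finally have "exp (- (ln (1 + (real n)\<^sup>2) + D - birkhoff_sum n \<phi> x + real n * p + birkhoff_sum n (letter_cost f L m) x))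
      \<le> exp (- (real n * ln (real (card R))) - ln (1 + (real n)\<^sup>2))" using D by simp
  also have "\<dots> = (1 / real (card R)) ^ n / (1 + (real n)\<^sup>2)"
  proof -
    have "0 < 1 + (real n)\<^sup>2" by (simp add: add_pos_nonneg)
    then show ?thesis using card_R
      by (simp add: exp_diff exp_minus exp_of_nat_mult power_one_over inverse_eq_divide)
  qed
  also have "\<dots> \<le> code (itinerary f n x)" by (rule code_ge_uniform)
  finally show ?thesis .
qed

text \<open>
  The window extends from the first to the last visit to \<open>{..m}\<close>. At every place outside of it the orbit is
  above \<open>m\<close>, and this is charged: \<open>\<phi>\<close> is at most \<open>L\<close> plus its excess there, the window is shorter than
  \<open>n\<close>, and the symbol is coded uniformly. Inside the window at most \<open>k\<close> final places are coded uniformly.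
\<close>

lemma code_ge_visit:
  assumes x: "x \<in> Shift M" and s: "s \<le> t" and t: "t < n"
    and before: "\<And>i. i < s \<Longrightarrow> m < x i" and after: "\<And>i. t < i \<Longrightarrow> i < n \<Longrightarrow> m < x i"
    and z: "z \<in> Per M a (t - s + 2 * J)" "\<forall>i\<le>t - s. z (J + i) = x (s + i)"
      "birkhoff_sum (t - s) \<phi> ((shift ^^ s) x) - D \<le> birkhoff_sum (t - s + 2 * J) \<phi> z"
    and L: "0 \<le> L" and D: "0 \<le> D" and f: "f \<in> Shift M \<rightarrow> R" and det: "determined k f'"
  shows "exp (- (ln (1 + (real n)\<^sup>2) + (D + \<bar>C\<bar> + L + \<bar>p\<bar> * (1 + 2 * real J) + real k * ln (real (card R)))
      - birkhoff_sum n \<phi> x + real n * p + birkhoff_sum n (letter_cost f L m) x))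
    \<le> code (itinerary f n x)"
proof -
  let ?r = "ln (real (card R))"
  have r0: "0 \<le> ?r" using card_R by simp
  \<comment> \<open>The number of times spent above \<open>m\<close>.\<close>
  define N where "N = (\<Sum>i<n. of_bool (m < x i) :: real)"
  have Ncard: "real (card S) \<le> N" if "S \<subseteq> {i. i < n \<and> m < x i}" for S
  proof -
    have "card S \<le> card {i. i < n \<and> m < x i}" using that by (intro card_mono) auto
    moreover have "N = real (card {i. i < n \<and> m < x i})"
      unfolding N_def by (subst sum_of_bool_eq) (auto intro!: arg_cong[of _ _ card])
    ultimately show ?thesis by simp
  qed
  have outN: "real (s + (n - Suc t)) \<le> N"
  proof -
    have "card ({..<s} \<union> {t<..<n}) = s + (n - Suc t)"
      using s by (subst card_Un_disjoint) auto
    moreover have "real (card ({..<s} \<union> {t<..<n})) \<le> N"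
      using before after s t by (intro Ncard) auto
    ultimately show ?thesis by simp
  qed
  \<comment> \<open>The time \<open>t\<close> belongs to this set although \<open>x t \<le> m\<close>: the Birkhoff sum of the window ends before it.\<close>
  define Out where "Out = {..<s} \<union> {t..<n}"
  have cO: "real (card Out) \<le> N + 1"
  proof -
    have "card Out = s + (n - t)" unfolding Out_def using s by (subst card_Un_disjoint) auto
    then show ?thesis using outN t by (simp add: of_nat_diff)
  qed
  have split: "birkhoff_sum n \<phi> x = birkhoff_sum (t - s) \<phi> ((shift ^^ s) x) + (\<Sum>i\<in>Out. \<phi> ((shift ^^ i) x))"
  proof -
    have "birkhoff_sum (t - s) \<phi> ((shift ^^ s) x) = (\<Sum>i<t - s. \<phi> ((shift ^^ (i + s)) x))"
      by (simp add: birkhoff_sum_def funpow_add)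
    also have "\<dots> = (\<Sum>i\<in>{s..<t}. \<phi> ((shift ^^ i) x))"
      using s by (intro sum.reindex_bij_witness[of _ "\<lambda>i. i - s" "\<lambda>i. i + s"]) auto
    finally have e: "birkhoff_sum (t - s) \<phi> ((shift ^^ s) x) = (\<Sum>i\<in>{s..<t}. \<phi> ((shift ^^ i) x))" .
    have "{..<n} = {s..<t} \<union> Out" "{s..<t} \<inter> Out = {}" using s t by (auto simp: Out_def)
    then have "birkhoff_sum n \<phi> x = (\<Sum>i\<in>{s..<t}. \<phi> ((shift ^^ i) x)) + (\<Sum>i\<in>Out. \<phi> ((shift ^^ i) x))"
      by (simp add: birkhoff_sum_def sum.union_disjoint Out_def)
    then show ?thesis by (simp only: e)
  qed
  have "(\<Sum>i\<in>Out. \<phi> ((shift ^^ i) x)) \<le> (\<Sum>i\<in>Out. L + excess L ((shift ^^ i) x))"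
    by (intro sum_mono) (auto simp: excess_def)
  also have "\<dots> \<le> L * (N + 1) + (\<Sum>i\<in>Out. excess L ((shift ^^ i) x))"
    using mult_left_mono[OF cO L] by (simp add: sum.distrib mult.commute)
  also have "(\<Sum>i\<in>Out. excess L ((shift ^^ i) x)) \<le> birkhoff_sum n (excess L) x"
    unfolding birkhoff_sum_def using s t by (intro sum_mono2) (auto simp: Out_def excess_def)
  finally have phi: "birkhoff_sum n \<phi> x - L * (N + 1) - birkhoff_sum n (excess L) x \<le> birkhoff_sum (t - s) \<phi> ((shift ^^ s) x)"
    unfolding split by simp
  have lp: "real (t - s + 2 * J) * p \<le> real n * p + \<bar>p\<bar> * (N + 1 + 2 * real J)"
  proof -
    have "real n - real (t - s) \<le> N + 1" using outN s t by (simp add: of_nat_diff)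
    then have "(real n - real (t - s)) * \<bar>p\<bar> \<le> (N + 1) * \<bar>p\<bar>" by (intro mult_right_mono) auto
    moreover have "- ((real n - real (t - s)) * p) \<le> (real n - real (t - s)) * \<bar>p\<bar>"
    proof -
      have "(real n - real (t - s)) * - p \<le> (real n - real (t - s)) * \<bar>p\<bar>"
        using s t by (intro mult_left_mono) auto
      then show ?thesis by simp
    qed
    moreover have "2 * real J * p \<le> 2 * real J * \<bar>p\<bar>" by (intro mult_left_mono) auto
    ultimately show ?thesis by (simp add: algebra_simps)
  qed
  have W: "exp (- birkhoff_sum n (noise_cost f) x - ?r * (N + real k)) \<le> (\<Prod>i<n. symbol_weight s t z i (itinerary f n x ! i))"
  proof -
    define I where "I = {i. i < n \<and> \<not> (s \<le> i \<and> i + k \<le> t + 1)}"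
    have cI: "real (card I) \<le> N + real k"
    proof -
      have "card I \<le> card (({..<s} \<union> {t<..<n}) \<union> {t + 2 - k..t})"
        by (intro card_mono) (auto simp: I_def)
      also have "\<dots> \<le> card ({..<s} \<union> {t<..<n}) + card {t + 2 - k..t}" by (rule card_Un_le)
      also have "card ({..<s} \<union> {t<..<n}) = s + (n - Suc t)"
        using s by (subst card_Un_disjoint) auto
      also have "card {t + 2 - k..t} \<le> k" by simp
      finally show ?thesis using outN by linarith
    qed
    have "- birkhoff_sum n (noise_cost f) x - ?r * (N + real k)
        \<le> - birkhoff_sum n (noise_cost f) x - ?r * real (card I)"
      using mult_left_mono[OF cI r0] by simp
    also have "\<dots> = (\<Sum>i<n. - noise_cost f ((shift ^^ i) x) - ?r * of_bool (i \<in> I))"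
    proof -
      have "(\<Sum>i<n. of_bool (i \<in> I)) = (real (card I))"
        by (subst sum_of_bool_eq) (auto simp: I_def intro!: arg_cong[of _ _ card])
      then show ?thesis by (simp add: birkhoff_sum_def sum_subtractf sum_negf sum_distrib_left[symmetric])
    qed
    finally have "exp (- birkhoff_sum n (noise_cost f) x - ?r * (N + real k))
        \<le> (\<Prod>i<n. exp (- noise_cost f ((shift ^^ i) x) - ?r * of_bool (i \<in> I)))"
      by (simp add: exp_sum[symmetric])
    also have "\<dots> \<le> (\<Prod>i<n. symbol_weight s t z i (itinerary f n x ! i))"
    proof (rule prod_mono)
      fix i assume i: "i \<in> {..<n}"
      have itn: "itinerary f n x ! i = f ((shift ^^ i) x)" using i by (simp add: itinerary_nth)
      show "0 \<le> exp (- noise_cost f ((shift ^^ i) x) - ?r * of_bool (i \<in> I)) \<and>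
        exp (- noise_cost f ((shift ^^ i) x) - ?r * of_bool (i \<in> I)) \<le> symbol_weight s t z i (itinerary f n x ! i)"
      proof (cases "i \<in> I")
        case True
        have "exp (- noise_cost f ((shift ^^ i) x) - ?r) \<le> exp (- ?r)"
          using noise_cost_nonneg[of f "(shift ^^ i) x"] by simp
        also have "\<dots> = 1 / real (card R)" using card_R by (simp add: exp_minus inverse_eq_divide)
        finally have "exp (- noise_cost f ((shift ^^ i) x) - ?r * of_bool (i \<in> I)) \<le> 1 / real (card R)"
          using True by simp
        moreover have "\<not> (s \<le> i \<and> i + k \<le> t + 1)" using True unfolding I_def by blast
        then have "symbol_weight s t z i c = 1 / real (card R)" for c
          unfolding symbol_weight_def by (rule if_not_P)
        ultimately show ?thesis by simp
      next
        case False
        then have in_win: "s \<le> i" "i + k \<le> t + 1" using i by (auto simp: I_def)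
        have "(shift ^^ (J + (i - s))) z j = (shift ^^ i) x j" if "j < k" for j
        proof -
          have le: "i - s + j \<le> t - s" using in_win that by linarith
          have "z (J + (i - s + j)) = x (s + (i - s + j))" by (rule z(2)[rule_format, OF le])
          moreover have "j + (J + (i - s)) = J + (i - s + j)" "s + (i - s + j) = j + i" using in_win by auto
          ultimately show ?thesis by (simp only: shift_pow_apply)
        qed
        then have "f' ((shift ^^ (J + (i - s))) z) = f' ((shift ^^ i) x)"
          using det unfolding determined_def by blast
        then show ?thesis using False in_win noisy_ge[of f "(shift ^^ i) x"] by (simp add: symbol_weight_def itn)
      qed
    qed
    finally show ?thesis .
  qed
  let ?l = "t - s + 2 * J"
  have fw: "itinerary f n x \<in> words"
    using f shift_pow_in_Shift[OF x] by (auto simp: itinerary_def)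
  have lc: "birkhoff_sum n (letter_cost f L m) x = birkhoff_sum n (excess L) x + (\<bar>p\<bar> + L + ?r) * N + birkhoff_sum n (noise_cost f) x"
    by (simp add: birkhoff_sum_def letter_cost_def sum.distrib sum_distrib_left N_def shift_pow_apply)
  have "exp (- (ln (1 + (real n)\<^sup>2) + (D + \<bar>C\<bar> + L + \<bar>p\<bar> * (1 + 2 * real J) + real k * ?r)
      - birkhoff_sum n \<phi> x + real n * p + birkhoff_sum n (letter_cost f L m) x))
    \<le> exp ((birkhoff_sum ?l \<phi> z - C - real ?l * p) + (- birkhoff_sum n (noise_cost f) x - ?r * (N + real k)) - ln (1 + (real n)\<^sup>2))"
    using z(3) phi lp abs_ge_self[of C] by (simp add: lc algebra_simps)
  also have "\<dots> = loop_weight ?l z * exp (- birkhoff_sum n (noise_cost f) x - ?r * (N + real k)) / (1 + (real n)\<^sup>2)"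
  proof -
    have "0 < 1 + (real n)\<^sup>2" by (simp add: add_pos_nonneg)
    then show ?thesis by (simp only: exp_diff[of "_ + _"] exp_add exp_ln loop_weight_def)
  qed
  also have "\<dots> \<le> loop_weight ?l z * (\<Prod>i<n. symbol_weight s t z i (itinerary f n x ! i)) / (1 + (real n)\<^sup>2)"
    using W by (intro divide_right_mono mult_left_mono) (auto simp: loop_weight_def)
  also have "\<dots> \<le> code (itinerary f n x)"
    using fw s t z(1) by (intro code_ge_window) auto
  finally show ?thesis .
qed

end

section \<open>Pressure as a lower bound for the growth of periodic sums\<close>

lemma log_square_over_n: "(\<lambda>n. (ln (1 + (real n)\<^sup>2) + D) / real n) \<longlonglongrightarrow> 0"
proof (rule tendsto_sandwich)
  show "eventually (\<lambda>n. D / real n \<le> (ln (1 + (real n)\<^sup>2) + D) / real n) sequentially"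
    by (rule always_eventually) (auto intro!: divide_right_mono)
  show "eventually (\<lambda>n. (ln (1 + (real n)\<^sup>2) + D) / real n \<le> (ln 2 + D) / real n + 2 * (ln (real n) / real n)) sequentially"
    using eventually_gt_at_top[of 0]
  proof eventually_elim
    case (elim n)
    have "1 + (real n)\<^sup>2 \<le> 2 * (real n)\<^sup>2" using elim by (simp add: Suc_le_eq)
    then have "ln (1 + (real n)\<^sup>2) \<le> ln (2 * (real n)\<^sup>2)" using elim by (subst ln_le_cancel_iff) (auto simp: add_pos_nonneg)
    also have "\<dots> = ln 2 + 2 * ln (real n)" using elim by (simp add: ln_mult ln_realpow)
    finally have "(ln (1 + (real n)\<^sup>2) + D) / real n \<le> (ln 2 + 2 * ln (real n) + D) / real n"
      by (intro divide_right_mono) auto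
    then show ?case by (simp add: add_divide_distrib)
  qed
  show "(\<lambda>n. D / real n) \<longlonglongrightarrow> 0" by (rule lim_const_over_n)
  have "(\<lambda>n. (ln 2 + D) / real n + 2 * (ln (real n) / real n)) \<longlonglongrightarrow> 0 + 2 * 0"
    by (intro tendsto_add tendsto_mult tendsto_const lim_const_over_n lim_ln_over_n)
  then show "(\<lambda>n. (ln 2 + D) / real n + 2 * (ln (real n) / real n)) \<longlonglongrightarrow> 0" by simp
qed

text \<open>
  The mean code length divided by \<open>n\<close>. By invariance each of the \<open>n\<close> places contributes the same
  integral of \<open>letter_cost\<close>, and the remaining cost is \<open>o(n)\<close>.
\<close>

lemma partition_entropy_le_letter_cost:
  assumes mix: "topologically_mixing M" and V: "bounded_distortion M \<phi> V"
    and Z: "\<And>l. 0 < l \<Longrightarrow> Zper M \<phi> a l \<le> ennreal (exp (C + real l * p))"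
    and \<mu>: "\<mu> \<in> inv_measures M" and \<phi>: "integrable \<mu> \<phi>" and f: "simple_function \<mu> f"
    and det: "determined k f'" and fm: "{x \<in> Shift M. f x \<noteq> f' x} \<in> sets \<mu>"
    and e: "0 < e" "e < 1" and L: "0 \<le> L"
  defines "r \<equiv> real (card (f ` Shift M))"
  shows "partition_entropy \<mu> f \<le> p - (\<integral>x. \<phi> x \<partial>\<mu>) + (\<integral>x. max 0 (\<bar>\<phi> x\<bar> - L) \<partial>\<mu>)
    + (\<bar>p\<bar> + L + ln r) * measure \<mu> {x \<in> Shift M. m < x 0} - ln (1 - e)
    + measure \<mu> {x \<in> Shift M. f x \<noteq> f' x} * - ln (e / r)"
proof -
  note I = inv_measuresD[OF \<mu>]
  interpret prob_space \<mu> by (rule I(1))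
  define R where "R = f ` Shift M"
  have R: "finite R" "R \<noteq> {}"
    using simple_functionD(1)[OF f] not_empty I(3) by (auto simp: R_def)
  obtain J D where J: "0 < J" "0 \<le> D" and close:
    "\<forall>x\<in>Shift M. \<forall>s t. s \<le> t \<longrightarrow> x s \<le> m \<longrightarrow> x t \<le> m \<longrightarrow>
      (\<exists>z\<in>Per M a (t - s + 2 * J). (\<forall>i\<le>t - s. z (J + i) = x (s + i)) \<and>
        birkhoff_sum (t - s) \<phi> ((shift ^^ s) x) - D \<le> birkhoff_sum (t - s + 2 * J) \<phi> z)"
    using closing_lemma[OF mix V, of m a] by blast
  have coding: "loop_coding M a \<phi> C p R J e"
    by unfold_locales (use Z J R e in auto)
  define G where "G = loop_coding.letter_cost \<phi> p R f' e f L m"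
  have G: "G y = max 0 (\<bar>\<phi> y\<bar> - L) + (\<bar>p\<bar> + L + ln r) * of_bool (m < y 0)
      + (if f y = f' y then - ln (1 - e) else - ln (e / r))" for y
    unfolding G_def loop_coding.letter_cost_def[OF coding] loop_coding.excess_def[OF coding]
      loop_coding.noise_cost_def[OF coding] by (simp add: R_def r_def)
  have r: "1 \<le> r" using loop_coding.card_R[OF coding] by (simp add: r_def R_def)
  define D' where "D' = D + \<bar>C\<bar> + L + \<bar>p\<bar> * (1 + 2 * real J) + real k * ln (real (card R))"
  have D': "0 \<le> D'" using J L r by (simp add: D'_def r_def R_def)
  have code: "exp (- (ln (1 + (real n)\<^sup>2) + D' - birkhoff_sum n \<phi> x + real n * p + birkhoff_sum n G x))
      \<le> loop_coding.code M a \<phi> C p R f' k J e n (itinerary f n x)" if x: "x \<in> Shift M" for n x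
  proof (cases "\<exists>i<n. x i \<le> m")
    case False
    then have "m < x i" if "i < n" for i using that by (meson not_le)
    then show ?thesis unfolding G_def
      by (rule loop_coding.code_ge_never[OF coding x _ L D'])
  next
    case True
    let ?T = "{i. i < n \<and> x i \<le> m}"
    have T: "finite ?T" "?T \<noteq> {}" using True by auto
    define s where "s = Min ?T"
    define t where "t = Max ?T"
    have sT: "s \<in> ?T" and tT: "t \<in> ?T" unfolding s_def t_def using T by (auto intro: Min_in Max_in simp del: mem_Collect_eq)
    have st: "s \<le> t" unfolding t_def using T(1) sT by (rule Max_ge)
    have before: "m < x i" if "i < s" for i
    proof (rule ccontr)
      assume "\<not> m < x i"
      then have "i \<in> ?T" using that sT by auto
      then have "s \<le> i" unfolding s_def using T(1) by (intro Min_le)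
      then show False using that by simp
    qed
    have after: "m < x i" if "t < i" "i < n" for i
    proof (rule ccontr)
      assume "\<not> m < x i"
      then have "i \<in> ?T" using that by auto
      then have "i \<le> t" unfolding t_def using T(1) by (intro Max_ge)
      then show False using that by simp
    qed
    obtain z where z: "z \<in> Per M a (t - s + 2 * J)" "\<forall>i\<le>t - s. z (J + i) = x (s + i)"
        "birkhoff_sum (t - s) \<phi> ((shift ^^ s) x) - D \<le> birkhoff_sum (t - s + 2 * J) \<phi> z"
      using close[rule_format, OF x st] sT tT by auto
    have tn: "t < n" using tT by simp
    have fR: "f \<in> Shift M \<rightarrow> R" by (auto simp: R_def)
    show ?thesis
      unfolding G_def D'_def
      by (rule loop_coding.code_ge_visit[OF coding x st tn before after z L J(2) fR det])
  qed
  have Gi: "integrable \<mu> G" "(\<integral>x. G x \<partial>\<mu>) = (\<integral>x. max 0 (\<bar>\<phi> x\<bar> - L) \<partial>\<mu>)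
      + (\<bar>p\<bar> + L + ln r) * measure \<mu> {x \<in> Shift M. m < x 0}
      + (- ln (1 - e) * measure \<mu> {x \<in> Shift M. f x = f' x} + - ln (e / r) * measure \<mu> {x \<in> Shift M. f x \<noteq> f' x})"
  proof -
    let ?A = "{x \<in> Shift M. m < x 0}" and ?B = "{x \<in> Shift M. f x = f' x}" and ?N = "{x \<in> Shift M. f x \<noteq> f' x}"
    have A: "?A \<in> sets \<mu>"
      using large_symbol_sets I(2) by simp
    have B: "?B \<in> sets \<mu>"
    proof -
      have "?B = space \<mu> - ?N" using I(3) by auto
      then show ?thesis using fm by auto
    qed
    have i1: "integrable \<mu> (\<lambda>x. max 0 (\<bar>\<phi> x\<bar> - L))"
      using \<phi> by (intro integrable_max) auto
    let ?g = "\<lambda>y. max 0 (\<bar>\<phi> y\<bar> - L) + (\<bar>p\<bar> + L + ln r) * indicator ?A y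
      + (- ln (1 - e) * indicator ?B y + - ln (e / r) * indicator ?N y)"
    have eq: "G y = ?g y" if "y \<in> space \<mu>" for y
      using that I(3) by (simp add: G indicator_def)
    have ig: "integrable \<mu> ?g"
      using A B fm by (intro Bochner_Integration.integrable_add integrable_mult_right i1 integrable_real_indicator)
        (auto simp: emeasure_eq_measure)
    then show "integrable \<mu> G" by (subst Bochner_Integration.integrable_cong[OF refl eq])
    have "(\<integral>x. G x \<partial>\<mu>) = (\<integral>x. ?g x \<partial>\<mu>)" by (rule Bochner_Integration.integral_cong[OF refl eq])
    also have "\<dots> = (\<integral>x. max 0 (\<bar>\<phi> x\<bar> - L) \<partial>\<mu>) + (\<bar>p\<bar> + L + ln r) * measure \<mu> ?A
      + (- ln (1 - e) * measure \<mu> ?B + - ln (e / r) * measure \<mu> ?N)"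
    proof -
      have ii: "integrable \<mu> (indicator S :: _ \<Rightarrow> real)" if "S \<in> sets \<mu>" for S
        using that by (intro integrable_real_indicator) (auto simp: emeasure_eq_measure)
      have im: "(\<integral>x. c * indicator S x \<partial>\<mu>) = c * measure \<mu> S" if "S \<in> sets \<mu>" for S and c :: real
        using that sets.sets_into_space[OF that] by (simp add: Int_absorb2)
      show ?thesis
        by (subst Bochner_Integration.integral_add, (intro Bochner_Integration.integrable_add integrable_mult_right i1 ii A B fm)+)+
          (simp only: im A B fm)
    qed
    finally show "(\<integral>x. G x \<partial>\<mu>) = (\<integral>x. max 0 (\<bar>\<phi> x\<bar> - L) \<partial>\<mu>) + (\<bar>p\<bar> + L + ln r) * measure \<mu> ?A
      + (- ln (1 - e) * measure \<mu> ?B + - ln (e / r) * measure \<mu> ?N)" .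
  qed
  have H: "shannon \<mu> (itinerary f n) \<le> ln (1 + (real n)\<^sup>2) + D' + real n * (p - (\<integral>x. \<phi> x \<partial>\<mu>) + (\<integral>x. G x \<partial>\<mu>))" for n
  proof -
    let ?c = "\<lambda>x. ln (1 + (real n)\<^sup>2) + D' - birkhoff_sum n \<phi> x + real n * p + birkhoff_sum n G x"
    let ?code = "loop_coding.code M a \<phi> C p R f' k J e n"
    note s\<phi> = integral_shift[OF \<mu> \<phi>] and sG = integral_shift[OF \<mu> Gi(1)]
    have "shannon \<mu> (itinerary f n) \<le> (\<integral>x. ?c x \<partial>\<mu>)"
    proof (rule shannon_le_cost[OF I(1) simple_function_itinerary[OF \<mu> f], where Q = ?code])
      show "0 \<le> ?code u" for u by (rule loop_coding.code_nonneg[OF coding])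
      have "(\<Sum>u\<in>itinerary f n ` space \<mu>. ?code u) \<le> (\<Sum>u | length u = n \<and> set u \<subseteq> R. ?code u)"
        using I(3) by (intro sum_mono2 loop_coding.finite_words[OF coding] loop_coding.code_nonneg[OF coding])
          (auto simp: itinerary_def R_def intro!: imageI shift_pow_in_Shift)
      also have "\<dots> \<le> 1" by (rule loop_coding.code_sum[OF coding])
      finally show "(\<Sum>u\<in>itinerary f n ` space \<mu>. ?code u) \<le> 1" .
      show "integrable \<mu> ?c" using s\<phi>(1) sG(1) by simp
      show "AE x in \<mu>. exp (- ?c x) \<le> ?code (itinerary f n x)"
        using code I(3) by (intro AE_I2) simp
    qed
    also have "\<dots> = ln (1 + (real n)\<^sup>2) + D' + real n * (p - (\<integral>x. \<phi> x \<partial>\<mu>) + (\<integral>x. G x \<partial>\<mu>))"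
      using s\<phi> sG by (simp add: prob_space algebra_simps)
    finally show ?thesis .
  qed
  let ?b = "p - (\<integral>x. \<phi> x \<partial>\<mu>) + (\<integral>x. G x \<partial>\<mu>)"
  have "(\<lambda>n. (ln (1 + (real n)\<^sup>2) + D') / real n + ?b) \<longlonglongrightarrow> 0 + ?b"
    by (intro tendsto_add log_square_over_n tendsto_const)
  then have "partition_entropy \<mu> f \<le> 0 + ?b"
  proof (rule LIMSEQ_le[OF partition_entropy_limit(1)[OF \<mu> f]], intro exI allI impI)
    fix n :: nat assume n: "1 \<le> n"
    have "shannon \<mu> (itinerary f n) / real n \<le> (ln (1 + (real n)\<^sup>2) + D' + real n * ?b) / real n"
      by (intro divide_right_mono H) simp
    also have "\<dots> = (ln (1 + (real n)\<^sup>2) + D') / real n + ?b" using n by (simp add: add_divide_distrib)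
    finally show "shannon \<mu> (itinerary f n) / real n \<le> (ln (1 + (real n)\<^sup>2) + D') / real n + ?b" .
  qed
  moreover have "- ln (1 - e) * measure \<mu> {x \<in> Shift M. f x = f' x} \<le> - ln (1 - e)"
    using e by (intro mult_left_le) auto
  ultimately show ?thesis by (simp add: Gi(2) mult.commute)
qed

text \<open>
  The error terms of the code are made smaller than any \<open>\<delta>\<close>. The order of the choices matters: first the
  noise \<open>e\<close>, then \<open>f'\<close>, whose error is weighted with \<open>- ln (e / r)\<close>, then the level \<open>L\<close>, and at last
  \<open>m\<close>, whose charge involves \<open>L\<close>. A potential whose positive part is not integrable would make the
  pressure infinite.
\<close>

lemma pressure_le_growth_bound:
  assumes mix: "topologically_mixing M" and V: "bounded_distortion M \<phi> V"
    and m\<phi>: "\<phi> \<in> borel_measurable (borel_Shift M)" and P: "pressure M \<phi> < \<infinity>"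
    and Z: "\<And>l. 0 < l \<Longrightarrow> Zper M \<phi> a l \<le> ennreal (exp (C + real l * p))"
  shows "pressure M \<phi> \<le> ereal p"
  unfolding pressure_def
proof (rule SUP_least)
  fix \<mu> assume "\<mu> \<in> {\<mu> \<in> inv_measures M. (\<integral>\<^sup>+x. ennreal (- \<phi> x) \<partial>\<mu>) < \<infinity>}"
  then have \<mu>: "\<mu> \<in> inv_measures M" and neg: "(\<integral>\<^sup>+x. ennreal (- \<phi> x) \<partial>\<mu>) < \<infinity>" by auto
  note I = inv_measuresD[OF \<mu>]
  interpret prob_space \<mu> by (rule I(1))
  have le: "ks_entropy \<mu> + ext_integral \<mu> \<phi> \<le> pressure M \<phi>"
    unfolding pressure_def using \<mu> neg by (intro SUP_upper) auto
  have \<phi>: "integrable \<mu> \<phi>"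
  proof -
    have "(\<integral>\<^sup>+x. ennreal (\<phi> x) \<partial>\<mu>) \<noteq> \<infinity>"
    proof
      assume inf: "(\<integral>\<^sup>+x. ennreal (\<phi> x) \<partial>\<mu>) = \<infinity>"
      have "enn2ereal (\<integral>\<^sup>+x. ennreal (- \<phi> x) \<partial>\<mu>) = ereal (enn2real (\<integral>\<^sup>+x. ennreal (- \<phi> x) \<partial>\<mu>))"
        using neg by (metis enn2ereal_ennreal enn2real_nonneg ennreal_enn2real infinity_ennreal_def)
      then have "ext_integral \<mu> \<phi> = \<infinity>"
        unfolding ext_integral_def inf by simp
      then have "ks_entropy \<mu> + ext_integral \<mu> \<phi> = \<infinity>"
        using ks_entropy_nonneg[OF \<mu>] by simp
      then show False using le P by auto
    qed
    moreover have "\<phi> \<in> borel_measurable \<mu>"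
      using m\<phi> by (simp add: measurable_cong_sets[OF I(2) refl])
    ultimately show ?thesis using neg unfolding real_integrable_def by auto
  qed
  let ?I = "\<integral>x. \<phi> x \<partial>\<mu>"
  have "partition_entropy \<mu> f \<le> p - ?I" if f: "simple_function \<mu> f" for f
  proof (rule field_le_epsilon)
    fix \<delta> :: real assume "0 < \<delta>"
    then have d: "0 < \<delta> / 4" by simp
    define r where "r = real (card (f ` Shift M))"
    have r: "1 \<le> r"
    proof -
      have "finite (f ` Shift M)" "f ` Shift M \<noteq> {}"
        using simple_functionD(1)[OF f] not_empty I(3) by auto
      then show ?thesis by (simp add: r_def Suc_le_eq card_gt_0_iff)
    qed
    \<comment> \<open>Chosen so that a correct prediction costs exactly \<open>\<delta> / 4\<close>.\<close>
    define e where "e = 1 - exp (- (\<delta> / 4))"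
    have e: "0 < e" "e < 1" and le1: "- ln (1 - e) = \<delta> / 4" using d by (simp_all add: e_def)
    define c where "c = - ln (e / r)"
    have c: "0 \<le> c"
    proof -
      have "e / r \<le> 1" "0 < e / r" using e r by (simp_all add: field_simps)
      then show ?thesis by (simp add: c_def)
    qed
    have "0 < \<delta> / 4 / (c + 1)" using d c by (intro divide_pos_pos) auto
    then obtain k f' where f': "determined k f'" "measure \<mu> {x \<in> Shift M. f x \<noteq> f' x} < \<delta> / 4 / (c + 1)"
      "{x \<in> Shift M. f x \<noteq> f' x} \<in> sets \<mu>"
      using approx_by_determined_function[OF \<mu> f] by blast
    have t4: "measure \<mu> {x \<in> Shift M. f x \<noteq> f' x} * c \<le> \<delta> / 4"
    proof -
      have "measure \<mu> {x \<in> Shift M. f x \<noteq> f' x} * c \<le> \<delta> / 4 / (c + 1) * c"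
        using f'(2) c by (intro mult_right_mono) auto
      also have "\<dots> \<le> \<delta> / 4" using c d by (simp add: field_simps)
      finally show ?thesis .
    qed
    have "(\<lambda>L. \<integral>x. max 0 (\<bar>\<phi> x\<bar> - real L) \<partial>\<mu>) \<longlonglongrightarrow> (\<integral>x. 0 \<partial>\<mu>)"
    proof (rule integral_dominated_convergence[where w = "\<lambda>x. \<bar>\<phi> x\<bar>"])
      show "integrable \<mu> (\<lambda>x. \<bar>\<phi> x\<bar>)" using \<phi> by simp
      show "AE x in \<mu>. (\<lambda>L. max 0 (\<bar>\<phi> x\<bar> - real L)) \<longlonglongrightarrow> 0"
      proof (rule AE_I2)
        fix x
        obtain N :: nat where N: "\<bar>\<phi> x\<bar> \<le> real N" using real_arch_simple by blast
        have "eventually (\<lambda>L. max 0 (\<bar>\<phi> x\<bar> - real L) = 0) sequentially"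
          using eventually_ge_at_top[of N] by eventually_elim (use N in auto)
        then show "(\<lambda>L. max 0 (\<bar>\<phi> x\<bar> - real L)) \<longlonglongrightarrow> 0" by (rule tendsto_eventually)
      qed
    qed (use \<phi> in \<open>auto intro!: borel_measurable_max borel_measurable_diff\<close>)
    then have "eventually (\<lambda>L. (\<integral>x. max 0 (\<bar>\<phi> x\<bar> - real L) \<partial>\<mu>) < \<delta> / 4) sequentially"
      using d by (intro order_tendstoD(2)) auto
    then obtain L where L: "(\<integral>x. max 0 (\<bar>\<phi> x\<bar> - real L) \<partial>\<mu>) < \<delta> / 4" by (auto simp: eventually_sequentially)
    define q where "q = \<bar>p\<bar> + real L + ln r"
    have q: "0 \<le> q" using r by (simp add: q_def)
    have A: "{x \<in> Shift M. m < x 0} \<in> sets \<mu>" for m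
      using large_symbol_sets I(2) by simp
    have "(\<lambda>m. measure \<mu> {x \<in> Shift M. m < x 0}) \<longlonglongrightarrow> measure \<mu> (\<Inter>m. {x \<in> Shift M. m < x 0})"
      using A by (intro finite_Lim_measure_decseq) (auto simp: decseq_def)
    moreover have "(\<Inter>m. {x \<in> Shift M. m < x 0}) = {}" by auto
    ultimately have "eventually (\<lambda>m. measure \<mu> {x \<in> Shift M. m < x 0} < \<delta> / 4 / (q + 1)) sequentially"
      using d q by (intro order_tendstoD(2)) (auto intro!: divide_pos_pos)
    then obtain m where m: "measure \<mu> {x \<in> Shift M. m < x 0} < \<delta> / 4 / (q + 1)" by (auto simp: eventually_sequentially)
    have t2: "q * measure \<mu> {x \<in> Shift M. m < x 0} \<le> \<delta> / 4"
    proof -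
      have "q * measure \<mu> {x \<in> Shift M. m < x 0} \<le> q * (\<delta> / 4 / (q + 1))"
        using m q by (intro mult_left_mono) auto
      also have "\<dots> \<le> \<delta> / 4" using q d by (simp add: field_simps)
      finally show ?thesis .
    qed
    have "partition_entropy \<mu> f \<le> p - ?I + (\<integral>x. max 0 (\<bar>\<phi> x\<bar> - real L) \<partial>\<mu>)
      + q * measure \<mu> {x \<in> Shift M. m < x 0} - ln (1 - e) + measure \<mu> {x \<in> Shift M. f x \<noteq> f' x} * c"
      using partition_entropy_le_letter_cost[OF mix V Z \<mu> \<phi> f f'(1,3) e, of "real L" m]
      unfolding q_def c_def r_def by simp
    then show "partition_entropy \<mu> f \<le> p - ?I + \<delta>" using L t2 t4 le1 by linarith
  qed
  then have "ks_entropy \<mu> \<le> ereal (p - ?I)"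
    unfolding ks_entropy_def by (intro SUP_least) auto
  then have "ks_entropy \<mu> + ext_integral \<mu> \<phi> \<le> ereal (p - ?I) + ereal ?I"
    unfolding ext_integral_integrable(1)[OF \<phi>] by (intro add_right_mono)
  then show "ks_entropy \<mu> + ext_integral \<mu> \<phi> \<le> ereal p" by simp
qed

text \<open>
  Lower bound for the growth of periodic sums. If no \<open>Z_l\<close> exceeds \<open>exp (2 * V + l * p)\<close>, coding by loops
  shows that the pressure is at most \<open>p\<close>; otherwise supermultiplicativity propagates the growth to all
  large \<open>n\<close>.
\<close>

lemma eventually_Zper_ge:
  assumes mix: "topologically_mixing M" and V: "bounded_distortion M \<phi> V"
    and m\<phi>: "\<phi> \<in> borel_measurable (borel_Shift M)" and P: "pressure M \<phi> < \<infinity>" and q: "ereal q < pressure M \<phi>"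
  shows "eventually (\<lambda>n. ennreal (exp (real n * q)) \<le> Zper M \<phi> a n) sequentially"
proof -
  obtain p where p: "q < p" "ereal p < pressure M \<phi>" using ereal_dense2[OF q] by auto
  have "\<exists>l>0. ennreal (exp (2 * V + real l * p)) < Zper M \<phi> a l"
  proof (rule ccontr)
    assume none: "\<not> (\<exists>l>0. ennreal (exp (2 * V + real l * p)) < Zper M \<phi> a l)"
    have "Zper M \<phi> a l \<le> ennreal (exp (2 * V + real l * p))" if "0 < l" for l
      using none that by (meson not_less)
    from pressure_le_growth_bound[OF mix V m\<phi> P this] p(2) show False by simp
  qed
  then obtain l where "0 < l" "ennreal (exp (2 * V + real l * p)) < Zper M \<phi> a l" by blast
  then obtain c where c: "0 < c" "eventually (\<lambda>n. ennreal (c * exp (real n * p)) \<le> Zper M \<phi> a n) sequentially"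
    using Zper_growth[OF V mix] by blast
  have "eventually (\<lambda>n. - ln c / (p - q) < real n) sequentially"
    by (rule filterlim_at_top_dense[THEN iffD1, OF filterlim_real_sequentially, rule_format])
  with c(2) show ?thesis
  proof eventually_elim
    case (elim n)
    have "- ln c \<le> real n * (p - q)" using elim p(1) by (simp add: field_simps)
    then have "exp (real n * q) \<le> exp (ln c + real n * p)" by (simp add: algebra_simps)
    also have "\<dots> = c * exp (real n * p)" using c by (simp add: exp_add)
    finally show ?case using elim(1) by (meson ennreal_leI order_trans)
  qed
qed

section \<open>The uniformity of the compactification\<close>

interpretation rho: Metric_space "UNIV :: (nat \<Rightarrow> enat) set" rho
  by (rule Metric_space_rho)

text \<open>
  The sets \<open>{x. enat j < x i}\<close> and their complements generate the topology of \<open>rho\<close>, which is that of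
  a Cantor set. The points \<open>x\<close> and \<open>y\<close> are related if none of these sets with \<open>i, j < k\<close> separates
  them. The relations form a basis of the uniformity of \<open>rho\<close>, and also of the uniformity induced by an
  injective function \<open>encode\<close> to the real line; they mediate between the two metrics.
\<close>

definition close_upto :: "nat \<Rightarrow> (nat \<Rightarrow> enat) \<Rightarrow> (nat \<Rightarrow> enat) \<Rightarrow> bool" where
  "close_upto k x y \<longleftrightarrow> (\<forall>i<k. \<forall>j<k. enat j < x i \<longleftrightarrow> enat j < y i)"

lemma close_upto_refl [simp]: "close_upto k x x"
  by (simp add: close_upto_def)

lemma close_upto_sym: "close_upto k x y \<Longrightarrow> close_upto k y x"
  by (simp add: close_upto_def)

lemma close_upto_trans: "close_upto k x y \<Longrightarrow> close_upto k y z \<Longrightarrow> close_upto k x z"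
  by (simp add: close_upto_def)

lemma close_upto_mono: "close_upto k x y \<Longrightarrow> l \<le> k \<Longrightarrow> close_upto l x y"
  by (auto simp: close_upto_def)

lemma enat_eqI_bits: "(\<And>j. enat j < x \<longleftrightarrow> enat j < y) \<Longrightarrow> x = y"
proof (rule ccontr)
  assume *: "\<And>j. enat j < x \<longleftrightarrow> enat j < y" and "x \<noteq> y"
  then consider "x < y" | "y < x" by fastforce
  then show False
  proof cases
    case 1
    then obtain j where "x = enat j" by (cases x) auto
    then show False using 1 *[of j] by simp
  next
    case 2
    then obtain j where "y = enat j" by (cases y) auto
    then show False using 2 *[of j] by simp
  qed
qed

lemma close_all_eq: "(\<And>k. close_upto k x y) \<Longrightarrow> x = y"
proof (rule ext, rule enat_eqI_bits)
  fix i j assume *: "\<And>k. close_upto k x y"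
  from *[of "Suc (max i j)"] show "enat j < x i \<longleftrightarrow> enat j < y i"
    unfolding close_upto_def by (simp add: less_Suc_eq_le)
qed

text \<open>
  Values below \<open>k\<close> are determined exactly, and all others have a reciprocal of at most \<open>1 / (k + 1)\<close>.
\<close>

lemma recip_close:
  assumes "\<And>j. j < k \<Longrightarrow> enat j < a \<longleftrightarrow> enat j < b"
  shows "\<bar>recip a - recip b\<bar> \<le> 1 / real (Suc k)"
proof (cases "enat k \<le> a \<and> enat k \<le> b")
  case True
  have "recip c \<le> 1 / real (Suc k)" if "enat k \<le> c" for c
    using that by (cases c) (auto simp: recip_def intro!: divide_left_mono)
  then have "recip a \<le> 1 / real (Suc k)" "recip b \<le> 1 / real (Suc k)" using True by auto
  then show ?thesis using recip_bounds[of a] recip_bounds[of b] by (simp add: abs_le_iff)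
next
  case False
  have "a = b"
  proof (rule enat_eqI_bits)
    fix j
    show "enat j < a \<longleftrightarrow> enat j < b"
    proof (cases "j < k")
      case jk: False
      have c: "\<not> enat j < a \<and> \<not> enat j < b"
      proof (cases "a < enat k")
        case True
        then obtain c where c: "a = enat c" "c < k" by (cases a) auto
        then have "\<not> enat c < b" using assms[of c] by simp
        then show ?thesis using c jk by (cases b) auto
      next
        case False
        then have "b < enat k" using \<open>\<not> (enat k \<le> a \<and> enat k \<le> b)\<close> by (meson not_le)
        then obtain c where c: "b = enat c" "c < k" by (cases b) auto
        then have "\<not> enat c < a" using assms[of c] by simp
        then show ?thesis using c jk by (cases a) auto
      qed
      then show ?thesis by simp
    qed (rule assms)
  qed
  then show ?thesis by simp
qed

lemma rho_small_if_close:
  assumes "0 < e"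
  shows "\<exists>k. \<forall>x y. close_upto k x y \<longrightarrow> rho x y < e"
proof -
  have e2: "0 < e / 2" using assms by simp
  obtain k1 where k1: "(1/2) ^ k1 < e / 2" using real_arch_pow_inv[OF e2, of "1/2"] by auto
  obtain k2 where k2: "inverse (real (Suc k2)) < e / 2" using reals_Archimedean[OF e2] by blast
  define k where "k = max k1 k2"
  have a: "(1/2 :: real) ^ k < e / 2"
  proof -
    have "(1/2 :: real) ^ k \<le> (1/2) ^ k1" by (rule power_decreasing) (auto simp: k_def)
    then show ?thesis using k1 by linarith
  qed
  have b: "1 / real (Suc k) < e / 2"
  proof -
    have "1 / real (Suc k) \<le> 1 / real (Suc k2)" by (intro divide_left_mono) (auto simp: k_def)
    then show ?thesis using k2 by (simp add: inverse_eq_divide)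
  qed
  show ?thesis
  proof (intro exI[of _ k] allI impI)
    fix x y assume xy: "close_upto k x y"
    define w where "w i = (if i < k then x i else y i)" for i
    have "rho x w \<le> (1/2) ^ k" by (rule rho_le_agree) (simp add: w_def)
    moreover have "rho w y \<le> 1 / real (Suc k)"
    proof -
      have half: "(\<lambda>i. (1/2 :: real) ^ Suc i * (1 / real (Suc k))) sums (1 * (1 / real (Suc k)))"
        by (intro sums_mult2 power_half_series)
      have "rho w y \<le> (\<Sum>i. (1/2 :: real) ^ Suc i * (1 / real (Suc k)))"
        unfolding rho_def
      proof (rule suminf_le[OF _ rho_summable])
        fix i
        show "(1/2) ^ Suc i * \<bar>recip (w i) - recip (y i)\<bar> \<le> (1/2) ^ Suc i * (1 / real (Suc k))"
        proof (rule mult_left_mono)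
          show "\<bar>recip (w i) - recip (y i)\<bar> \<le> 1 / real (Suc k)"
            using xy by (intro recip_close) (auto simp: w_def close_upto_def)
        qed simp
      qed (use half in \<open>rule sums_summable\<close>)
      then show ?thesis using half by (simp add: sums_iff)
    qed
    ultimately show "rho x y < e" using rho.triangle[of x w y] a b by simp
  qed
qed

lemma rho_ge_coord: "(1/2) ^ Suc i * \<bar>recip (x i) - recip (y i)\<bar> \<le> rho x y"
  unfolding rho_def using sum_le_suminf[OF rho_summable, of "{i}" x y] by simp

lemma close_if_rho_small: "\<exists>d>0. \<forall>x y. rho x y < d \<longrightarrow> close_upto k x y"
proof -
  define d where "d = (1/2 :: real) ^ k * (1 / real (Suc k * Suc k))"
  have sep: "d \<le> rho x y" if "i < k" "j < k" "enat j < x i" "\<not> enat j < y i" for x y i j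
  proof -
    have x: "recip (x i) \<le> 1 / real (Suc (Suc j))"
      using that(3) by (cases "x i") (auto simp: recip_def intro!: divide_left_mono)
    have y: "1 / real (Suc j) \<le> recip (y i)"
      using that(4) by (cases "y i") (auto simp: recip_def intro!: divide_left_mono)
    have "1 / real (Suc k * Suc k) \<le> 1 / real (Suc j * Suc (Suc j))"
    proof (rule divide_left_mono)
      have "Suc j * Suc (Suc j) \<le> Suc k * Suc k" using that(2) by (intro mult_le_mono) auto
      then show "real (Suc j * Suc (Suc j)) \<le> real (Suc k * Suc k)" by (simp only: of_nat_le_iff)
    qed (simp_all del: of_nat_mult of_nat_Suc)
    also have "\<dots> = 1 / real (Suc j) - 1 / real (Suc (Suc j))" by (simp add: field_simps)
    also have "\<dots> \<le> \<bar>recip (x i) - recip (y i)\<bar>" using x y by linarith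
    finally have "d \<le> (1/2) ^ k * \<bar>recip (x i) - recip (y i)\<bar>" unfolding d_def by (intro mult_left_mono) auto
    also have "\<dots> \<le> (1/2) ^ Suc i * \<bar>recip (x i) - recip (y i)\<bar>"
      using that(1) by (intro mult_right_mono power_decreasing) auto
    also have "\<dots> \<le> rho x y" by (rule rho_ge_coord)
    finally show ?thesis .
  qed
  have "close_upto k x y" if "rho x y < d" for x y
    unfolding close_upto_def
  proof (intro allI impI iffI)
    fix i j assume ij: "i < k" "j < k"
    show "enat j < y i" if "enat j < x i"
      using sep[where x = x and y = y and i = i and j = j] ij that \<open>rho x y < d\<close> by (meson not_le)
    show "enat j < x i" if "enat j < y i"
      using sep[where x = y and y = x and i = i and j = j] ij that \<open>rho x y < d\<close> rho.commute[of x y] by (metis not_le)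
  qed
  moreover have "0 < d" unfolding d_def by (intro mult_pos_pos divide_pos_pos) (simp_all del: of_nat_mult mult_Suc mult_Suc_right)
  ultimately show ?thesis by blast
qed

section \<open>Embedding of the compactification into the real line\<close>

text \<open>
  All bits \<open>enat j < x i\<close> in one sequence, by the pairing of natural numbers.
\<close>

definition bit_at :: "nat \<Rightarrow> (nat \<Rightarrow> enat) \<Rightarrow> real" where
  "bit_at e x = of_bool (enat (snd (prod_decode e)) < x (fst (prod_decode e)))"

text \<open>
  A point of a Cantor set. The digits are \<open>0\<close> and \<open>1\<close> in base \<open>3\<close>, so that a digit outweighs all later
  ones and the expansion is unique.
\<close>

definition encode :: "(nat \<Rightarrow> enat) \<Rightarrow> real" where
  "encode x = (\<Sum>e. bit_at e x * (1/3) ^ e)"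

lemma encode_summable: "summable (\<lambda>e. bit_at e x * (1/3) ^ e)"
  by (rule summable_comparison_test'[of "\<lambda>e. (1/3 :: real) ^ e" 0])
    (auto simp: summable_geometric bit_at_def)

lemma third_tail:
  "summable (\<lambda>e. (1/3 :: real) ^ (e + N))" "(\<Sum>e. (1/3 :: real) ^ (e + N)) = (3/2) * (1/3) ^ N"
proof -
  have g: "(\<lambda>e. (1/3 :: real) ^ e) sums (1 / (1 - 1/3))" by (rule geometric_sums) simp
  have "(\<lambda>e. (1/3 :: real) ^ e * (1/3) ^ N) sums (1 / (1 - 1/3) * (1/3) ^ N)" by (rule sums_mult2[OF g])
  then have "(\<lambda>e. (1/3 :: real) ^ (e + N)) sums ((3/2) * (1/3) ^ N)" by (simp add: power_add)
  then show "summable (\<lambda>e. (1/3 :: real) ^ (e + N))" "(\<Sum>e. (1/3 :: real) ^ (e + N)) = (3/2) * (1/3) ^ N"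
    by (simp_all add: sums_iff)
qed

lemma encode_diff_tail:
  assumes "\<And>e. e < N \<Longrightarrow> bit_at e x = bit_at e y"
  shows "encode x - encode y = (\<Sum>e. (bit_at (e + N) x - bit_at (e + N) y) * (1/3) ^ (e + N))"
    "summable (\<lambda>e. (bit_at (e + N) x - bit_at (e + N) y) * (1/3) ^ (e + N))"
    "\<bar>encode x - encode y\<bar> \<le> (3/2) * (1/3) ^ N"
proof -
  let ?t = "\<lambda>e. (bit_at e x - bit_at e y) * (1/3) ^ e"
  have s: "summable ?t"
    using summable_diff[OF encode_summable[of x] encode_summable[of y]] by (simp add: left_diff_distrib)
  show s': "summable (\<lambda>e. ?t (e + N))" using s by (rule summable_ignore_initial_segment)
  have "encode x - encode y = (\<Sum>e. ?t e)"
    unfolding encode_def by (simp add: suminf_diff[OF encode_summable encode_summable] left_diff_distrib)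
  also have "\<dots> = (\<Sum>e. ?t (e + N)) + (\<Sum>e<N. ?t e)" by (rule suminf_split_initial_segment[OF s])
  also have "(\<Sum>e<N. ?t e) = 0" using assms by simp
  finally show 1: "encode x - encode y = (\<Sum>e. ?t (e + N))" by simp
  have le: "\<bar>?t e\<bar> \<le> (1/3) ^ e" for e
    by (auto simp: bit_at_def abs_mult)
  have ab: "summable (\<lambda>e. \<bar>?t (e + N)\<bar>)"
    by (rule summable_comparison_test'[OF third_tail(1), of 0 _ N]) (use le in simp)
  have "\<bar>\<Sum>e. ?t (e + N)\<bar> \<le> (\<Sum>e. \<bar>?t (e + N)\<bar>)" by (rule summable_rabs[OF ab])
  also have "\<dots> \<le> (\<Sum>e. (1/3) ^ (e + N))" by (rule suminf_le[OF le ab third_tail(1)])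
  finally show "\<bar>encode x - encode y\<bar> \<le> (3/2) * (1/3) ^ N" by (simp only: 1 third_tail(2))
qed

text \<open>
  The first different digit, number \<open>e0\<close>, contributes \<open>(1/3)^e0\<close>, and all later digits together at most
  half of that.
\<close>

lemma encode_separates:
  assumes "\<bar>encode x - encode y\<bar> < (1/2) * (1/3) ^ N" "e \<le> N"
  shows "bit_at e x = bit_at e y"
proof (rule ccontr)
  assume ne: "bit_at e x \<noteq> bit_at e y"
  define e0 where "e0 = (LEAST e. bit_at e x \<noteq> bit_at e y)"
  have e0: "bit_at e0 x \<noteq> bit_at e0 y" unfolding e0_def using ne by (rule LeastI)
  have e0N: "e0 \<le> N" unfolding e0_def using ne assms(2) by (meson Least_le order_trans)
  have before: "bit_at i x = bit_at i y" if "i < e0" for i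
    using that not_less_Least unfolding e0_def by blast
  let ?t = "\<lambda>e. (bit_at e x - bit_at e y) * (1/3) ^ e"
  note D = encode_diff_tail[of e0 x y, OF before]
  have s: "summable (\<lambda>e. ?t (e + e0))" by (rule D(2))
  have "(\<Sum>e. ?t (e + e0)) = ?t e0 + (\<Sum>e. ?t (Suc e + e0))"
    using suminf_split_head[OF s] by simp
  then have "encode x - encode y = ?t e0 + (\<Sum>e. ?t (e + Suc e0))" using D(1) by simp
  moreover have "\<bar>\<Sum>e. ?t (e + Suc e0)\<bar> \<le> (3/2) * (1/3) ^ Suc e0"
  proof -
    have le: "\<bar>?t e\<bar> \<le> (1/3) ^ e" for e
      by (auto simp: bit_at_def abs_mult)
    have ab: "summable (\<lambda>e. \<bar>?t (e + Suc e0)\<bar>)"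
      by (rule summable_comparison_test'[OF third_tail(1), of 0 _ "Suc e0"]) (simp only: real_norm_def abs_idempotent le)
    have "\<bar>\<Sum>e. ?t (e + Suc e0)\<bar> \<le> (\<Sum>e. \<bar>?t (e + Suc e0)\<bar>)" by (rule summable_rabs[OF ab])
    also have "\<dots> \<le> (\<Sum>e. (1/3) ^ (e + Suc e0))" by (rule suminf_le[OF le ab third_tail(1)])
    finally show ?thesis by (simp only: third_tail(2))
  qed
  moreover have "\<bar>?t e0\<bar> = (1/3) ^ e0"
  proof -
    have "\<bar>bit_at e0 x - bit_at e0 y\<bar> = 1" using e0 by (auto simp: bit_at_def split: if_splits)
    then show ?thesis by (simp add: abs_mult)
  qed
  moreover have "(1/2) * c \<le> \<bar>D\<bar>" if "D = a + b" "\<bar>b\<bar> \<le> (3/2) * (1/3 * c)" "\<bar>a\<bar> = c" for D a b c :: real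
    using that by linarith
  ultimately have "(1/2) * (1/3) ^ e0 \<le> \<bar>encode x - encode y\<bar>" by (simp only: power_Suc)
  moreover have "(1/3 :: real) ^ N \<le> (1/3) ^ e0" using e0N by (intro power_decreasing) auto
  ultimately show False using assms(1) by linarith
qed

lemma encode_close:
  assumes "0 < d"
  shows "\<exists>k. \<forall>x y. close_upto k x y \<longrightarrow> \<bar>encode x - encode y\<bar> < d"
proof -
  have "0 < d / 2" using assms by simp
  then obtain N where N: "(1/3) ^ N < d / 2" using real_arch_pow_inv[of "d / 2" "1/3"] by auto
  show ?thesis
  proof (intro exI[of _ N] allI impI)
    fix x y assume xy: "close_upto N x y"
    have "bit_at e x = bit_at e y" if "e < N" for e
    proof -
      have "fst (prod_decode e) \<le> e" "snd (prod_decode e) \<le> e"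
        using le_prod_encode_1[of "fst (prod_decode e)" "snd (prod_decode e)"]
          le_prod_encode_2[of "snd (prod_decode e)" "fst (prod_decode e)"] by simp_all
      then show ?thesis using xy that by (simp add: bit_at_def close_upto_def)
    qed
    from encode_diff_tail(3)[of N x y, OF this] N show "\<bar>encode x - encode y\<bar> < d" by linarith
  qed
qed

lemma close_if_encode_small:
  "\<exists>d>0. \<forall>x y. \<bar>encode x - encode y\<bar> < d \<longrightarrow> close_upto k x y"
proof -
  define N where "N = (\<Sum>i<k. \<Sum>j<k. prod_encode (i, j))"
  have le: "prod_encode (i, j) \<le> N" if "i < k" "j < k" for i j
  proof -
    have "prod_encode (i, j) \<le> (\<Sum>j<k. prod_encode (i, j))" using that by (intro member_le_sum) auto
    also have "\<dots> \<le> N" unfolding N_def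
      using that member_le_sum[of i "{..<k}" "\<lambda>i. \<Sum>j<k. prod_encode (i, j)"] by simp
    finally show ?thesis .
  qed
  show ?thesis
  proof (intro exI[of _ "(1/2) * (1/3 :: real) ^ N"] conjI allI impI)
    fix x y assume xy: "\<bar>encode x - encode y\<bar> < (1/2) * (1/3) ^ N"
    show "close_upto k x y"
      unfolding close_upto_def
    proof (intro allI impI)
      fix i j assume "i < k" "j < k"
      from encode_separates[OF xy le[OF this]] show "(enat j < x i) = (enat j < y i)"
        by (simp add: bit_at_def of_bool_eq_iff)
    qed
  qed simp
qed

lemma encode_bounded: "\<bar>encode x\<bar> \<le> 2"
proof -
  have "encode (\<lambda>_. 0) = 0" by (simp add: encode_def bit_at_def)
  then show ?thesis using encode_diff_tail(3)[of 0 x "\<lambda>_. 0"] by simp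
qed

section \<open>The topology of the compactification\<close>

lemma topspace_Shift_bar_top [simp]: "topspace (Shift_bar_top M) = Shift_bar M"
  by (simp add: Shift_bar_top_def Shift_bar_def)

lemma Shift_bar_iff: "x \<in> Shift_bar M \<longleftrightarrow> (\<forall>k. \<exists>y\<in>Shift M. close_upto k x (emb y))"
proof -
  have eq: "x \<in> Shift_bar M \<longleftrightarrow> (\<forall>r>0. \<exists>y\<in>Shift M. rho x (emb y) < r)"
    by (auto simp: Shift_bar_def rho.metric_closure_of rho.in_mball)
  show ?thesis unfolding eq
  proof safe
    fix k assume *: "\<forall>r>0. \<exists>y\<in>Shift M. rho x (emb y) < r"
    obtain d where "d > 0" "\<forall>x y. rho x y < d \<longrightarrow> close_upto k x y" using close_if_rho_small by blast
    with * show "\<exists>y\<in>Shift M. close_upto k x (emb y)" by blast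
  next
    fix r :: real assume *: "\<forall>k. \<exists>y\<in>Shift M. close_upto k x (emb y)" and "0 < r"
    then obtain k where "\<forall>x y. close_upto k x y \<longrightarrow> rho x y < r" using rho_small_if_close by blast
    with * show "\<exists>y\<in>Shift M. rho x (emb y) < r" by blast
  qed
qed

lemma emb_in_Shift_bar: "x \<in> Shift M \<Longrightarrow> emb x \<in> Shift_bar M"
  unfolding Shift_bar_iff by (intro allI bexI[of _ x]) auto

lemma openin_Shift_bar:
  "openin (Shift_bar_top M) U \<longleftrightarrow>
    U \<subseteq> Shift_bar M \<and> (\<forall>x\<in>U. \<exists>k. \<forall>y\<in>Shift_bar M. close_upto k x y \<longrightarrow> y \<in> U)"
proof safe
  assume "openin (Shift_bar_top M) U"
  then obtain T where T: "openin rho.mtopology T" "U = T \<inter> Shift_bar M"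
    unfolding Shift_bar_top_def openin_subtopology by blast
  show "\<And>x. x \<in> U \<Longrightarrow> x \<in> Shift_bar M" using T by blast
  fix x assume "x \<in> U"
  then have "x \<in> T" using T by blast
  then obtain r where r: "0 < r" "rho.mball x r \<subseteq> T" using T(1) unfolding rho.openin_mtopology by blast
  obtain k where "\<forall>x y. close_upto k x y \<longrightarrow> rho x y < r" using rho_small_if_close[OF r(1)] by blast
  then show "\<exists>k. \<forall>y\<in>Shift_bar M. close_upto k x y \<longrightarrow> y \<in> U"
    using r(2) T(2) by (intro exI[of _ k]) (auto simp: subset_iff rho.in_mball)
next
  assume sub: "U \<subseteq> Shift_bar M" and loc: "\<forall>x\<in>U. \<exists>k. \<forall>y\<in>Shift_bar M. close_upto k x y \<longrightarrow> y \<in> U"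
  have "\<forall>x. \<exists>d>0. x \<in> U \<longrightarrow> (\<forall>y\<in>Shift_bar M. rho x y < d \<longrightarrow> y \<in> U)"
  proof
    fix x
    show "\<exists>d>0. x \<in> U \<longrightarrow> (\<forall>y\<in>Shift_bar M. rho x y < d \<longrightarrow> y \<in> U)"
    proof (cases "x \<in> U")
      case True
      then obtain k where k: "\<forall>y\<in>Shift_bar M. close_upto k x y \<longrightarrow> y \<in> U" using loc by blast
      obtain d where "d > 0" "\<forall>x y. rho x y < d \<longrightarrow> close_upto k x y" using close_if_rho_small by blast
      with k show ?thesis by blast
    qed (auto intro: zero_less_one)
  qed
  from choice[OF this] obtain d where
    d': "\<forall>x. 0 < d x \<and> (x \<in> U \<longrightarrow> (\<forall>y\<in>Shift_bar M. rho x y < d x \<longrightarrow> y \<in> U))" by blast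
  have "U = (\<Union>x\<in>U. rho.mball x (d x)) \<inter> Shift_bar M"
  proof
    show "U \<subseteq> (\<Union>x\<in>U. rho.mball x (d x)) \<inter> Shift_bar M"
    proof
      fix x assume x: "x \<in> U"
      then have "x \<in> rho.mball x (d x)" using d' by (simp add: rho.in_mball)
      then show "x \<in> (\<Union>x\<in>U. rho.mball x (d x)) \<inter> Shift_bar M" using x sub by blast
    qed
    show "(\<Union>x\<in>U. rho.mball x (d x)) \<inter> Shift_bar M \<subseteq> U"
    proof
      fix y assume "y \<in> (\<Union>x\<in>U. rho.mball x (d x)) \<inter> Shift_bar M"
      then obtain x where "x \<in> U" "rho x y < d x" "y \<in> Shift_bar M" by (auto simp: rho.in_mball)
      then show "y \<in> U" using d' by blast
    qed
  qed
  moreover have "openin rho.mtopology (\<Union>x\<in>U. rho.mball x (d x))"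
    by (intro openin_Union ballI) (auto intro: rho.openin_mball)
  ultimately show "openin (Shift_bar_top M) U"
    unfolding Shift_bar_top_def openin_subtopology by blast
qed

lemma continuous_map_Shift_bar:
  "continuous_map (Shift_bar_top M) euclideanreal f \<longleftrightarrow>
    (\<forall>x\<in>Shift_bar M. \<forall>e>0. \<exists>k. \<forall>y\<in>Shift_bar M. close_upto k x y \<longrightarrow> \<bar>f x - f y\<bar> < e)"
proof safe
  fix x e assume f: "continuous_map (Shift_bar_top M) euclideanreal f" and x: "x \<in> Shift_bar M" and e: "(0::real) < e"
  have "openin (Shift_bar_top M) {y \<in> topspace (Shift_bar_top M). f y \<in> ball (f x) e}"
    using f by (rule openin_continuous_map_preimage) simp
  then show "\<exists>k. \<forall>y\<in>Shift_bar M. close_upto k x y \<longrightarrow> \<bar>f x - f y\<bar> < e"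
  proof -
    have "x \<in> {y \<in> topspace (Shift_bar_top M). f y \<in> ball (f x) e}" using x e by simp
    then obtain k where "\<forall>y\<in>Shift_bar M. close_upto k x y \<longrightarrow> y \<in> {y \<in> topspace (Shift_bar_top M). f y \<in> ball (f x) e}"
      using \<open>openin _ _\<close> unfolding openin_Shift_bar by blast
    then show ?thesis by (intro exI[of _ k]) (auto simp: dist_real_def)
  qed
next
  assume *: "\<forall>x\<in>Shift_bar M. \<forall>e>0. \<exists>k. \<forall>y\<in>Shift_bar M. close_upto k x y \<longrightarrow> \<bar>f x - f y\<bar> < e"
  show "continuous_map (Shift_bar_top M) euclideanreal f"
    unfolding continuous_map_def
  proof safe
    fix U :: "real set" assume U: "openin euclideanreal U"
    show "openin (Shift_bar_top M) {x \<in> topspace (Shift_bar_top M). f x \<in> U}"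
      unfolding openin_Shift_bar
    proof safe
      fix x assume x: "x \<in> topspace (Shift_bar_top M)" "f x \<in> U"
      obtain e where e: "0 < e" "ball (f x) e \<subseteq> U" using U x(2) by (auto simp: open_contains_ball)
      obtain k where k: "\<forall>y\<in>Shift_bar M. close_upto k x y \<longrightarrow> \<bar>f x - f y\<bar> < e" using * x e(1) by (metis topspace_Shift_bar_top)
      show "\<exists>k. \<forall>y\<in>Shift_bar M. close_upto k x y \<longrightarrow> y \<in> {x \<in> topspace (Shift_bar_top M). f x \<in> U}"
      proof (intro exI[of _ k] ballI impI)
        fix y assume y: "y \<in> Shift_bar M" "close_upto k x y"
        then have "f y \<in> ball (f x) e" using k by (simp add: dist_real_def)
        then show "y \<in> {x \<in> topspace (Shift_bar_top M). f x \<in> U}" using e(2) y(1) by auto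
      qed
    qed auto
  qed auto
qed

lemma encode_continuous: "continuous_map (Shift_bar_top M) euclideanreal encode"
  unfolding continuous_map_Shift_bar using encode_close by blast

lemma encode_inj: "encode x = encode y \<Longrightarrow> x = y"
proof (rule close_all_eq)
  fix k assume "encode x = encode y"
  moreover obtain d where "d > 0" "\<forall>x y. \<bar>encode x - encode y\<bar> < d \<longrightarrow> close_upto k x y" using close_if_encode_small by blast
  ultimately show "close_upto k x y" by simp
qed

lemma shift_close: "close_upto (Suc k) x y \<Longrightarrow> close_upto k (shift x) (shift y)"
  by (auto simp: close_upto_def shift_def)

lemma shift_emb: "shift (emb x) = emb (shift x)"
  by (simp add: shift_def emb_def)

lemma shift_Shift_bar: "x \<in> Shift_bar M \<Longrightarrow> shift x \<in> Shift_bar M"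
  unfolding Shift_bar_iff
proof
  fix k assume "\<forall>k. \<exists>y\<in>Shift M. close_upto k x (emb y)"
  then obtain y where "y \<in> Shift M" "close_upto (Suc k) x (emb y)" by blast
  then show "\<exists>y\<in>Shift M. close_upto k (shift x) (emb y)"
    using shift_close[of k x "emb y"] shift_in_Shift[of y M] unfolding shift_emb by blast
qed

text \<open>
  If the codes converge, each bit is eventually constant. The limits of the bits \<open>enat j < x i\<close> are
  decreasing in \<open>j\<close>, hence they are the bits of a point, possibly with coordinates \<open>\<infinity>\<close>.
\<close>

lemma closed_encode_Shift_bar: "closed (encode ` Shift_bar M)"
  unfolding closed_sequential_limits
proof (intro allI impI, elim conjE)
  fix ys l assume ys: "\<forall>n. ys n \<in> encode ` Shift_bar M" and lim: "ys \<longlonglongrightarrow> (l :: real)"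
  from ys have "\<forall>n. \<exists>x. x \<in> Shift_bar M \<and> ys n = encode x" by blast
  then obtain xs where xs: "\<And>n. xs n \<in> Shift_bar M" "\<And>n. ys n = encode (xs n)" by metis
  have cauchy: "\<exists>N. \<forall>n\<ge>N. \<forall>m\<ge>N. close_upto k (xs n) (xs m)" for k
  proof -
    obtain d where d: "d > 0" "\<forall>x y. \<bar>encode x - encode y\<bar> < d \<longrightarrow> close_upto k x y" using close_if_encode_small by blast
    have "Cauchy ys" using lim by (rule LIMSEQ_imp_Cauchy)
    then obtain N where "\<forall>m\<ge>N. \<forall>n\<ge>N. \<bar>ys m - ys n\<bar> < d" using d(1) unfolding Cauchy_def dist_real_def by blast
    with d(2) show ?thesis unfolding xs(2) by blast
  qed
  then obtain N where N: "\<And>k n m. n \<ge> N k \<Longrightarrow> m \<ge> N k \<Longrightarrow> close_upto k (xs n) (xs m)" by metis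
  define \<beta> where "\<beta> i j \<longleftrightarrow> enat j < xs (N (Suc (max i j))) i" for i j
  have bits: "enat j < xs n i \<longleftrightarrow> \<beta> i j" if "i < k" "j < k" "n \<ge> N k" for n i j k
  proof -
    let ?K = "Suc (max i j)"
    let ?m = "max n (N ?K)"
    have "close_upto k (xs n) (xs ?m)" using that by (intro N) auto
    then have "enat j < xs n i \<longleftrightarrow> enat j < xs ?m i" using that by (simp add: close_upto_def)
    moreover have "close_upto ?K (xs ?m) (xs (N ?K))" by (intro N) auto
    then have "enat j < xs ?m i \<longleftrightarrow> \<beta> i j" unfolding close_upto_def \<beta>_def by (simp add: less_Suc_eq_le)
    ultimately show ?thesis by simp
  qed
  have down: "\<beta> i j" if "\<beta> i j'" "j \<le> j'" for i j j'
  proof -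
    let ?k = "Suc (max i j')"
    have "enat j' < xs (N ?k) i" using bits[of i ?k j' "N ?k"] that(1) by (simp add: less_Suc_eq_le)
    then have "enat j < xs (N ?k) i" using that(2) by (meson enat_ord_simps(1) le_less_trans)
    then show ?thesis using bits[of i ?k j "N ?k"] that(2) by (simp add: less_Suc_eq_le)
  qed
  define x where "x i = (if \<forall>j. \<beta> i j then \<infinity> else enat (LEAST j. \<not> \<beta> i j))" for i
  have xb: "enat j < x i \<longleftrightarrow> \<beta> i j" for i j
  proof (cases "\<forall>j. \<beta> i j")
    case False
    then have nb: "\<not> \<beta> i (LEAST j. \<not> \<beta> i j)" by (metis LeastI_ex)
    have "j < (LEAST j. \<not> \<beta> i j) \<longleftrightarrow> \<beta> i j"
    proof
      show "j < (LEAST j. \<not> \<beta> i j) \<Longrightarrow> \<beta> i j" using not_less_Least by blast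
      show "\<beta> i j \<Longrightarrow> j < (LEAST j. \<not> \<beta> i j)" using nb down by (meson not_less)
    qed
    then show ?thesis using False by (simp add: x_def)
  qed (simp add: x_def)
  have near: "close_upto k (xs n) x" if "n \<ge> N k" for k n
    unfolding close_upto_def xb using bits that by blast
  have "x \<in> Shift_bar M"
    unfolding Shift_bar_iff
  proof
    fix k
    obtain y where "y \<in> Shift M" "close_upto k (xs (N k)) (emb y)" using xs(1) unfolding Shift_bar_iff by blast
    then show "\<exists>y\<in>Shift M. close_upto k x (emb y)"
      using close_upto_trans[OF close_upto_sym[OF near[of k "N k"]]] by blast
  qed
  moreover have "ys \<longlonglongrightarrow> encode x"
  proof (rule LIMSEQ_I)
    fix e :: real assume "0 < e"
    then obtain k where "\<forall>x y. close_upto k x y \<longrightarrow> \<bar>encode x - encode y\<bar> < e" using encode_close by blast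
    with near[where k = k] show "\<exists>no. \<forall>n\<ge>no. norm (ys n - encode x) < e"
      unfolding xs(2) real_norm_def by (intro exI[of _ "N k"] allI impI) blast
  qed
  then have "l = encode x" using lim LIMSEQ_unique by blast
  ultimately show "l \<in> encode ` Shift_bar M" by blast
qed

text \<open>
  Off the image of the compactification the value is an arbitrary but constant point of it, which keeps
  the function measurable and its values in \<open>Shift_bar M\<close>.
\<close>

definition decode :: "(nat \<Rightarrow> nat \<Rightarrow> bool) \<Rightarrow> real \<Rightarrow> nat \<Rightarrow> enat" where
  "decode M r = (if r \<in> encode ` Shift_bar M then inv_into (Shift_bar M) encode r else (SOME x. x \<in> Shift_bar M))"

lemma decode_encode: "x \<in> Shift_bar M \<Longrightarrow> decode M (encode x) = x"
proof -
  assume x: "x \<in> Shift_bar M"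
  have "inj_on encode (Shift_bar M)" by (intro inj_onI encode_inj)
  then show ?thesis unfolding decode_def using x by simp
qed

lemma decode_in: "Shift_bar M \<noteq> {} \<Longrightarrow> decode M r \<in> Shift_bar M"
  unfolding decode_def by (auto intro: inv_into_into some_in_eq[THEN iffD2])

text \<open>
  The encoding is a homeomorphism onto a compact subset of the real line, so continuous functions on the
  compactification become bounded continuous functions on the real line by the Tietze theorem. In this
  way weak convergence of measures on the compactification reduces to that of real distributions.
\<close>

lemma bounded_extension:
  assumes "continuous_map (Shift_bar_top M) euclideanreal f"
  obtains g B where "continuous_on UNIV g" "\<forall>r. \<bar>g r\<bar> \<le> B" "\<forall>x\<in>Shift_bar M. g (encode x) = f x"
proof -
  let ?J = "encode ` Shift_bar M"
  let ?F = "\<lambda>r. f (decode M r)"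
  have J: "compact ?J"
    using closed_encode_Shift_bar encode_bounded by (auto simp: compact_eq_bounded_closed bounded_iff)
  have cF: "continuous_on ?J ?F"
    unfolding continuous_on_iff
  proof safe
    fix x :: "nat \<Rightarrow> enat" and e :: real assume x: "x \<in> Shift_bar M" and e: "0 < e"
    obtain k where k: "\<forall>y\<in>Shift_bar M. close_upto k x y \<longrightarrow> \<bar>f x - f y\<bar> < e"
      using assms x e unfolding continuous_map_Shift_bar by blast
    obtain d where d: "d > 0" "\<forall>x y. \<bar>encode x - encode y\<bar> < d \<longrightarrow> close_upto k x y" using close_if_encode_small by blast
    show "\<exists>d>0. \<forall>x'\<in>?J. dist x' (encode x) < d \<longrightarrow> dist (f (decode M x')) (f (decode M (encode x))) < e"
    proof (intro exI[of _ d] conjI ballI impI)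
      fix r assume "r \<in> ?J" and "dist r (encode x) < d"
      then obtain y where y: "y \<in> Shift_bar M" "r = encode y" "\<bar>encode x - encode y\<bar> < d"
        by (auto simp: dist_real_def abs_minus_commute)
      then have "\<bar>f x - f y\<bar> < e" using d(2) k by blast
      then show "dist (f (decode M r)) (f (decode M (encode x))) < e"
        unfolding y(2) decode_encode[OF x] decode_encode[OF y(1)] dist_real_def by (simp add: abs_minus_commute)
    qed (rule d)
  qed
  obtain B where B: "0 \<le> B" "\<And>r. r \<in> ?J \<Longrightarrow> norm (?F r) \<le> B"
  proof -
    have "compact (?F ` ?J)" by (rule compact_continuous_image[OF cF J])
    then have "bounded (?F ` ?J)" by (rule compact_imp_bounded)
    then obtain B where "0 < B" "\<forall>y\<in>?F ` ?J. norm y \<le> B" unfolding bounded_pos by blast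
    then show ?thesis by (intro that[of B]) (simp, blast)
  qed
  obtain g where "continuous_on UNIV g" "\<And>r. r \<in> ?J \<Longrightarrow> g r = ?F r" "\<And>r. r \<in> UNIV \<Longrightarrow> norm (g r) \<le> B"
    using Tietze[OF cF closed_subset[OF subset_UNIV closed_encode_Shift_bar] B] by blast
  then show ?thesis by (intro that[of g B]) (auto simp: decode_encode)
qed

section \<open>Continuous extension to the compactification\<close>

lemma close_upto_common: "close_upto k x y \<Longrightarrow> close_upto k x z \<Longrightarrow> close_upto k y z"
  by (simp add: close_upto_def)

lemma UCb_close:
  assumes "g \<in> UCb M" "0 < e"
  shows "\<exists>k. \<forall>x\<in>Shift M. \<forall>y\<in>Shift M. close_upto k (emb x) (emb y) \<longrightarrow> \<bar>g x - g y\<bar> < e"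
proof -
  obtain d where d: "d > 0" "\<forall>x\<in>Shift M. \<forall>y\<in>Shift M. rho (emb x) (emb y) < d \<longrightarrow> \<bar>g x - g y\<bar> < e"
    using assms unfolding UCb_def by blast
  obtain k where k: "\<forall>x y. close_upto k x y \<longrightarrow> rho x y < d" using rho_small_if_close[OF d(1)] by blast
  show ?thesis
  proof (intro exI[of _ k] ballI impI)
    fix x y assume "x \<in> Shift M" "y \<in> Shift M" "close_upto k (emb x) (emb y)"
    moreover from this(3) have "rho (emb x) (emb y) < d" using k by blast
    ultimately show "\<bar>g x - g y\<bar> < e" using d(2) by blast
  qed
qed

text \<open>
  The values of \<open>g\<close> along any approximating points of \<open>Shift M\<close> form a Cauchy sequence by uniform
  continuity.
\<close>

lemma continuous_extension_exists:
  assumes g: "g \<in> UCb M"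
  shows "\<exists>h. continuous_map (Shift_bar_top M) euclideanreal h \<and> (\<forall>x\<in>Shift M. h (emb x) = g x)"
proof -
  define Y where "Y x k = (SOME y. y \<in> Shift M \<and> close_upto k x (emb y))" for x k
  have Y: "Y x k \<in> Shift M" "close_upto k x (emb (Y x k))" if x: "x \<in> Shift_bar M" for x k
  proof -
    have "\<exists>y. y \<in> Shift M \<and> close_upto k x (emb y)" using x unfolding Shift_bar_iff by blast
    from someI_ex[OF this] show "Y x k \<in> Shift M" "close_upto k x (emb (Y x k))" unfolding Y_def by blast+
  qed
  define h where "h x = lim (\<lambda>k. g (Y x k))" for x
  have conv: "(\<lambda>k. g (Y x k)) \<longlonglongrightarrow> h x" if x: "x \<in> Shift_bar M" for x
  proof -
    have "Cauchy (\<lambda>k. g (Y x k))"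
    proof (rule metric_CauchyI)
      fix e :: real assume "0 < e"
      then obtain k where k: "\<forall>x\<in>Shift M. \<forall>y\<in>Shift M. close_upto k (emb x) (emb y) \<longrightarrow> \<bar>g x - g y\<bar> < e"
        using UCb_close[OF g] by blast
      show "\<exists>N. \<forall>m\<ge>N. \<forall>n\<ge>N. dist (g (Y x m)) (g (Y x n)) < e"
      proof (intro exI[of _ k] allI impI)
        fix m n assume mn: "k \<le> m" "k \<le> n"
        have "close_upto k x (emb (Y x m))" "close_upto k x (emb (Y x n))"
          by (rule close_upto_mono[OF Y(2)[OF x] mn(1)], rule close_upto_mono[OF Y(2)[OF x] mn(2)])
        then have "close_upto k (emb (Y x m)) (emb (Y x n))" by (rule close_upto_common)
        then have "\<bar>g (Y x m) - g (Y x n)\<bar> < e" using k Y(1)[OF x] by blast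
        then show "dist (g (Y x m)) (g (Y x n)) < e" by (simp add: dist_real_def)
      qed
    qed
    then show ?thesis unfolding h_def by (simp add: Cauchy_convergent_iff convergent_LIMSEQ_iff)
  qed
  have near: "\<exists>k. \<forall>x\<in>Shift_bar M. \<forall>z\<in>Shift M. close_upto k x (emb z) \<longrightarrow> \<bar>h x - g z\<bar> \<le> e" if "0 < e" for e
  proof -
    obtain k where k: "\<forall>x\<in>Shift M. \<forall>y\<in>Shift M. close_upto k (emb x) (emb y) \<longrightarrow> \<bar>g x - g y\<bar> < e"
      using UCb_close[OF g \<open>0 < e\<close>] by blast
    show ?thesis
    proof (intro exI[of _ k] ballI impI)
      fix x z assume x: "x \<in> Shift_bar M" and z: "z \<in> Shift M" "close_upto k x (emb z)"
      have "(\<lambda>n. \<bar>g (Y x n) - g z\<bar>) \<longlonglongrightarrow> \<bar>h x - g z\<bar>"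
        by (intro tendsto_rabs tendsto_diff conv[OF x] tendsto_const)
      then show "\<bar>h x - g z\<bar> \<le> e"
      proof (rule LIMSEQ_le_const2, intro exI[of _ k] allI impI)
        fix n assume "k \<le> n"
        then have "close_upto k x (emb (Y x n))" by (rule close_upto_mono[OF Y(2)[OF x]])
        then have "close_upto k (emb (Y x n)) (emb z)" using z(2) by (rule close_upto_common)
        then have "\<bar>g (Y x n) - g z\<bar> < e" using k Y(1)[OF x] z(1) by blast
        then show "\<bar>g (Y x n) - g z\<bar> \<le> e" by (rule less_imp_le)
      qed
    qed
  qed
  have "continuous_map (Shift_bar_top M) euclideanreal h"
    unfolding continuous_map_Shift_bar
  proof (intro ballI allI impI)
    fix x and e :: real assume x: "x \<in> Shift_bar M" and "0 < e"
    then have "0 < e / 3" by simp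
    then obtain k where k: "\<forall>x\<in>Shift_bar M. \<forall>z\<in>Shift M. close_upto k x (emb z) \<longrightarrow> \<bar>h x - g z\<bar> \<le> e / 3"
      using near by blast
    show "\<exists>k. \<forall>y\<in>Shift_bar M. close_upto k x y \<longrightarrow> \<bar>h x - h y\<bar> < e"
    proof (intro exI[of _ k] ballI impI)
      fix y assume y: "y \<in> Shift_bar M" "close_upto k x y"
      have z: "Y x k \<in> Shift M" "close_upto k x (emb (Y x k))" by (rule Y[OF x])+
      have "close_upto k y (emb (Y x k))" by (rule close_upto_common[OF y(2) z(2)])
      then have "\<bar>h x - g (Y x k)\<bar> \<le> e / 3" "\<bar>h y - g (Y x k)\<bar> \<le> e / 3" using k x y(1) z by blast+
      then show "\<bar>h x - h y\<bar> < e" using \<open>0 < e\<close> by linarith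
    qed
  qed
  moreover have "h (emb x) = g x" if "x \<in> Shift M" for x
  proof (rule ccontr)
    assume ne: "h (emb x) \<noteq> g x"
    define e where "e = \<bar>h (emb x) - g x\<bar> / 2"
    have e: "0 < e" "\<bar>h (emb x) - g x\<bar> = 2 * e" using ne by (simp_all add: e_def)
    obtain k where "\<forall>y\<in>Shift_bar M. \<forall>z\<in>Shift M. close_upto k y (emb z) \<longrightarrow> \<bar>h y - g z\<bar> \<le> e"
      using near[OF e(1)] by blast
    then have "\<bar>h (emb x) - g x\<bar> \<le> e"
      using emb_in_Shift_bar[OF that] that by (meson close_upto_refl)
    then show False using e by linarith
  qed
  ultimately show ?thesis by blast
qed

lemma continuous_extension_unique:
  assumes f: "continuous_map (Shift_bar_top M) euclideanreal f" and h: "continuous_map (Shift_bar_top M) euclideanreal h"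
    and eq: "\<forall>x\<in>Shift M. f (emb x) = h (emb x)" and x: "x \<in> Shift_bar M"
  shows "f x = h x"
proof (rule ccontr)
  assume ne: "f x \<noteq> h x"
  define e where "e = \<bar>f x - h x\<bar> / 2"
  have e: "0 < e" using ne by (simp add: e_def)
  obtain k where k: "\<forall>y\<in>Shift_bar M. close_upto k x y \<longrightarrow> \<bar>f x - f y\<bar> < e"
    using f x e unfolding continuous_map_Shift_bar by blast
  obtain l where l: "\<forall>y\<in>Shift_bar M. close_upto l x y \<longrightarrow> \<bar>h x - h y\<bar> < e"
    using h x e unfolding continuous_map_Shift_bar by blast
  obtain y where y: "y \<in> Shift M" "close_upto (max k l) x (emb y)" using x unfolding Shift_bar_iff by blast
  have "close_upto k x (emb y)" "close_upto l x (emb y)" by (rule close_upto_mono[OF y(2)], simp)+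
  then have "\<bar>f x - f (emb y)\<bar> < e" "\<bar>h x - h (emb y)\<bar> < e"
    using k l emb_in_Shift_bar[OF y(1)] by blast+
  moreover have "f (emb y) = h (emb y)" using eq y(1) by blast
  moreover have "\<bar>f x - h x\<bar> = 2 * e" by (simp add: e_def)
  ultimately show False by linarith
qed

lemma extend_props:
  assumes g: "g \<in> UCb M"
  shows "continuous_map (Shift_bar_top M) euclideanreal (extend M g)" "\<And>x. x \<in> Shift M \<Longrightarrow> extend M g (emb x) = g x"
proof -
  let ?P = "\<lambda>h. h \<in> extensional (Shift_bar M) \<and> continuous_map (Shift_bar_top M) euclideanreal h \<and> (\<forall>x\<in>Shift M. h (emb x) = g x)"
  obtain h where h: "continuous_map (Shift_bar_top M) euclideanreal h" "\<forall>x\<in>Shift M. h (emb x) = g x"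
    using continuous_extension_exists[OF g] by blast
  have "?P (restrict h (Shift_bar M))"
  proof (intro conjI restrict_extensional)
    show "continuous_map (Shift_bar_top M) euclideanreal (restrict h (Shift_bar M))"
      using h(1) by (rule continuous_map_eq) simp
  qed (use h(2) emb_in_Shift_bar in \<open>simp add: restrict_def\<close>)
  moreover have "f = f'" if "?P f" "?P f'" for f f'
  proof (rule extensionalityI)
    show "f \<in> extensional (Shift_bar M)" "f' \<in> extensional (Shift_bar M)" using that by blast+
    have c: "continuous_map (Shift_bar_top M) euclideanreal f" "continuous_map (Shift_bar_top M) euclideanreal f'"
      and e: "\<forall>x\<in>Shift M. f (emb x) = f' (emb x)" using that by auto
    show "f x = f' x" if "x \<in> Shift_bar M" for x by (rule continuous_extension_unique[OF c e that])
  qed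
  ultimately have "\<exists>!h. ?P h" by (intro ex1I)
  from theI'[OF this] have "?P (extend M g)" unfolding extend_def .
  then show "continuous_map (Shift_bar_top M) euclideanreal (extend M g)" "\<And>x. x \<in> Shift M \<Longrightarrow> extend M g (emb x) = g x"
    by blast+
qed

section \<open>Measurable structure of the compactification\<close>

lemma openin_subset_Pow: "{U. openin (Shift_bar_top M) U} \<subseteq> Pow (Shift_bar M)"
  using openin_subset[of "Shift_bar_top M"] by auto

lemma space_borel_bar [simp]: "space (borel_bar M) = Shift_bar M"
  unfolding borel_bar_def by (simp add: space_measure_of[OF openin_subset_Pow])

lemma openin_sets_borel_bar: "openin (Shift_bar_top M) U \<Longrightarrow> U \<in> sets (borel_bar M)"
  unfolding borel_bar_def by (subst sets_measure_of[OF openin_subset_Pow]) auto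

lemma continuous_measurable:
  assumes "continuous_map (Shift_bar_top M) euclideanreal f"
  shows "f \<in> borel_measurable (borel_bar M)"
proof (rule borel_measurableI)
  fix S :: "real set" assume "open S"
  then have "openin (Shift_bar_top M) {x \<in> topspace (Shift_bar_top M). f x \<in> S}"
    using assms by (intro openin_continuous_map_preimage) auto
  moreover have "{x \<in> topspace (Shift_bar_top M). f x \<in> S} = f -` S \<inter> space (borel_bar M)" by auto
  ultimately show "f -` S \<inter> space (borel_bar M) \<in> sets (borel_bar M)"
    using openin_sets_borel_bar by metis
qed

lemma measurable_into_borel_bar:
  assumes "\<And>x. x \<in> space N \<Longrightarrow> f x \<in> Shift_bar M"
    and "\<And>U. openin (Shift_bar_top M) U \<Longrightarrow> f -` U \<inter> space N \<in> sets N"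
  shows "f \<in> N \<rightarrow>\<^sub>M borel_bar M"
  unfolding borel_bar_def using assms by (intro measurable_measure_of openin_subset_Pow) auto

lemma shift_measurable_bar: "shift \<in> borel_bar M \<rightarrow>\<^sub>M borel_bar M"
proof (rule measurable_into_borel_bar)
  fix U assume U: "openin (Shift_bar_top M) U"
  have "openin (Shift_bar_top M) (shift -` U \<inter> Shift_bar M)"
    unfolding openin_Shift_bar
  proof (intro conjI ballI)
    fix x assume x: "x \<in> shift -` U \<inter> Shift_bar M"
    then obtain k where k: "\<forall>y\<in>Shift_bar M. close_upto k (shift x) y \<longrightarrow> y \<in> U" using U unfolding openin_Shift_bar by blast
    show "\<exists>k. \<forall>y\<in>Shift_bar M. close_upto k x y \<longrightarrow> y \<in> shift -` U \<inter> Shift_bar M"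
      using k shift_close shift_Shift_bar by (intro exI[of _ "Suc k"]) blast
  qed simp
  then show "shift -` U \<inter> space (borel_bar M) \<in> sets (borel_bar M)" by (simp add: openin_sets_borel_bar)
qed (simp add: shift_Shift_bar)

lemma decode_measurable:
  assumes "Shift_bar M \<noteq> {}"
  shows "decode M \<in> borel \<rightarrow>\<^sub>M borel_bar M"
proof (rule measurable_into_borel_bar)
  fix U assume U: "openin (Shift_bar_top M) U"
  let ?J = "encode ` Shift_bar M"
  have J: "?J \<in> sets borel" using closed_encode_Shift_bar by (rule borel_closed)
  have "\<forall>x. \<exists>d>0. x \<in> U \<longrightarrow> (\<forall>y\<in>Shift_bar M. \<bar>encode x - encode y\<bar> < d \<longrightarrow> y \<in> U)"
  proof
    fix x
    show "\<exists>d>0. x \<in> U \<longrightarrow> (\<forall>y\<in>Shift_bar M. \<bar>encode x - encode y\<bar> < d \<longrightarrow> y \<in> U)"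
    proof (cases "x \<in> U")
      case True
      then obtain k where k: "\<forall>y\<in>Shift_bar M. close_upto k x y \<longrightarrow> y \<in> U" using U unfolding openin_Shift_bar by blast
      obtain d where d: "d > 0" "\<forall>x y. \<bar>encode x - encode y\<bar> < d \<longrightarrow> close_upto k x y" using close_if_encode_small by blast
      show ?thesis
      proof (intro exI[of _ d] conjI impI ballI)
        fix y assume "y \<in> Shift_bar M" "\<bar>encode x - encode y\<bar> < d"
        moreover from this(2) have "close_upto k x y" using d(2) by blast
        ultimately show "y \<in> U" using k by blast
      qed (rule d(1))
    next
      case False
      then show ?thesis by (intro exI[of _ 1]) simp
    qed
  qed
  from choice[OF this] obtain d where
    d: "\<forall>x. 0 < d x \<and> (x \<in> U \<longrightarrow> (\<forall>y\<in>Shift_bar M. \<bar>encode x - encode y\<bar> < d x \<longrightarrow> y \<in> U))" by blast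
  have sub: "U \<subseteq> Shift_bar M" using openin_subset[OF U] by simp
  have "decode M -` U = (?J \<inter> (\<Union>x\<in>U. ball (encode x) (d x))) \<union> (if (SOME x. x \<in> Shift_bar M) \<in> U then - ?J else {})"
  proof (intro set_eqI)
    fix r
    show "r \<in> decode M -` U \<longleftrightarrow> r \<in> (?J \<inter> (\<Union>x\<in>U. ball (encode x) (d x))) \<union> (if (SOME x. x \<in> Shift_bar M) \<in> U then - ?J else {})"
    proof (cases "r \<in> ?J")
      case True
      then obtain y where y: "y \<in> Shift_bar M" "r = encode y" by blast
      have "y \<in> U \<longleftrightarrow> (\<exists>x\<in>U. \<bar>encode x - encode y\<bar> < d x)"
      proof
        assume "y \<in> U"
        moreover have "\<bar>encode y - encode y\<bar> < d y" using d by simp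
        ultimately show "\<exists>x\<in>U. \<bar>encode x - encode y\<bar> < d x" by (intro bexI[of _ y])
      next
        assume "\<exists>x\<in>U. \<bar>encode x - encode y\<bar> < d x"
        then obtain x where x: "x \<in> U" "\<bar>encode x - encode y\<bar> < d x" by (elim bexE)
        from d x(1) have "\<forall>y\<in>Shift_bar M. \<bar>encode x - encode y\<bar> < d x \<longrightarrow> y \<in> U" by (elim allE[of _ x]) simp
        with x(2) y(1) show "y \<in> U" by simp
      qed
      moreover have "decode M r = y" using y by (simp add: decode_encode)
      ultimately show ?thesis using True by (simp add: y(2) dist_real_def)
    next
      case False
      then show ?thesis by (simp add: decode_def)
    qed
  qed
  moreover have "\<dots> \<in> sets borel" 
  proof -
    have "open (\<Union>x\<in>U. ball (encode x) (d x))" by blast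
    then have "?J \<inter> (\<Union>x\<in>U. ball (encode x) (d x)) \<in> sets borel" by (intro sets.Int[OF J] borel_open)
    moreover have "(if (SOME x. x \<in> Shift_bar M) \<in> U then - ?J else {}) \<in> sets borel" using J borel_comp by simp
    ultimately show ?thesis by (rule sets.Un)
  qed
  ultimately show "decode M -` U \<inter> space borel \<in> sets borel" by simp
qed (rule decode_in[OF assms])

lemma inv_measures_barD:
  assumes "\<mu> \<in> inv_measures_bar M"
  shows "prob_space \<mu>" "sets \<mu> = sets (borel_bar M)" "space \<mu> = Shift_bar M" "distr \<mu> \<mu> shift = \<mu>"
proof -
  show "prob_space \<mu>" "sets \<mu> = sets (borel_bar M)" "distr \<mu> \<mu> shift = \<mu>"
    using assms by (simp_all add: inv_measures_bar_def)
  from sets_eq_imp_space_eq[OF this(2)] show "space \<mu> = Shift_bar M" by simp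
qed

lemma continuous_integrable:
  assumes \<mu>: "prob_space \<mu>" "sets \<mu> = sets (borel_bar M)" and f: "continuous_map (Shift_bar_top M) euclideanreal f"
  shows "integrable \<mu> f"
proof -
  interpret prob_space \<mu> by fact
  obtain g B where g: "continuous_on UNIV g" "\<forall>r. \<bar>g r\<bar> \<le> B" "\<forall>x\<in>Shift_bar M. g (encode x) = f x"
    by (rule bounded_extension[OF f])
  have sp: "space \<mu> = Shift_bar M" using sets_eq_imp_space_eq[OF \<mu>(2)] by simp
  show ?thesis
  proof (rule integrable_const_bound)
    show "AE x in \<mu>. norm (f x) \<le> B" 
    proof (rule AE_I2)
      fix x assume "x \<in> space \<mu>"
      then have "g (encode x) = f x" using g(3) sp by simp
      then show "norm (f x) \<le> B" using g(2)[rule_format, of "encode x"] by simp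
    qed
    show "f \<in> borel_measurable \<mu>" using continuous_measurable[OF f] by (simp add: measurable_cong_sets[OF \<mu>(2) refl])
  qed
qed

section \<open>Sequential compactness of the invariant measures\<close>

lemma encode_measurable: "encode \<in> borel_measurable (borel_bar M)"
  by (rule continuous_measurable[OF encode_continuous])

text \<open>
  The real distributions of the encoding have the same characteristic function, which is an integral of
  continuous functions, so they agree by the uniqueness theorem of Levy. The measures are recovered by
  decoding.
\<close>

lemma measure_on_borel_bar_eqI:
  assumes \<mu>: "prob_space \<mu>" "sets \<mu> = sets (borel_bar M)" and \<nu>: "prob_space \<nu>" "sets \<nu> = sets (borel_bar M)"
    and eq: "\<And>f. continuous_map (Shift_bar_top M) euclideanreal f \<Longrightarrow> (\<integral>x. f x \<partial>\<mu>) = (\<integral>x. f x \<partial>\<nu>)"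
  shows "\<mu> = \<nu>"
proof -
  have cm: "continuous_map (Shift_bar_top M) euclideanreal (\<lambda>x. h (encode x))" if "continuous_on UNIV h" for h :: "real \<Rightarrow> real"
    using continuous_map_compose[OF encode_continuous, of euclideanreal h] that
    by (simp add: comp_def)
  have ch: "char (distr \<eta> borel encode) t = complex_of_real (\<integral>x. cos (t * encode x) \<partial>\<eta>) + \<i> * complex_of_real (\<integral>x. sin (t * encode x) \<partial>\<eta>)"
    if \<eta>: "prob_space \<eta>" "sets \<eta> = sets (borel_bar M)" for \<eta> t
  proof -
    have me: "encode \<in> borel_measurable \<eta>"
      unfolding measurable_cong_sets[OF \<eta>(2) refl] by (rule encode_measurable)
    have ic: "integrable \<eta> (\<lambda>x. cos (t * encode x))" "integrable \<eta> (\<lambda>x. sin (t * encode x))"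
    proof -
      have "continuous_on UNIV (\<lambda>r. cos (t * r))" "continuous_on UNIV (\<lambda>r. sin (t * r))"
        by (intro continuous_intros)+
      from this[THEN cm, THEN continuous_integrable[OF \<eta>]]
      show "integrable \<eta> (\<lambda>x. cos (t * encode x))" "integrable \<eta> (\<lambda>x. sin (t * encode x))" .
    qed
    have "char (distr \<eta> borel encode) t = (\<integral>x. iexp (t * encode x) \<partial>\<eta>)"
      unfolding char_def by (rule integral_distr[OF me]) simp
    also have "\<dots> = (\<integral>x. complex_of_real (cos (t * encode x)) + \<i> * complex_of_real (sin (t * encode x)) \<partial>\<eta>)"
    proof (rule Bochner_Integration.integral_cong[OF refl])
      fix x
      have "exp (\<i> * complex_of_real s) = complex_of_real (cos s) + \<i> * complex_of_real (sin s)" for s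
        unfolding cis_conv_exp[symmetric] by (rule complex_eqI) simp_all
      then show "iexp (t * encode x) = complex_of_real (cos (t * encode x)) + \<i> * complex_of_real (sin (t * encode x))" .
    qed
    also have "\<dots> = complex_of_real (\<integral>x. cos (t * encode x) \<partial>\<eta>) + \<i> * complex_of_real (\<integral>x. sin (t * encode x) \<partial>\<eta>)"
    proof -
      have c: "(\<integral>x. complex_of_real (cos (t * encode x)) \<partial>\<eta>) = complex_of_real (\<integral>x. cos (t * encode x) \<partial>\<eta>)"
        by (rule integral_bounded_linear[OF bounded_linear_of_real ic(1)])
      have s: "(\<integral>x. complex_of_real (sin (t * encode x)) \<partial>\<eta>) = complex_of_real (\<integral>x. sin (t * encode x) \<partial>\<eta>)"
        by (rule integral_bounded_linear[OF bounded_linear_of_real ic(2)])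
      have B: "(\<integral>x. \<i> * complex_of_real (sin (t * encode x)) \<partial>\<eta>) = \<i> * (\<integral>x. complex_of_real (sin (t * encode x)) \<partial>\<eta>)"
        by (rule integral_mult_right_zero)
      have A: "(\<integral>x. complex_of_real (cos (t * encode x)) + \<i> * complex_of_real (sin (t * encode x)) \<partial>\<eta>)
        = (\<integral>x. complex_of_real (cos (t * encode x)) \<partial>\<eta>) + (\<integral>x. \<i> * complex_of_real (sin (t * encode x)) \<partial>\<eta>)"
        by (rule Bochner_Integration.integral_add[OF integrable_of_real[OF ic(1)]
              integrable_mult_right[OF integrable_of_real[OF ic(2)]]])
      show ?thesis by (rule trans[OF A arg_cong2[of _ _ _ _ "(+)", OF c trans[OF B arg_cong[of _ _ "(*) \<i>", OF s]]]])
    qed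
    finally show ?thesis .
  qed
  have "char (distr \<mu> borel encode) = char (distr \<nu> borel encode)"
  proof
    fix t
    show "char (distr \<mu> borel encode) t = char (distr \<nu> borel encode) t"
      unfolding ch[OF \<mu>] ch[OF \<nu>]
    proof -
      have "continuous_on UNIV (\<lambda>r. cos (t * r))" "continuous_on UNIV (\<lambda>r. sin (t * r))"
        by (intro continuous_intros)+
      from this[THEN cm, THEN eq] show "complex_of_real (\<integral>x. cos (t * encode x) \<partial>\<mu>) + \<i> * complex_of_real (\<integral>x. sin (t * encode x) \<partial>\<mu>)
        = complex_of_real (\<integral>x. cos (t * encode x) \<partial>\<nu>) + \<i> * complex_of_real (\<integral>x. sin (t * encode x) \<partial>\<nu>)" by (simp only:)
    qed
  qed
  moreover have rd: "real_distribution (distr \<eta> borel encode)" if \<eta>: "prob_space \<eta>" "sets \<eta> = sets (borel_bar M)" for \<eta>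
    by (rule prob_space.real_distribution_distr[OF \<eta>(1)])
      (unfold measurable_cong_sets[OF \<eta>(2) refl], rule encode_measurable)
  ultimately have de: "distr \<mu> borel encode = distr \<nu> borel encode"
    using Levy_uniqueness[OF rd[OF \<mu>] rd[OF \<nu>]] by simp
  have round_trip: "distr (distr \<eta> borel encode) (borel_bar M) (decode M) = \<eta>"
    if \<eta>: "prob_space \<eta>" "sets \<eta> = sets (borel_bar M)" for \<eta>
  proof -
    have sp: "space \<eta> = Shift_bar M" using sets_eq_imp_space_eq[OF \<eta>(2)] by simp
    have ne: "Shift_bar M \<noteq> {}" using prob_space.not_empty[OF \<eta>(1)] sp by simp
    have me: "encode \<in> borel_measurable \<eta>"
      unfolding measurable_cong_sets[OF \<eta>(2) refl] by (rule encode_measurable)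
    have "distr (distr \<eta> borel encode) (borel_bar M) (decode M) = distr \<eta> (borel_bar M) (decode M \<circ> encode)"
      by (rule distr_distr[OF decode_measurable[OF ne] me])
    also have "\<dots> = distr \<eta> \<eta> (\<lambda>x. x)"
    proof (rule distr_cong[OF refl \<eta>(2)[symmetric]])
      show "(decode M \<circ> encode) x = x" if "x \<in> space \<eta>" for x
        using decode_encode[of x M] that unfolding sp by simp
    qed
    also have "\<dots> = \<eta>" by (rule distr_id)
    finally show ?thesis .
  qed
  have "\<mu> = distr (distr \<mu> borel encode) (borel_bar M) (decode M)" by (rule round_trip[OF \<mu>, symmetric])
  also have "\<dots> = distr (distr \<nu> borel encode) (borel_bar M) (decode M)" by (simp only: de)
  also have "\<dots> = \<nu>" by (rule round_trip[OF \<nu>])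
  finally show ?thesis .
qed

lemma continuous_shift:
  assumes "continuous_map (Shift_bar_top M) euclideanreal f"
  shows "continuous_map (Shift_bar_top M) euclideanreal (\<lambda>x. f (shift x))"
  unfolding continuous_map_Shift_bar
proof (intro ballI allI impI)
  fix x and e :: real assume x: "x \<in> Shift_bar M" and "0 < e"
  then obtain k where k: "\<forall>y\<in>Shift_bar M. close_upto k (shift x) y \<longrightarrow> \<bar>f (shift x) - f y\<bar> < e"
    using assms shift_Shift_bar[OF x] unfolding continuous_map_Shift_bar by blast
  show "\<exists>k. \<forall>y\<in>Shift_bar M. close_upto k x y \<longrightarrow> \<bar>f (shift x) - f (shift y)\<bar> < e"
  proof (intro exI[of _ "Suc k"] ballI impI)
    fix y assume y: "y \<in> Shift_bar M" "close_upto (Suc k) x y"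
    show "\<bar>f (shift x) - f (shift y)\<bar> < e"
      using k shift_Shift_bar[OF y(1)] shift_close[OF y(2)] by blast
  qed
qed

text \<open>
  Helly's selection theorem for the real distributions of the encoding. The limit lives on the image of
  the compactification, since this image is closed, and it is pulled back by decoding. Invariance
  passes to the limit because \<open>f \<circ> shift\<close> is continuous together with \<open>f\<close>.
\<close>

lemma inv_measures_bar_seq_compact:
  fixes \<mu>s :: "nat \<Rightarrow> (nat \<Rightarrow> enat) measure"
  assumes \<mu>s: "\<And>n. \<mu>s n \<in> inv_measures_bar M"
  obtains r \<mu> where "strict_mono (r :: nat \<Rightarrow> nat)" "\<mu> \<in> inv_measures_bar M"
    "\<forall>f. continuous_map (Shift_bar_top M) euclideanreal f \<longrightarrow> (\<lambda>n. \<integral>x. f x \<partial>\<mu>s (r n)) \<longlonglongrightarrow> (\<integral>x. f x \<partial>\<mu>)"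
proof -
  note I = inv_measures_barD[OF \<mu>s]
  let ?J = "encode ` Shift_bar M"
  have ne: "Shift_bar M \<noteq> {}" using prob_space.not_empty[OF I(1)[of 0]] I(3)[of 0] by simp
  have me: "encode \<in> borel_measurable (\<mu>s n)" for n
    unfolding measurable_cong_sets[OF I(2) refl] by (rule encode_measurable)
  define \<nu> where "\<nu> n = distr (\<mu>s n) borel encode" for n
  have rd: "real_distribution (\<nu> n)" for n
    unfolding \<nu>_def by (rule prob_space.real_distribution_distr[OF I(1) me])
  have push: "(\<integral>x. g (encode x) \<partial>\<mu>s n) = (\<integral>y. g y \<partial>\<nu> n)" if "g \<in> borel_measurable borel" for g :: "real \<Rightarrow> real" and n
    unfolding \<nu>_def by (rule integral_distr[OF me that, symmetric])
  have "tight \<nu>"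
    unfolding tight_def
  proof (intro conjI allI impI rd)
    fix \<epsilon> :: real assume e: "0 < \<epsilon>"
    show "\<exists>a b. a < b \<and> (\<forall>n. 1 - \<epsilon> < measure (\<nu> n) {a<..b})"
    proof (rule exI[of _ "-3"], rule exI[of _ 3], intro conjI allI)
      fix n
      have "-3 < encode x \<and> encode x \<le> 3" for x using encode_bounded[of x] by (simp add: abs_le_iff)
      then have "encode -` {-3<..3} \<inter> space (\<mu>s n) = space (\<mu>s n)" by auto
      then have "measure (\<nu> n) {-3<..3} = 1"
        unfolding \<nu>_def by (simp add: measure_distr[OF me] prob_space.prob_space[OF I(1)])
      then show "1 - \<epsilon> < measure (\<nu> n) {-3<..3}" using e by simp
    qed simp
  qed
  from tight_imp_convergent_subsubsequence[OF this strict_mono_id] obtain r N where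
    r: "strict_mono (r :: nat \<Rightarrow> nat)" and N: "real_distribution N" and w: "weak_conv_m (\<nu> \<circ> id \<circ> r) N" by blast
  interpret N: real_distribution N by (rule N)
  have lim: "(\<lambda>n. \<integral>y. g y \<partial>\<nu> (r n)) \<longlonglongrightarrow> (\<integral>y. g y \<partial>N)" if "continuous_on UNIV g" "\<forall>y. \<bar>g y\<bar> \<le> B" for g :: "real \<Rightarrow> real" and B
  proof -
    have "(\<lambda>n. integral\<^sup>L ((\<nu> \<circ> id \<circ> r) n) g) \<longlonglongrightarrow> integral\<^sup>L N g"
    proof (rule weak_conv_imp_integral_bdd_continuous_conv[OF _ N w])
      show "real_distribution ((\<nu> \<circ> id \<circ> r) n)" for n using rd by simp
      show "isCont g x" for x using that(1) by (simp add: continuous_on_eq_continuous_at)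
      show "norm (g x) \<le> B" for x using that(2) by simp
    qed
    then show ?thesis by simp
  qed
  have J: "closed ?J" by (rule closed_encode_Shift_bar)
  have AEJ: "AE y in N. y \<in> ?J"
  proof -
    \<comment> \<open>A bounded continuous function that vanishes exactly on the image.\<close>
    let ?g = "\<lambda>y. min 1 (infdist y ?J)"
    have g: "continuous_on UNIV ?g" by (intro continuous_intros)
    have b: "\<forall>y. \<bar>?g y\<bar> \<le> 1" by (auto simp: infdist_nonneg abs_le_iff)
    have gm: "?g \<in> borel_measurable borel" using g by (rule borel_measurable_continuous_onI)
    have "(\<integral>y. ?g y \<partial>\<nu> n) = 0" for n
      unfolding push[OF gm, symmetric] using I(3)[of n]
      by (subst Bochner_Integration.integral_cong[where g = "\<lambda>_. 0", OF refl]) auto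
    then have "(\<integral>y. ?g y \<partial>N) = 0" using lim[OF g b] by (simp add: LIMSEQ_const_iff)
    moreover have "integrable N ?g"
      by (rule N.integrable_const_bound[of _ 1]) (use b gm in auto)
    ultimately have "AE y in N. ?g y = 0"
      by (subst (asm) integral_nonneg_eq_0_iff_AE) (auto simp: infdist_nonneg)
    then show ?thesis
    proof eventually_elim
      case (elim y)
      then have "infdist y ?J = 0" by (simp add: min_def split: if_splits)
      then show ?case using J ne in_closed_iff_infdist_zero[of ?J y] by simp
    qed
  qed
  define \<mu> where "\<mu> = distr N (borel_bar M) (decode M)"
  have dm: "decode M \<in> N \<rightarrow>\<^sub>M borel_bar M"
    unfolding measurable_cong_sets[OF N.events_eq_borel refl] by (rule decode_measurable[OF ne])
  have P: "prob_space \<mu>" unfolding \<mu>_def by (rule N.prob_space_distr[OF dm])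
  have S: "sets \<mu> = sets (borel_bar M)" by (simp add: \<mu>_def)
  have conv: "(\<lambda>n. \<integral>x. f x \<partial>\<mu>s (r n)) \<longlonglongrightarrow> (\<integral>x. f x \<partial>\<mu>)" if f: "continuous_map (Shift_bar_top M) euclideanreal f" for f
  proof -
    obtain g B where g: "continuous_on UNIV g" "\<forall>r. \<bar>g r\<bar> \<le> B" "\<forall>x\<in>Shift_bar M. g (encode x) = f x"
      by (rule bounded_extension[OF f])
    have gm: "g \<in> borel_measurable borel" using g(1) by (rule borel_measurable_continuous_onI)
    have gN: "g \<in> borel_measurable N"
      unfolding measurable_cong_sets[OF N.events_eq_borel refl] by (rule gm)
    have fN: "(\<lambda>y. f (decode M y)) \<in> borel_measurable N"
      by (rule measurable_compose[OF dm continuous_measurable[OF f]])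
    have "(\<integral>x. f x \<partial>\<mu>) = (\<integral>y. f (decode M y) \<partial>N)"
      unfolding \<mu>_def by (rule integral_distr[OF dm continuous_measurable[OF f]])
    also have "\<dots> = (\<integral>y. g y \<partial>N)"
    proof (rule integral_cong_AE[OF fN gN])
      show "AE y in N. f (decode M y) = g y"
        using AEJ
      proof eventually_elim
        case (elim y)
        then obtain x where "x \<in> Shift_bar M" "y = encode x" by blast
        then show ?case using g(3) by (simp add: decode_encode)
      qed
    qed
    finally have 1: "(\<integral>x. f x \<partial>\<mu>) = (\<integral>y. g y \<partial>N)" .
    have 2: "(\<integral>x. f x \<partial>\<mu>s n) = (\<integral>y. g y \<partial>\<nu> n)" for n
      unfolding push[OF gm, symmetric] using I(3)[of n] g(3) by (intro Bochner_Integration.integral_cong) auto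
    show ?thesis unfolding 1 2 by (rule lim[OF g(1,2)])
  qed
  have sm: "shift \<in> \<eta> \<rightarrow>\<^sub>M \<eta>" if "sets \<eta> = sets (borel_bar M)" for \<eta>
    unfolding measurable_cong_sets[OF that that] by (rule shift_measurable_bar)
  have "distr \<mu> \<mu> shift = \<mu>"
  proof (rule measure_on_borel_bar_eqI[OF _ _ P S])
    show "prob_space (distr \<mu> \<mu> shift)" by (rule prob_space.prob_space_distr[OF P sm[OF S]])
    show "sets (distr \<mu> \<mu> shift) = sets (borel_bar M)" by (simp add: S)
    fix f assume f: "continuous_map (Shift_bar_top M) euclideanreal f"
    have fm: "f \<in> borel_measurable \<eta>" if "sets \<eta> = sets (borel_bar M)" for \<eta>
      unfolding measurable_cong_sets[OF that refl] by (rule continuous_measurable[OF f])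
    have "(\<integral>x. f x \<partial>\<mu>s n) = (\<integral>x. f (shift x) \<partial>\<mu>s n)" for n
      using integral_distr[OF sm[OF I(2)] fm[OF I(2)], of n] unfolding I(4) .
    then have "(\<lambda>n. \<integral>x. f x \<partial>\<mu>s (r n)) \<longlonglongrightarrow> (\<integral>x. f (shift x) \<partial>\<mu>)"
      using conv[OF continuous_shift[OF f]] by simp
    then have "(\<integral>x. f (shift x) \<partial>\<mu>) = (\<integral>x. f x \<partial>\<mu>)" using conv[OF f] by (rule LIMSEQ_unique)
    then show "(\<integral>x. f x \<partial>distr \<mu> \<mu> shift) = (\<integral>x. f x \<partial>\<mu>)"
      by (simp add: integral_distr[OF sm[OF S] fm[OF S]])
  qed
  then have "\<mu> \<in> inv_measures_bar M" using P S by (simp add: inv_measures_bar_def)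
  moreover from conv have "\<forall>f. continuous_map (Shift_bar_top M) euclideanreal f \<longrightarrow> (\<lambda>n. \<integral>x. f x \<partial>\<mu>s (r n)) \<longlonglongrightarrow> (\<integral>x. f x \<partial>\<mu>)"
    by (intro allI impI)
  ultimately show ?thesis by (rule that[OF r])
qed

lemma topspace_weak_star: "topspace (weak_star M) = inv_measures_bar M"
proof -
  have "inv_measures_bar M \<in> {{\<mu> \<in> inv_measures_bar M. (\<integral>y. f y \<partial>\<mu>) \<in> U} |f U.
        continuous_map (Shift_bar_top M) euclideanreal f \<and> open U}"
    by (intro CollectI exI[of _ "\<lambda>_. 0"] exI[of _ UNIV]) simp
  then have "inv_measures_bar M \<subseteq> \<Union>{{\<mu> \<in> inv_measures_bar M. (\<integral>y. f y \<partial>\<mu>) \<in> U} |f U.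
        continuous_map (Shift_bar_top M) euclideanreal f \<and> open U}" by (rule Union_upper)
  moreover have "\<Union>{{\<mu> \<in> inv_measures_bar M. (\<integral>y. f y \<partial>\<mu>) \<in> U} |f U.
        continuous_map (Shift_bar_top M) euclideanreal f \<and> open U} \<subseteq> inv_measures_bar M"
    by (rule Union_least) auto
  ultimately show ?thesis unfolding weak_star_def topology_generated_by_topspace by (rule equalityI[rotated])
qed

text \<open>
  The weak-star topology is given by a subbasis, so the convergence of integrals gives convergence in the
  topology by induction over the generation of open sets.
\<close>

lemma weak_star_limit_in_closed:
  assumes K: "closedin (weak_star M) K" and \<mu>s: "\<And>n. \<mu>s n \<in> K" and \<mu>: "\<mu> \<in> inv_measures_bar M"
    and lim: "\<forall>f. continuous_map (Shift_bar_top M) euclideanreal f \<longrightarrow> (\<lambda>n. \<integral>x. f x \<partial>\<mu>s n) \<longlonglongrightarrow> (\<integral>x. f x \<partial>\<mu>)"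
  shows "\<mu> \<in> K"
proof (rule ccontr)
  assume "\<mu> \<notin> K"
  let ?S = "{{\<mu> \<in> inv_measures_bar M. (\<integral>y. f y \<partial>\<mu>) \<in> U} |f U.
        continuous_map (Shift_bar_top M) euclideanreal f \<and> open U}"
  have \<mu>sI: "\<mu>s n \<in> inv_measures_bar M" for n
    using closedin_subset[OF K] \<mu>s[of n] unfolding topspace_weak_star by blast
  have "openin (weak_star M) (inv_measures_bar M - K)"
    using K unfolding closedin_def topspace_weak_star by blast
  then have "generate_topology_on ?S (inv_measures_bar M - K)"
    unfolding weak_star_def openin_topology_generated_by_iff .
  then have "\<mu> \<in> inv_measures_bar M - K \<longrightarrow> eventually (\<lambda>n. \<mu>s n \<in> inv_measures_bar M - K) sequentially"
  proof (induction rule: generate_topology_on.induct)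
    case (Int A B)
    then show ?case by (auto elim: eventually_elim2)
  next
    case (UN \<A>)
    show ?case
    proof
      assume "\<mu> \<in> \<Union>\<A>"
      then obtain A where A: "A \<in> \<A>" "\<mu> \<in> A" by blast
      then have "eventually (\<lambda>n. \<mu>s n \<in> A) sequentially" using UN(2)[OF A(1)] by blast
      then show "eventually (\<lambda>n. \<mu>s n \<in> \<Union>\<A>) sequentially"
        by (rule eventually_mono) (use A(1) in blast)
    qed
  next
    case (Basis A)
    then obtain f U where A: "A = {\<mu> \<in> inv_measures_bar M. (\<integral>y. f y \<partial>\<mu>) \<in> U}"
      "continuous_map (Shift_bar_top M) euclideanreal f" "open U" by blast
    show ?case
    proof
      assume "\<mu> \<in> A"
      then have "(\<integral>y. f y \<partial>\<mu>) \<in> U" by (simp add: A(1))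
      with lim[rule_format, OF A(2)] A(3) have "eventually (\<lambda>n. (\<integral>y. f y \<partial>\<mu>s n) \<in> U) sequentially"
        by (intro topological_tendstoD)
      then show "eventually (\<lambda>n. \<mu>s n \<in> A) sequentially" using \<mu>sI by (simp add: A(1))
    qed
  qed simp
  then show False using \<mu> \<open>\<mu> \<notin> K\<close> \<mu>s by simp
qed

section \<open>Finite covers of closed sets of measures\<close>

lemma recode_close:
  assumes "close_upto k (emb x) (emb y)" "i < k"
  shows "min (x i) k = min (y i) k"
proof (rule ccontr)
  assume "min (x i) k \<noteq> min (y i) k"
  then consider "x i < k" "x i < y i" | "y i < k" "y i < x i" by linarith
  then show False using assms unfolding close_upto_def emb_def
    by cases (metis enat_ord_simps(2) less_irrefl)+
qed

lemma close_recode: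
  assumes "\<And>i. i < k \<Longrightarrow> min (x i) k = min (y i) k"
  shows "close_upto k (emb x) (emb y)"
  unfolding close_upto_def emb_def
proof (intro allI impI)
  fix i j assume "i < k" "j < k"
  with assms[of i] show "(enat j < enat (x i)) = (enat j < enat (y i))" by (auto simp: min_def split: if_splits)
qed

definition recode :: "nat \<Rightarrow> (nat \<Rightarrow> nat) \<Rightarrow> nat list" where
  "recode k x = map (\<lambda>i. min (x i) k) [0..<k]"

lemma recode_eq_iff: "recode k x = recode k y \<longleftrightarrow> close_upto k (emb x) (emb y)"
proof -
  have "recode k x = recode k y \<longleftrightarrow> (\<forall>i<k. min (x i) k = min (y i) k)" by (auto simp: recode_def)
  then show ?thesis using close_recode recode_close by blast
qed

definition coarse_words :: "nat \<Rightarrow> nat list set" where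
  "coarse_words k = {w. set w \<subseteq> {..k} \<and> length w = k}"

lemma finite_coarse_words: "finite (coarse_words k)"
  unfolding coarse_words_def by (rule finite_lists_length_eq) simp

lemma recode_in: "recode k x \<in> coarse_words k"
  by (auto simp: recode_def coarse_words_def)

text \<open>
  Functions of the first \<open>k\<close> symbols truncated at \<open>k\<close>, with rational values: a countable dense subset of
  \<open>UCb M\<close>.
\<close>

definition step_functions :: "((nat \<Rightarrow> nat) \<Rightarrow> real) set" where
  "step_functions = (\<Union>k. (\<lambda>q x. q (recode k x)) ` (PiE (coarse_words k) (\<lambda>_. \<rat>)))"

lemma countable_step_functions: "countable step_functions"
  unfolding step_functions_def
  by (intro countable_UN countable_image countable_PiE finite_coarse_words countable_rat) simp

lemma step_functions_UCb: "s \<in> step_functions \<Longrightarrow> s \<in> UCb M"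
proof -
  assume "s \<in> step_functions"
  then obtain k q where s: "s = (\<lambda>x. q (recode k x))" unfolding step_functions_def by blast
  obtain d where d: "d > 0" "\<forall>x y. rho x y < d \<longrightarrow> close_upto k x y" using close_if_rho_small by blast
  have "s ` Shift M \<subseteq> q ` coarse_words k" using recode_in by (auto simp: s)
  then have "bounded (s ` Shift M)" using finite_coarse_words by (meson bounded_subset finite_imageI finite_imp_bounded)
  moreover have "\<exists>d>0. \<forall>x\<in>Shift M. \<forall>y\<in>Shift M. rho (emb x) (emb y) < d \<longrightarrow> \<bar>s x - s y\<bar> < e" if "0 < e" for e :: real
  proof (intro exI[of _ d] conjI ballI impI d(1))
    fix x y assume "rho (emb x) (emb y) < d"
    then have "recode k x = recode k y" using d(2) recode_eq_iff by blast
    then show "\<bar>s x - s y\<bar> < e" using that by (simp add: s)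
  qed
  ultimately show "s \<in> UCb M" unfolding UCb_def by blast
qed

lemma step_functions_dense:
  assumes g: "g \<in> UCb M" and e: "0 < e"
  shows "\<exists>s\<in>step_functions. \<forall>x\<in>Shift M. \<bar>s x - g x\<bar> \<le> e"
proof -
  have "0 < e / 2" using e by simp
  then obtain k where k: "\<forall>x\<in>Shift M. \<forall>y\<in>Shift M. close_upto k (emb x) (emb y) \<longrightarrow> \<bar>g x - g y\<bar> < e / 2"
    using UCb_close[OF g] by blast
  define rep where "rep w = (SOME y. y \<in> Shift M \<and> recode k y = w)" for w
  have "\<exists>r\<in>\<rat>. \<bar>r - t\<bar> < e / 2" for t :: real
  proof -
    obtain r where "r \<in> \<rat>" "t < r" "r < t + e / 2" using Rats_dense_in_real[of t "t + e / 2"] \<open>0 < e / 2\<close> by auto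
    then show ?thesis by (intro bexI[of _ r]) auto
  qed
  then have "\<forall>t. \<exists>r. r \<in> \<rat> \<and> \<bar>r - t\<bar> < e / 2" for t :: real by blast
  from choice[OF this] obtain Q where Q: "\<forall>t :: real. Q t \<in> \<rat> \<and> \<bar>Q t - t\<bar> < e / 2" by (elim exE)
  define q where "q = restrict (\<lambda>w. Q (g (rep w))) (coarse_words k)"
  have "q \<in> PiE (coarse_words k) (\<lambda>_. \<rat>)" using Q by (auto simp: q_def)
  then have "(\<lambda>x. q (recode k x)) \<in> step_functions" unfolding step_functions_def by blast
  moreover have "\<bar>q (recode k x) - g x\<bar> \<le> e" if x: "x \<in> Shift M" for x
  proof -
    let ?y = "rep (recode k x)"
    have "\<exists>y. y \<in> Shift M \<and> recode k y = recode k x" using x by blast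
    from someI_ex[OF this] have y: "?y \<in> Shift M" "recode k ?y = recode k x" unfolding rep_def by blast+
    have "close_upto k (emb ?y) (emb x)" using y(2) by (simp only: recode_eq_iff)
    then have "\<bar>g ?y - g x\<bar> < e / 2" using k y(1) x by blast
    moreover have "\<bar>Q (g ?y) - g ?y\<bar> < e / 2" using Q by blast
    moreover have "q (recode k x) = Q (g ?y)" using recode_in by (simp add: q_def)
    ultimately show ?thesis by linarith
  qed
  ultimately show ?thesis by (intro bexI[of _ "\<lambda>x. q (recode k x)"] ballI)
qed

lemma extend_near:
  assumes g: "g \<in> UCb M" and h: "h \<in> UCb M" and e: "\<forall>x\<in>Shift M. \<bar>h x - g x\<bar> \<le> e"
    and \<mu>: "prob_space \<mu>" "sets \<mu> = sets (borel_bar M)"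
  shows "(\<integral>x. extend M g x \<partial>\<mu>) - e \<le> (\<integral>x. extend M h x \<partial>\<mu>)"
proof -
  interpret prob_space \<mu> by (rule \<mu>)
  note G = extend_props[OF g] and H = extend_props[OF h]
  have sp: "space \<mu> = Shift_bar M" using sets_eq_imp_space_eq[OF \<mu>(2)] by simp
  have pt: "extend M g x - e \<le> extend M h x" if x: "x \<in> Shift_bar M" for x
  proof (rule field_le_epsilon)
    fix d :: real assume "0 < d"
    then have d: "0 < d / 2" by simp
    obtain k where k: "\<forall>y\<in>Shift_bar M. close_upto k x y \<longrightarrow> \<bar>extend M g x - extend M g y\<bar> < d / 2"
      using G(1) x d unfolding continuous_map_Shift_bar by blast
    obtain l where l: "\<forall>y\<in>Shift_bar M. close_upto l x y \<longrightarrow> \<bar>extend M h x - extend M h y\<bar> < d / 2"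
      using H(1) x d unfolding continuous_map_Shift_bar by blast
    obtain y where y: "y \<in> Shift M" "close_upto (max k l) x (emb y)" using x unfolding Shift_bar_iff by blast
    have "close_upto k x (emb y)" "close_upto l x (emb y)" by (rule close_upto_mono[OF y(2)], simp)+
    then have "\<bar>extend M g x - extend M g (emb y)\<bar> < d / 2" "\<bar>extend M h x - extend M h (emb y)\<bar> < d / 2"
      using k l emb_in_Shift_bar[OF y(1)] by blast+
    moreover have "\<bar>h y - g y\<bar> \<le> e" using e y(1) by blast
    ultimately show "extend M g x - e \<le> extend M h x + d"
      unfolding G(2)[OF y(1)] H(2)[OF y(1)] by linarith
  qed
  have "(\<integral>x. extend M g x - e \<partial>\<mu>) \<le> (\<integral>x. extend M h x \<partial>\<mu>)"
    using continuous_integrable[OF \<mu> G(1)] continuous_integrable[OF \<mu> H(1)] pt sp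
    by (intro integral_mono) auto
  then show ?thesis using continuous_integrable[OF \<mu> G(1)] by (simp add: prob_space)
qed

text \<open>
  Compactness of \<open>K\<close> for covers by the half spaces given by the pairs \<open>(g, c)\<close> of \<open>\<G>\<close>. Sequential
  compactness handles countable covers, and \<open>stable\<close> allows to replace \<open>\<G>\<close> by its countable part with
  step functions and rational bounds.
\<close>

lemma finite_subcover:
  fixes \<G> :: "(((nat \<Rightarrow> nat) \<Rightarrow> real) \<times> real) set"
  assumes K: "closedin (weak_star M) K"
    and UCb: "\<And>g c. (g, c) \<in> \<G> \<Longrightarrow> g \<in> UCb M"
    and stable: "\<And>g c h e. (g, c) \<in> \<G> \<Longrightarrow> h \<in> UCb M \<Longrightarrow> \<forall>x\<in>Shift M. \<bar>h x - g x\<bar> \<le> e \<Longrightarrow> (h, c + e) \<in> \<G>"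
    and cover: "\<And>\<nu>. \<nu> \<in> K \<Longrightarrow> \<exists>(g, c)\<in>\<G>. c < (\<integral>y. extend M g y \<partial>\<nu>)"
  shows "\<exists>F\<subseteq>\<G>. finite F \<and> (\<forall>\<nu>\<in>K. \<exists>(g, c)\<in>F. c < (\<integral>y. extend M g y \<partial>\<nu>))"
proof (cases "K = {}")
  case False
  define \<G>0 where "\<G>0 = \<G> \<inter> (step_functions \<times> \<rat>)"
  have count: "countable \<G>0"
    unfolding \<G>0_def using countable_step_functions countable_rat by (intro countable_Int2 countable_SIGMA)
  have KI: "K \<subseteq> inv_measures_bar M" using closedin_subset[OF K] by (simp add: topspace_weak_star)
  have cover0: "\<exists>(g, c)\<in>\<G>0. c < (\<integral>y. extend M g y \<partial>\<nu>)" if \<nu>: "\<nu> \<in> K" for \<nu>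
  proof -
    obtain g c where gc: "(g, c) \<in> \<G>" "c < (\<integral>y. extend M g y \<partial>\<nu>)" using cover[OF \<nu>] by blast
    \<comment> \<open>A quarter of the gap: one is lost in the integral and at most two in the bound \<open>c\<close>.\<close>
    define \<eta> where "\<eta> = ((\<integral>y. extend M g y \<partial>\<nu>) - c) / 4"
    have \<eta>: "0 < \<eta>" using gc(2) by (simp add: \<eta>_def)
    obtain s where s: "s \<in> step_functions" "\<forall>x\<in>Shift M. \<bar>s x - g x\<bar> \<le> \<eta>"
      using step_functions_dense[OF UCb[OF gc(1)] \<eta>] by blast
    have sU: "s \<in> UCb M" using s(1) by (rule step_functions_UCb)
    obtain c' where c': "c' \<in> \<rat>" "c + \<eta> < c'" "c' < c + 2 * \<eta>"
      using Rats_dense_in_real[of "c + \<eta>" "c + 2 * \<eta>"] \<eta> by auto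
    have "(s, c + \<eta>) \<in> \<G>" by (rule stable[OF gc(1) sU s(2)])
    then have "(s, (c + \<eta>) + (c' - (c + \<eta>))) \<in> \<G>"
      using c' by (intro stable[OF _ sU]) auto
    then have "(s, c') \<in> \<G>0" using s(1) c'(1) by (simp add: \<G>0_def)
    moreover have "(\<integral>y. extend M g y \<partial>\<nu>) - \<eta> \<le> (\<integral>y. extend M s y \<partial>\<nu>)"
      using \<nu> KI by (intro extend_near[OF UCb[OF gc(1)] sU s(2)] inv_measures_barD) auto
    moreover have "(\<integral>y. extend M g y \<partial>\<nu>) = c + 4 * \<eta>" by (simp add: \<eta>_def field_simps)
    ultimately show ?thesis using c'(3) \<eta> by (intro bexI[of _ "(s, c')"]) auto
  qed
  have ne: "\<G>0 \<noteq> {}" using False cover0 by blast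
  define e where "e = from_nat_into \<G>0"
  have eG: "e n \<in> \<G>0" for n unfolding e_def using ne by (rule from_nat_into)
  have "\<exists>n. \<forall>\<nu>\<in>K. \<exists>(g, c)\<in>e ` {..n}. c < (\<integral>y. extend M g y \<partial>\<nu>)"
  proof (rule ccontr)
    assume "\<not> ?thesis"
    then have "\<forall>n. \<exists>\<nu>. \<nu> \<in> K \<and> (\<forall>(g, c)\<in>e ` {..n}. (\<integral>y. extend M g y \<partial>\<nu>) \<le> c)"
      by (auto simp: not_less split_beta)
    from choice[OF this] obtain \<mu>s where
      \<mu>s: "\<forall>n. \<mu>s n \<in> K \<and> (\<forall>(g, c)\<in>e ` {..n}. (\<integral>y. extend M g y \<partial>\<mu>s n) \<le> c)" by (elim exE)
    have "\<mu>s n \<in> inv_measures_bar M" for n using \<mu>s KI by blast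
    then obtain r \<mu> where r: "strict_mono (r :: nat \<Rightarrow> nat)" "\<mu> \<in> inv_measures_bar M"
      "\<forall>f. continuous_map (Shift_bar_top M) euclideanreal f \<longrightarrow> (\<lambda>n. \<integral>x. f x \<partial>\<mu>s (r n)) \<longlonglongrightarrow> (\<integral>x. f x \<partial>\<mu>)"
      by (rule inv_measures_bar_seq_compact)
    have "\<mu> \<in> K" using \<mu>s by (intro weak_star_limit_in_closed[OF K _ r(2,3)]) blast
    then obtain g c where gc: "(g, c) \<in> \<G>0" "c < (\<integral>y. extend M g y \<partial>\<mu>)" using cover0 by blast
    obtain j where j: "e j = (g, c)"
      unfolding e_def using from_nat_into_surj[OF count gc(1)] by blast
    have gU: "g \<in> UCb M" using gc(1) UCb by (auto simp: \<G>0_def)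
    have "(\<lambda>n. \<integral>x. extend M g x \<partial>\<mu>s (r n)) \<longlonglongrightarrow> (\<integral>x. extend M g x \<partial>\<mu>)"
      using r(3) extend_props(1)[OF gU] by blast
    then have "(\<integral>x. extend M g x \<partial>\<mu>) \<le> c"
    proof (rule LIMSEQ_le_const2, intro exI[of _ j] allI impI)
      fix n assume "j \<le> n"
      then have "j \<le> r n" using strict_mono_imp_increasing[OF r(1), of n] by simp
      then have "(g, c) \<in> e ` {..r n}" using j by (metis atMost_iff image_eqI)
      then show "(\<integral>x. extend M g x \<partial>\<mu>s (r n)) \<le> c" using \<mu>s by blast
    qed
    then show False using gc(2) by simp
  qed
  then obtain n where "\<forall>\<nu>\<in>K. \<exists>(g, c)\<in>e ` {..n}. c < (\<integral>y. extend M g y \<partial>\<nu>)" by blast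
  moreover have "e ` {..n} \<subseteq> \<G>" using eG by (auto simp: \<G>0_def)
  ultimately show ?thesis by (intro exI[of _ "e ` {..n}"]) auto
qed auto

section \<open>The large deviation upper bound\<close>

lemma orbit_measure_eq_avg:
  "orbit_measure M n x = avg_measure (borel_bar M) n (\<lambda>k. return (borel_bar M) (emb ((shift ^^ k) x)))"
  by (simp add: orbit_measure_def avg_measure_def)

lemma integral_orbit_measure:
  assumes g: "g \<in> UCb M" and x: "x \<in> Shift M" and n: "0 < n"
  shows "(\<integral>y. extend M g y \<partial>orbit_measure M n x) = birkhoff_sum n g x / real n"
proof -
  note G = extend_props[OF g]
  have X: "emb ((shift ^^ k) x) \<in> Shift_bar M" for k by (intro emb_in_Shift_bar shift_pow_in_Shift x)
  have pr: "prob_space (return (borel_bar M) (emb ((shift ^^ k) x)))" for k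
    using X by (intro prob_space_return) simp
  have A: "measure_average (borel_bar M) n (\<lambda>k. return (borel_bar M) (emb ((shift ^^ k) x)))"
    unfolding measure_average_def using n pr by simp
  have i: "integrable (return (borel_bar M) (emb ((shift ^^ k) x))) (extend M g)" for k
    by (rule continuous_integrable[OF pr _ G(1)]) simp
  have v: "(\<integral>y. extend M g y \<partial>return (borel_bar M) (emb ((shift ^^ k) x))) = g ((shift ^^ k) x)" for k
    using integral_return[of "emb ((shift ^^ k) x)" "borel_bar M" "extend M g"] X continuous_measurable[OF G(1)]
      G(2)[OF shift_pow_in_Shift[OF x]] by simp
  show ?thesis
    unfolding orbit_measure_eq_avg measure_average.integrable_avg(2)[OF A i continuous_measurable[OF G(1)]] v
    by (simp add: birkhoff_sum_def)
qed

lemma ennreal_ratio_le: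
  assumes "a \<le> ennreal A" "ennreal B \<le> b" "0 \<le> A" "0 < B"
  shows "a / b \<le> ennreal (A / B)"
proof (cases "b = top")
  case False
  then obtain b' where b': "b = ennreal b'" "0 \<le> b'" by (cases b) auto
  then have le: "B \<le> b'" using assms(2) by simp
  have "a / b \<le> ennreal A / b" using assms(1) by (rule divide_right_mono_ennreal)
  also have "\<dots> = ennreal (A / b')" using b' le assms by (simp add: divide_ennreal)
  also have "\<dots> \<le> ennreal (A / B)" using le assms by (intro ennreal_leI divide_left_mono) auto
  finally show ?thesis .
qed simp

lemma elog_le:
  assumes "r \<le> ennreal (exp t)"
  shows "elog r \<le> ereal t"
proof (cases "r = 0")
  case False
  have top: "r \<noteq> top" using assms by (auto simp: top_unique)
  then obtain r' where r': "r = ennreal r'" "0 \<le> r'" by (cases r) auto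
  have pos: "0 < r'" using False r' by (cases "r' = 0") auto
  have "r' \<le> exp t" using assms r' by simp
  then have "ln r' \<le> t" using pos by (metis ln_exp ln_le_cancel_iff exp_gt_zero)
  then show ?thesis using False top r' by (simp add: elog_def)
qed (simp add: elog_def)

lemma Zper_perturb:
  assumes "\<forall>x\<in>Shift M. \<bar>h x - g x\<bar> \<le> e"
  shows "Zper M (\<lambda>x. \<phi> x + h x) a n \<le> ennreal (exp (real n * e)) * Zper M (\<lambda>x. \<phi> x + g x) a n"
  unfolding Zper_def
proof (rule infsum_ennreal_le)
  fix F assume F: "finite F" "F \<subseteq> Per M a n"
  have "(\<Sum>x\<in>F. ennreal (exp (birkhoff_sum n (\<lambda>x. \<phi> x + h x) x)))
      \<le> (\<Sum>x\<in>F. ennreal (exp (real n * e)) * ennreal (exp (birkhoff_sum n (\<lambda>x. \<phi> x + g x) x)))"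
  proof (rule sum_mono)
    fix x assume "x \<in> F"
    then have x: "x \<in> Shift M" using F Per_D(1) by blast
    have "birkhoff_sum n h x \<le> (\<Sum>k<n. e + g ((shift ^^ k) x))"
      unfolding birkhoff_sum_def
    proof (rule sum_mono)
      fix k
      have "\<bar>h ((shift ^^ k) x) - g ((shift ^^ k) x)\<bar> \<le> e" using assms shift_pow_in_Shift[OF x] by blast
      then show "h ((shift ^^ k) x) \<le> e + g ((shift ^^ k) x)" by linarith
    qed
    also have "\<dots> = real n * e + birkhoff_sum n g x" by (simp add: sum.distrib birkhoff_sum_def)
    finally have "exp (birkhoff_sum n (\<lambda>x. \<phi> x + h x) x) \<le> exp (real n * e) * exp (birkhoff_sum n (\<lambda>x. \<phi> x + g x) x)"
      unfolding exp_add[symmetric] birkhoff_sum_add by simp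
    then show "ennreal (exp (birkhoff_sum n (\<lambda>x. \<phi> x + h x) x))
        \<le> ennreal (exp (real n * e)) * ennreal (exp (birkhoff_sum n (\<lambda>x. \<phi> x + g x) x))"
      by (subst ennreal_mult[symmetric]) (auto intro: ennreal_leI)
  qed
  also have "\<dots> = ennreal (exp (real n * e)) * (\<Sum>x\<in>F. ennreal (exp (birkhoff_sum n (\<lambda>x. \<phi> x + g x) x)))"
    by (rule sum_distrib_left[symmetric])
  also have "\<dots> \<le> ennreal (exp (real n * e)) * (\<Sum>\<^sub>\<infinity>x\<in>Per M a n. ennreal (exp (birkhoff_sum n (\<lambda>x. \<phi> x + g x) x)))"
    by (intro mult_left_mono sum_le_infsum_ennreal F) simp
  finally show "(\<Sum>x\<in>F. ennreal (exp (birkhoff_sum n (\<lambda>x. \<phi> x + h x) x)))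
      \<le> ennreal (exp (real n * e)) * (\<Sum>\<^sub>\<infinity>x\<in>Per M a n. ennreal (exp (birkhoff_sum n (\<lambda>x. \<phi> x + g x) x)))" .
qed

lemma pressure_not_MInfty:
  assumes mix: "topologically_mixing M" and m\<phi>: "\<phi> \<in> borel_measurable (borel_Shift M)" and V: "bounded_distortion M \<phi> V"
  shows "pressure M \<phi> \<noteq> -\<infinity>"
proof -
  obtain n where n: "0 < n" "Per M 0 n \<noteq> {}" using mixing_Per_nonempty[OF mix, of 0] by blast
  then obtain x where x: "x \<in> Per M 0 n" by blast
  have D: "\<bar>birkhoff_sum n \<phi> x - birkhoff_sum n \<phi> y\<bar> \<le> V" if "x \<in> Shift M" "y \<in> Shift M" "\<forall>i\<le>n. x i = y i" for x y
    using V that unfolding bounded_distortion_def by blast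
  have "ereal ((ln (\<Sum>x\<in>{x}. exp (birkhoff_sum n \<phi> x)) - V) / real n) \<le> pressure M \<phi>"
    using x by (intro pressure_ge_periodic_sum[OF n(1) _ _ _ m\<phi> bounded_imp_tempered[OF V] D]) auto
  then show ?thesis by auto
qed

text \<open>
  Chebyshev's inequality: if the orbit measure of \<open>x\<close> lies in the half space of \<open>(g, c)\<close>, then
  \<open>n * c < birkhoff_sum n g x\<close>, and the weight of \<open>x\<close> for \<open>\<phi>\<close> is at most \<open>exp (- n * c)\<close> times its weight
  for \<open>\<phi> + g\<close>.
\<close>

lemma restricted_sum_le:
  assumes F: "finite F" and n: "0 < n"
    and UCb: "\<And>g c. (g, c) \<in> F \<Longrightarrow> g \<in> UCb M"
    and cover: "\<forall>\<nu>\<in>K. \<exists>(g, c)\<in>F. c < (\<integral>y. extend M g y \<partial>\<nu>)"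
    and Z: "\<And>g c. (g, c) \<in> F \<Longrightarrow> Zper M (\<lambda>x. \<phi> x + g x) a n \<le> ennreal (exp (real n * (c - b)))"
  shows "(\<Sum>\<^sub>\<infinity>x\<in>{x \<in> Per M a n. orbit_measure M n x \<in> K}. ennreal (exp (birkhoff_sum n \<phi> x)))
    \<le> ennreal (real (card F) * exp (- real n * b))"
proof (rule infsum_ennreal_le)
  fix H assume H: "finite H" "H \<subseteq> {x \<in> Per M a n. orbit_measure M n x \<in> K}"
  let ?w = "\<lambda>g c x. ennreal (exp (- real n * c)) * ennreal (exp (birkhoff_sum n (\<lambda>x. \<phi> x + g x) x))"
  have "(\<Sum>x\<in>H. ennreal (exp (birkhoff_sum n \<phi> x))) \<le> (\<Sum>x\<in>H. \<Sum>(g, c)\<in>F. ?w g c x)"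
  proof (rule sum_mono)
    fix x assume "x \<in> H"
    then have x: "x \<in> Per M a n" "orbit_measure M n x \<in> K" using H by auto
    obtain g c where gc: "(g, c) \<in> F" "c < (\<integral>y. extend M g y \<partial>orbit_measure M n x)" using cover x(2) by blast
    have "c < birkhoff_sum n g x / real n"
      using gc(2) integral_orbit_measure[OF UCb[OF gc(1)] Per_D(1)[OF x(1)] n] by simp
    then have "real n * c \<le> birkhoff_sum n g x" using n by (simp add: field_simps)
    then have "exp (birkhoff_sum n \<phi> x) \<le> exp (- real n * c) * exp (birkhoff_sum n (\<lambda>x. \<phi> x + g x) x)"
      unfolding exp_add[symmetric] birkhoff_sum_add by simp
    then have "ennreal (exp (birkhoff_sum n \<phi> x)) \<le> ?w g c x"
      by (subst ennreal_mult[symmetric]) (auto intro: ennreal_leI)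
    also have "\<dots> = (\<lambda>(g, c). ?w g c x) (g, c)" by simp
    also have "\<dots> \<le> (\<Sum>(g, c)\<in>F. ?w g c x)"
      using F gc(1) by (intro member_le_sum) auto
    finally show "ennreal (exp (birkhoff_sum n \<phi> x)) \<le> (\<Sum>(g, c)\<in>F. ?w g c x)" .
  qed
  also have "\<dots> = (\<Sum>(g, c)\<in>F. \<Sum>x\<in>H. ?w g c x)"
    by (subst sum.swap) (simp add: case_prod_unfold)
  also have "\<dots> \<le> (\<Sum>(g, c)\<in>F. ennreal (exp (- real n * b)))"
  proof (rule sum_mono, clarify)
    fix g c assume gc: "(g, c) \<in> F"
    have "(\<Sum>x\<in>H. ?w g c x) = ennreal (exp (- real n * c)) * (\<Sum>x\<in>H. ennreal (exp (birkhoff_sum n (\<lambda>x. \<phi> x + g x) x)))"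
      by (rule sum_distrib_left[symmetric])
    also have "\<dots> \<le> ennreal (exp (- real n * c)) * Zper M (\<lambda>x. \<phi> x + g x) a n"
      unfolding Zper_def using H by (intro mult_left_mono sum_le_infsum_ennreal) auto
    also have "\<dots> \<le> ennreal (exp (- real n * c)) * ennreal (exp (real n * (c - b)))"
      by (intro mult_left_mono Z gc) simp
    also have "\<dots> = ennreal (exp (- real n * b))"
      by (subst ennreal_mult[symmetric]) (simp_all add: exp_add[symmetric] algebra_simps)
    finally show "(\<Sum>x\<in>H. ?w g c x) \<le> ennreal (exp (- real n * b))" .
  qed
  also have "\<dots> = ennreal (real (card F) * exp (- real n * b))"
    by (simp add: ennreal_mult ennreal_of_nat_eq_real_of_nat)
  finally show "(\<Sum>x\<in>H. ennreal (exp (birkhoff_sum n \<phi> x))) \<le> ennreal (real (card F) * exp (- real n * b))" .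
qed

theorem theorem1p1:
  fixes M :: "nat \<Rightarrow> nat \<Rightarrow> bool"
    and \<phi> :: "(nat \<Rightarrow> nat) \<Rightarrow> real"
    and a :: nat
    and K :: "(nat \<Rightarrow> enat) measure set"
  assumes "topologically_mixing M"
    and "summable_variations M \<phi>"
    and "pressure M \<phi> < \<infinity>"
    and "closedin (weak_star M) K"
  shows "limsup (\<lambda>n. ereal (1 / real n) *
           elog ((\<Sum>\<^sub>\<infinity>x\<in>{x \<in> Per M a n. orbit_measure M n x \<in> K}. ennreal (exp (birkhoff_sum n \<phi> x)))
                 / (\<Sum>\<^sub>\<infinity>x\<in>Per M a n. ennreal (exp (birkhoff_sum n \<phi> x)))))
         \<le> - (INF \<nu>\<in>K. rate M \<phi> \<nu>)"
    (is "limsup ?L \<le> - ?inf")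
proof (rule ccontr)
  assume "\<not> limsup ?L \<le> - ?inf"
  then have "- ?inf < limsup ?L" by (rule not_le_imp_less)
  then have gap: "- limsup ?L < ?inf" by (subst ereal_uminus_less_reorder)
  obtain \<alpha> where \<alpha>: "- limsup ?L < ereal \<alpha>" "ereal \<alpha> < ?inf"
    using ereal_dense2[OF gap] by (elim exE conjE)
  \<comment> \<open>The gap between \<open>\<beta>\<close> and \<open>\<alpha>\<close> absorbs the error in the lower bound for the denominator.\<close>
  obtain \<beta> where \<beta>: "- limsup ?L < ereal \<beta>" "ereal \<beta> < ereal \<alpha>"
    using ereal_dense2[OF \<alpha>(1)] by (elim exE conjE)
  define \<eta> where "\<eta> = \<alpha> - \<beta>"
  have \<eta>: "0 < \<eta>" using \<beta>(2) by (simp add: \<eta>_def)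
  note mix = assms(1)
  have m\<phi>: "\<phi> \<in> borel_measurable (borel_Shift M)" by (rule summable_variations_measurable[OF assms(2)])
  obtain V where V: "0 \<le> V" "bounded_distortion M \<phi> V" by (rule summable_variations_bounded_distortion[OF assms(2)])
  obtain P where P: "pressure M \<phi> = ereal P"
    using assms(3) pressure_not_MInfty[OF mix m\<phi> V(2)] by (cases "pressure M \<phi>") auto
  \<comment> \<open>Stated with the growth of the periodic sums of \<open>\<phi> + g\<close> in place of its pressure, since the former is visibly stable under small changes of \<open>g\<close>.\<close>
  define \<G> where "\<G> = {(g, c). g \<in> UCb M \<and>
    eventually (\<lambda>n. Zper M (\<lambda>x. \<phi> x + g x) a n \<le> ennreal (exp (real n * (c - (\<alpha> - P))))) sequentially}"
  have "\<exists>F\<subseteq>\<G>. finite F \<and> (\<forall>\<nu>\<in>K. \<exists>(g, c)\<in>F. c < (\<integral>y. extend M g y \<partial>\<nu>))"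
  proof (rule finite_subcover[OF assms(4)])
    show "g \<in> UCb M" if "(g, c) \<in> \<G>" for g c using that by (simp add: \<G>_def)
  next
    fix g c h e assume gc: "(g, c) \<in> \<G>" and h: "h \<in> UCb M" and near: "\<forall>x\<in>Shift M. \<bar>h x - g x\<bar> \<le> e"
    have "eventually (\<lambda>n. Zper M (\<lambda>x. \<phi> x + g x) a n \<le> ennreal (exp (real n * (c - (\<alpha> - P))))) sequentially"
      using gc by (simp add: \<G>_def)
    then have "eventually (\<lambda>n. Zper M (\<lambda>x. \<phi> x + h x) a n \<le> ennreal (exp (real n * (c + e - (\<alpha> - P))))) sequentially"
    proof eventually_elim
      case (elim n)
      have "Zper M (\<lambda>x. \<phi> x + h x) a n \<le> ennreal (exp (real n * e)) * Zper M (\<lambda>x. \<phi> x + g x) a n"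
        by (rule Zper_perturb[OF near])
      also have "\<dots> \<le> ennreal (exp (real n * e)) * ennreal (exp (real n * (c - (\<alpha> - P))))"
        using elim by (rule mult_left_mono) simp
      also have "\<dots> = ennreal (exp (real n * (c + e - (\<alpha> - P))))"
        by (subst ennreal_mult[symmetric]) (simp_all add: exp_add[symmetric] algebra_simps)
      finally show ?case .
    qed
    then show "(h, c + e) \<in> \<G>" using h by (simp add: \<G>_def)
  next
    fix \<nu> assume "\<nu> \<in> K"
    then have "?inf \<le> rate M \<phi> \<nu>" by (rule INF_lower)
    with \<alpha>(2) have "ereal \<alpha> < rate M \<phi> \<nu>" by simp
    then obtain g where g: "g \<in> UCb M"
      "ereal \<alpha> < ereal (\<integral>y. extend M g y \<partial>\<nu>) - pressure M (\<lambda>x. \<phi> x + g x) + pressure M \<phi>"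
      unfolding rate_def less_SUP_iff by blast
    then have "pressure M (\<lambda>x. \<phi> x + g x) < ereal ((\<integral>y. extend M g y \<partial>\<nu>) + P - \<alpha>)"
      unfolding P by (cases "pressure M (\<lambda>x. \<phi> x + g x)") auto
    from ereal_dense2[OF this]
    obtain q where q: "pressure M (\<lambda>x. \<phi> x + g x) < ereal q" "ereal q < ereal ((\<integral>y. extend M g y \<partial>\<nu>) + P - \<alpha>)"
      by (elim exE conjE)
    have "eventually (\<lambda>n. Zper M (\<lambda>x. \<phi> x + g x) a n \<le> ennreal (exp (real n * q))) sequentially"
    proof (rule eventually_Zper_le[OF _ _ q(1)])
      have "g \<in> borel_measurable (borel_Shift M)"
        by (rule measurable_Shift_locally_determined[OF UCb_locally_determined[OF g(1)]])
      then show "(\<lambda>x. \<phi> x + g x) \<in> borel_measurable (borel_Shift M)"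
        using m\<phi> by (intro borel_measurable_add)
      show "tempered_distortion M (\<lambda>x. \<phi> x + g x)"
        by (rule tempered_distortion_add[OF bounded_imp_tempered[OF V(2)] UCb_tempered_distortion[OF g(1)]])
    qed
    then have "(g, q + \<alpha> - P) \<in> \<G>" using g(1) by (simp add: \<G>_def)
    moreover have "q + \<alpha> - P < (\<integral>y. extend M g y \<partial>\<nu>)" using q(2) by simp
    ultimately show "\<exists>(g, c)\<in>\<G>. c < (\<integral>y. extend M g y \<partial>\<nu>)" by (intro bexI[of _ "(g, q + \<alpha> - P)"]) auto
  qed
  then obtain F where F: "F \<subseteq> \<G>" "finite F" "\<forall>\<nu>\<in>K. \<exists>(g, c)\<in>F. c < (\<integral>y. extend M g y \<partial>\<nu>)" by blast
  have "eventually (\<lambda>n. \<forall>(g, c)\<in>F. Zper M (\<lambda>x. \<phi> x + g x) a n \<le> ennreal (exp (real n * (c - (\<alpha> - P))))) sequentially"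
    using F(1,2) by (intro eventually_ball_finite) (auto simp: \<G>_def)
  moreover have "eventually (\<lambda>n. ennreal (exp (real n * (P - \<eta>))) \<le> Zper M \<phi> a n) sequentially"
    using \<eta> P by (intro eventually_Zper_ge[OF mix V(2) m\<phi> assms(3)]) simp
  moreover have "eventually (\<lambda>n::nat. 0 < n) sequentially" by (rule eventually_gt_at_top)
  ultimately have "eventually (\<lambda>n. ?L n \<le> ereal (ln (1 + real (card F)) / real n - \<beta>)) sequentially"
  proof eventually_elim
    case (elim n)
    let ?N = "\<Sum>\<^sub>\<infinity>x\<in>{x \<in> Per M a n. orbit_measure M n x \<in> K}. ennreal (exp (birkhoff_sum n \<phi> x))"
    have "?N \<le> ennreal (real (card F) * exp (- real n * (\<alpha> - P)))"
      using elim(1) F by (intro restricted_sum_le[OF F(2) elim(3) _ F(3)]) (auto simp: \<G>_def)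
    also have "\<dots> \<le> ennreal ((1 + real (card F)) * exp (- real n * (\<alpha> - P)))"
      by (intro ennreal_leI mult_right_mono) auto
    finally have "?N / Zper M \<phi> a n \<le> ennreal ((1 + real (card F)) * exp (- real n * (\<alpha> - P)) / exp (real n * (P - \<eta>)))"
      using elim(2) by (intro ennreal_ratio_le) auto
    also have "(1 + real (card F)) * exp (- real n * (\<alpha> - P)) / exp (real n * (P - \<eta>)) = exp (ln (1 + real (card F)) - real n * \<beta>)"
    proof -
      have pos: "0 < 1 + real (card F)" by simp
      have split: "exp (ln (1 + real (card F)) - real n * \<beta>) = exp (ln (1 + real (card F)) + (- real n * (\<alpha> - P)) - real n * (P - \<eta>))"
        by (simp add: \<eta>_def algebra_simps)
      show ?thesis by (subst split) (simp only: exp_diff exp_add exp_ln[OF pos])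
    qed
    finally have "elog (?N / Zper M \<phi> a n) \<le> ereal (ln (1 + real (card F)) - real n * \<beta>)" by (rule elog_le)
    then have "ereal (1 / real n) * elog (?N / Zper M \<phi> a n) \<le> ereal (1 / real n) * ereal (ln (1 + real (card F)) - real n * \<beta>)"
      by (intro ereal_mult_left_mono) auto
    also have "\<dots> = ereal (ln (1 + real (card F)) / real n - \<beta>)"
      using elim(3) by (simp add: field_simps)
    finally show ?case by (simp only: Zper_def)
  qed
  then have "limsup ?L \<le> limsup (\<lambda>n. ereal (ln (1 + real (card F)) / real n - \<beta>))" by (rule Limsup_mono)
  also have "\<dots> = ereal (0 - \<beta>)"
    by (intro lim_imp_Limsup tendsto_ereal tendsto_diff lim_const_over_n tendsto_const) simp
  finally have "limsup ?L \<le> - ereal \<beta>" by simp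
  then have "- (- ereal \<beta>) \<le> - limsup ?L" unfolding ereal_minus_le_minus .
  then have "ereal \<beta> \<le> - limsup ?L" by (simp only: ereal_uminus_uminus)
  then show False using \<beta>(1) by (meson leD)
qed

end
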